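(* Let $I,J\in\binom{[n]}{k}$ and let $d\ge0$ be an integer such that $(I,J,d)$ is valid. Then $q_1(q_2^{-1}(Y(I,J,d)))=S(I,J,d)$.
   Context: Fix integers $0\le k\le n$; $\binom{[n]}{k}$ is the set of $k$-element subsets of $[n]=\{1,\dots,n\}$. $\mathrm{Gr}(k,n)$ is the Grassmannian of $k$-planes in $\mathbb C^n$; for $S\subseteq[n]$, $\mathrm{Project}_S:\mathbb C^n\to\mathbb C^S$ is the coordinate projection. $X_J=\{V:\dim\mathrm{Project}_{[j]}(V)\le\#(J\cap[j])\ \forall j\}$, $X^I=\{V:\dim\mathrm{Project}_{[n-j+1,n]}(V)\le\#(I\cap[n-j+1,n])\ \forall j\}$. $M_{0,3}(d)$ is the moduli space of genus-zero, 3-pointed stable maps of degree $d$ to $\mathrm{Gr}(k,n)$ (degree with respect to the Plücker embedding), with evaluation maps $p_1,p_2,p_3$. $E(I,J,d)=p_1^{-1}(X_J)\cap p_2^{-1}(X^I)$ and $S(I,J,d)=p_3(E(I,J,d))\subseteq\mathrm{Gr}(k,n)$. Write $I=\{i_1<\dots<i_k\}$, $J=\{j_1<\dots<j_k\}$, $[n]\setminus I=\{m_1<\dots<m_{n-k}\}$, $[n]\setminus J=\{l_1<\dots<l_{n-k}\}$, extended to $\mathbb Z$-indices by $i_{r+k}=i_r+n$, $j_{r+k}=j_r+n$, $m_{r+n-k}=m_r+n$, $l_{r+n-k}=l_r+n$. Define $f:\mathbb Z\to\mathbb Z$ by $f(i_r)=j_{r+k-d}$, $f(m_r)=l_{r+d}$.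 $(I,J,d)$ is valid if $a\le f(a)\le a+n$ for all $a\in\mathbb Z$. $\mathrm{Fl}(k-d,k,k+d;n)$ and $\mathrm{Fl}(k-d,k+d;n)$ are the varieties of partial flags in $\mathbb C^n$ with subspaces of dimensions $(k-d,k,k+d)$ and $(k-d,k+d)$; $q_1:\mathrm{Fl}(k-d,k,k+d;n)\to\mathrm{Gr}(k,n)$ and $q_2:\mathrm{Fl}(k-d,k,k+d;n)\to\mathrm{Fl}(k-d,k+d;n)$ are the forgetful maps. For $X\subset\mathrm{Gr}(k,n)$, $X^{(d)}=q_2(q_1^{-1}(X))$, and $Y(I,J,d)=(X_J)^{(d)}\cap(X^I)^{(d)}\subset\mathrm{Fl}(k-d,k+d;n)$. *)

theory Defs
  imports "HOL-Library.Function_Algebras" "Jordan_Normal_Form.Determinant"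
begin

section \<open>Coordinate spaces and Grassmannians\<close>

text \<open>
  A vector is a function on the natural numbers, and \<open>\<complex>\<^sup>S\<close> consists of the vectors supported
  in \<open>S\<close>; in particular \<open>\<complex>\<^sup>n\<close> is \<open>coord_space {1..n}\<close>. Addition of vectors is pointwise.
  Varieties are identified with their sets of complex points.
\<close>

type_synonym cvec = "nat \<Rightarrow> complex"

definition scl :: "complex \<Rightarrow> cvec \<Rightarrow> cvec" where
  "scl c v = (\<lambda>i. c * v i)"

global_interpretation cvec: vector_space scl
  by unfold_locales (auto simp: scl_def fun_eq_iff algebra_simps)

definition coord_space :: "nat set \<Rightarrow> cvec set" where
  "coord_space S = {v. \<forall>i. i \<notin> S \<longrightarrow> v i = 0}"

definition project :: "nat set \<Rightarrow> cvec \<Rightarrow> cvec" where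
  "project S v = (\<lambda>i. if i \<in> S then v i else 0)"

definition ksubsets :: "nat \<Rightarrow> nat \<Rightarrow> nat set set" where
  "ksubsets k n = {S. S \<subseteq> {1..n} \<and> card S = k}"

definition Gr :: "nat \<Rightarrow> nat \<Rightarrow> cvec set set" where
  "Gr k n = {V. cvec.subspace V \<and> V \<subseteq> coord_space {1..n} \<and> cvec.dim V = k}"

definition schubert :: "nat \<Rightarrow> nat \<Rightarrow> nat set \<Rightarrow> cvec set set" where
  "schubert k n J = {V \<in> Gr k n.
     \<forall>j\<le>n. cvec.dim (project {1..j} ` V) \<le> card (J \<inter> {1..j})}"

definition opp_schubert :: "nat \<Rightarrow> nat \<Rightarrow> nat set \<Rightarrow> cvec set set" where
  "opp_schubert k n I = {V \<in> Gr k n.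
     \<forall>j\<le>n. cvec.dim (project {n-j+1..n} ` V) \<le> card (I \<inter> {n-j+1..n})}"


section \<open>Morphisms from the projective line to a Grassmannian\<close>

text \<open>The projective line is the set of lines in \<open>\<complex>\<^sup>2\<close>.\<close>

abbreviation P1 :: "cvec set set" where
  "P1 \<equiv> Gr 1 2"

definition P1_automorphism :: "(cvec set \<Rightarrow> cvec set) \<Rightarrow> bool" where
  "P1_automorphism \<phi> \<longleftrightarrow>
     (\<exists>A. Vector_Spaces.linear scl scl A \<and> bij_betw A (coord_space {1..2}) (coord_space {1..2}) \<and>
          (\<forall>L\<in>P1. \<phi> L = A ` L))"

definition binary_form :: "nat \<Rightarrow> (cvec \<Rightarrow> complex) \<Rightarrow> bool" where
  "binary_form e p \<longleftrightarrow> (\<exists>a. \<forall>x. p x = (\<Sum>i\<le>e. a i * x 1 ^ i * x 2 ^ (e - i)))"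

text \<open>The maximal minors, with columns indexed by \<open>S\<close>, of the matrix with rows \<open>b 0, \<dots>, b (k - 1)\<close>.\<close>

definition minor :: "nat \<Rightarrow> (nat \<Rightarrow> cvec) \<Rightarrow> nat set \<Rightarrow> complex" where
  "minor k b S = det (mat k k (\<lambda>(r, c). b r (sorted_list_of_set S ! c)))"

text \<open>
  \<open>p\<close> is a vector of homogeneous Pluecker coordinates of \<open>V\<close>; such a vector is unique up to a
  nonzero scalar. As \<open>V\<close> has dimension \<open>k\<close>, the \<open>k\<close> vectors \<open>b r\<close> spanning it form a basis.
\<close>

definition pluecker_coords :: "nat \<Rightarrow> nat \<Rightarrow> cvec set \<Rightarrow> (nat set \<Rightarrow> complex) \<Rightarrow> bool" where
  "pluecker_coords k n V p \<longleftrightarrow> V \<in> Gr k n \<and>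
     (\<exists>b c. c \<noteq> 0 \<and> cvec.span (b ` {..<k}) = V \<and> (\<forall>S\<in>ksubsets k n. p S = c * minor k b S))"

text \<open>
  \<open>F\<close> is a morphism \<open>P1 \<rightarrow> Gr k n\<close> of degree \<open>e\<close> with respect to the Pluecker embedding: after
  composing with the embedding it is given by binary forms of degree \<open>e\<close>. These have no common
  zero, because the homogeneous coordinates of a point do not all vanish.
\<close>

definition morphism_of_degree :: "nat \<Rightarrow> nat \<Rightarrow> nat \<Rightarrow> (cvec set \<Rightarrow> cvec set) \<Rightarrow> bool" where
  "morphism_of_degree k n e F \<longleftrightarrow>
     (\<exists>P. (\<forall>S\<in>ksubsets k n. binary_form e (P S)) \<and>
          (\<forall>x\<in>coord_space {1..2} - {0}.
              pluecker_coords k n (F (cvec.span {x})) (\<lambda>S. P S x)))"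


section \<open>Three-pointed stable maps of genus zero\<close>

text \<open>
  A connected nodal curve of arithmetic genus zero is a tree of projective lines. Its components
  are labelled by the finite set \<open>comps\<close>; the symmetric relation \<open>edges\<close> records which
  components meet, and \<open>node C v w\<close> is the point of component \<open>v\<close> that is glued to
  component \<open>w\<close>. The \<open>i\<close>-th marked point (\<open>i = 1, 2, 3\<close>) is \<open>mark_pt C i\<close> on component
  \<open>mark_comp C i\<close>. A morphism from the curve is a family of morphisms on the components that
  agree at the nodes.
\<close>

record pointed_map =
  comps :: "nat set"
  edges :: "(nat \<times> nat) set"
  node :: "nat \<Rightarrow> nat \<Rightarrow> cvec set"
  mark_comp :: "nat \<Rightarrow> nat"
  mark_pt :: "nat \<Rightarrow> cvec set"
  cmap :: "nat \<Rightarrow> cvec set \<Rightarrow> cvec set"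

text \<open>
  The last condition says that the arithmetic genus \<open>#edges - #comps + 1\<close> is zero; every edge
  occurs in \<open>edges\<close> with both orientations.
\<close>

definition tree_of_lines :: "pointed_map \<Rightarrow> bool" where
  "tree_of_lines C \<longleftrightarrow>
     finite (comps C) \<and> comps C \<noteq> {} \<and>
     edges C \<subseteq> comps C \<times> comps C \<and> sym (edges C) \<and> irrefl (edges C) \<and>
     (\<forall>v\<in>comps C. \<forall>w\<in>comps C. (v, w) \<in> (edges C)\<^sup>*) \<and>
     card (edges C) + 2 = 2 * card (comps C)"

definition special_points :: "pointed_map \<Rightarrow> nat \<Rightarrow> cvec set set" where
  "special_points C v =
     node C v ` (edges C `` {v}) \<union> {mark_pt C i | i. i \<in> {1,2,3} \<and> mark_comp C i = v}"

text \<open>The marked points are smooth points of the curve and pairwise distinct.\<close>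

definition prestable_curve :: "pointed_map \<Rightarrow> bool" where
  "prestable_curve C \<longleftrightarrow>
     tree_of_lines C \<and>
     (\<forall>v\<in>comps C. node C v ` (edges C `` {v}) \<subseteq> P1 \<and> inj_on (node C v) (edges C `` {v})) \<and>
     (\<forall>i\<in>{1,2,3}. mark_comp C i \<in> comps C \<and> mark_pt C i \<in> P1 \<and>
        mark_pt C i \<notin> node C (mark_comp C i) ` (edges C `` {mark_comp C i})) \<and>
     inj_on (\<lambda>i. (mark_comp C i, mark_pt C i)) {1,2,3}"

definition stable_map :: "nat \<Rightarrow> nat \<Rightarrow> nat \<Rightarrow> pointed_map \<Rightarrow> bool" where
  "stable_map k n d C \<longleftrightarrow>
     prestable_curve C \<and>
     (\<exists>e. (\<forall>v\<in>comps C. morphism_of_degree k n (e v) (cmap C v)) \<and> (\<Sum>v\<in>comps C. e v) = d) \<and>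
     (\<forall>(v, w)\<in>edges C. cmap C v (node C v w) = cmap C w (node C w v)) \<and>
     (\<forall>v\<in>comps C. (\<exists>V. \<forall>L\<in>P1. cmap C v L = V) \<longrightarrow> card (special_points C v) \<ge> 3)"

definition isomorphic_maps :: "pointed_map \<Rightarrow> pointed_map \<Rightarrow> bool" where
  "isomorphic_maps C C' \<longleftrightarrow>
     (\<exists>\<sigma> \<phi>. bij_betw \<sigma> (comps C) (comps C') \<and>
        (\<forall>v\<in>comps C. P1_automorphism (\<phi> v)) \<and>
        (\<forall>v\<in>comps C. \<forall>w\<in>comps C. (\<sigma> v, \<sigma> w) \<in> edges C' \<longleftrightarrow> (v, w) \<in> edges C) \<and>
        (\<forall>(v, w)\<in>edges C. node C' (\<sigma> v) (\<sigma> w) = \<phi> v (node C v w)) \<and>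
        (\<forall>i\<in>{1,2,3}. mark_comp C' i = \<sigma> (mark_comp C i) \<and>
           mark_pt C' i = \<phi> (mark_comp C i) (mark_pt C i)) \<and>
        (\<forall>v\<in>comps C. \<forall>L\<in>P1. cmap C' (\<sigma> v) (\<phi> v L) = cmap C v L))"

text \<open>The points of the moduli space are the isomorphism classes of stable maps.\<close>

definition M03 :: "nat \<Rightarrow> nat \<Rightarrow> nat \<Rightarrow> pointed_map set set" where
  "M03 k n d = {C. stable_map k n d C} //
     {(C, C'). stable_map k n d C \<and> stable_map k n d C' \<and> isomorphic_maps C C'}"

text \<open>All members of an isomorphism class have the same value at the \<open>i\<close>-th marked point.\<close>

definition ev :: "nat \<Rightarrow> pointed_map set \<Rightarrow> cvec set" where
  "ev i X = the_elem ((\<lambda>C. cmap C (mark_comp C i) (mark_pt C i)) ` X)"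

definition E_locus :: "nat \<Rightarrow> nat \<Rightarrow> nat set \<Rightarrow> nat set \<Rightarrow> nat \<Rightarrow> pointed_map set set" where
  "E_locus k n I J d = {X \<in> M03 k n d. ev 1 X \<in> schubert k n J \<and> ev 2 X \<in> opp_schubert k n I}"

definition S_locus :: "nat \<Rightarrow> nat \<Rightarrow> nat set \<Rightarrow> nat set \<Rightarrow> nat \<Rightarrow> cvec set set" where
  "S_locus k n I J d = ev 3 ` E_locus k n I J d"


section \<open>Valid triples\<close>

text \<open>
  For \<open>A = {a\<^sub>1 < \<dots> < a\<^sub>s}\<close> nonempty, \<open>ext_seq n A r\<close> is \<open>a\<^sub>r\<close>, extended to integer indices by
  \<open>a\<^sub>r\<^sub>+\<^sub>s = a\<^sub>r + n\<close>; list positions start at \<open>0\<close>.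
\<close>

definition ext_seq :: "nat \<Rightarrow> nat set \<Rightarrow> int \<Rightarrow> int" where
  "ext_seq n A r = int (sorted_list_of_set A ! nat ((r - 1) mod int (card A)))
                   + int n * ((r - 1) div int (card A))"

text \<open>
  For \<open>n > 0\<close> every integer occurs exactly once among the extended elements of \<open>I\<close> and of its
  complement, so the conditions below determine \<open>f\<close>. An empty set has no extended elements and
  imposes no condition.
\<close>

definition is_juggling_fun ::
  "nat \<Rightarrow> nat \<Rightarrow> nat set \<Rightarrow> nat set \<Rightarrow> nat \<Rightarrow> (int \<Rightarrow> int) \<Rightarrow> bool" where
  "is_juggling_fun k n I J d f \<longleftrightarrow>
     (I \<noteq> {} \<longrightarrow> (\<forall>r. f (ext_seq n I r) = ext_seq n J (r + int k - int d))) \<and>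
     ({1..n} - I \<noteq> {} \<longrightarrow>
        (\<forall>r. f (ext_seq n ({1..n} - I) r) = ext_seq n ({1..n} - J) (r + int d)))"

definition valid_triple :: "nat \<Rightarrow> nat \<Rightarrow> nat set \<Rightarrow> nat set \<Rightarrow> nat \<Rightarrow> bool" where
  "valid_triple k n I J d \<longleftrightarrow>
     (\<exists>f. is_juggling_fun k n I J d f \<and> (\<forall>a. a \<le> f a \<and> f a \<le> a + int n))"


section \<open>Partial flags\<close>

text \<open>Both flag varieties are empty if \<open>k < d\<close> or \<open>n < k + d\<close>.\<close>

definition Fl3 :: "nat \<Rightarrow> nat \<Rightarrow> nat \<Rightarrow> (cvec set \<times> cvec set \<times> cvec set) set" where
  "Fl3 k n d = {(A, V, B). d \<le> k \<and> A \<in> Gr (k - d) n \<and> V \<in> Gr k n \<and> B \<in> Gr (k + d) n \<and>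
                            A \<subseteq> V \<and> V \<subseteq> B}"

definition Fl2 :: "nat \<Rightarrow> nat \<Rightarrow> nat \<Rightarrow> (cvec set \<times> cvec set) set" where
  "Fl2 k n d = {(A, B). d \<le> k \<and> A \<in> Gr (k - d) n \<and> B \<in> Gr (k + d) n \<and> A \<subseteq> B}"

definition q1 :: "cvec set \<times> cvec set \<times> cvec set \<Rightarrow> cvec set" where
  "q1 = (\<lambda>(A, V, B). V)"

definition q2 :: "cvec set \<times> cvec set \<times> cvec set \<Rightarrow> cvec set \<times> cvec set" where
  "q2 = (\<lambda>(A, V, B). (A, B))"

definition flag_shadow :: "nat \<Rightarrow> nat \<Rightarrow> nat \<Rightarrow> cvec set set \<Rightarrow> (cvec set \<times> cvec set) set" where
  "flag_shadow k n d X = q2 ` {T \<in> Fl3 k n d. q1 T \<in> X}"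

definition Y_locus :: "nat \<Rightarrow> nat \<Rightarrow> nat set \<Rightarrow> nat set \<Rightarrow> nat \<Rightarrow> (cvec set \<times> cvec set) set" where
  "Y_locus k n I J d =
     flag_shadow k n d (schubert k n J) \<inter> flag_shadow k n d (opp_schubert k n I)"

end

theory Submission
  imports Defs "HOL-Computational_Algebra.Fundamental_Theorem_Algebra"
begin

text \<open>
  A morphism of degree \<open>e\<close> from the projective line to the Grassmannian has a kernel of dimension
  at least \<open>k - e\<close> and a span of dimension at most \<open>k + e\<close>: among all bases of the associated
  family of row spaces by polynomial vectors, one of minimal total degree is independent at every
  point and has independent leading coefficients, so its maximal minors have no common zero, their
  largest degree is the total degree of the basis, and they divide the Pluecker coordinates. Since
  the maps on adjacent components agree at the node, the dimension formula extends both bounds to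
  trees of lines, which yields a flag \<open>A \<subseteq> B\<close> with \<open>A\<close> below and \<open>B\<close> above the three marked values.

  Conversely, three \<open>k\<close>-planes between \<open>A\<close> and \<open>B\<close> that meet pairwise in \<open>A\<close> lie on one curve of
  degree \<open>d\<close>, which joins corresponding vectors of a basis by lines. Otherwise \<open>A\<close> can be enlarged
  and \<open>B\<close> shrunk by one dimension after moving one of the planes along a line, and that line is
  attached to a stable map of degree \<open>d - 1\<close>.
\<close>


section \<open>Dimensions of finitely generated subspaces\<close>

text \<open>A morphism is given by its Pluecker coordinates alone, so no polynomial basis of the row
  spaces comes with it. The charts supply one by Cramer's rule, with all degrees at most
  \<open>e\<close>; minimality then lowers the total degree from at most \<open>k * e\<close> to at
  most \<open>e\<close>. Hence at most \<open>e\<close> basis vectors are nonconstant, and there are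
  at most \<open>k + e\<close> coefficient vectors: this is the origin of the two bounds. The
  parameter \<open>t\<close> misses the point [1 : 0], where coefficients of degree \<open>e\<close>
  take the place of values.

  Validity enters as \<open>d \<le> k\<close> and \<open>k + d \<le> n\<close>. These allow a kernel
  of dimension at least \<open>k - d\<close> to be cut down, and a span of dimension at most
  \<open>k + d\<close> to be enlarged, to a flag of the exact dimensions. For \<open>k = 0\<close>
  or \<open>k = n\<close> one half of the conditions on the juggling function is void; there the
  Grassmannian is a point, which forces \<open>d = 0\<close>.

  In the converse the degree has to be exactly \<open>d\<close>: if the induction leaves the third
  plane where it is, the missing degree is put on an unmarked tail.\<close>

definition fin_gen :: "cvec set \<Rightarrow> bool" where
  "fin_gen W \<longleftrightarrow> (\<exists>T. finite T \<and> W \<subseteq> cvec.span T)"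

lemma fin_gen_subset: "fin_gen W \<Longrightarrow> U \<subseteq> W \<Longrightarrow> fin_gen U"
  unfolding fin_gen_def by blast

text \<open>The ambient space \<open>cvec\<close> is infinite-dimensional, and a subspace with an
  infinite basis has \<open>cvec.dim\<close> equal to 0, the cardinality of an infinite set. Bounds
  by \<open>cvec.dim\<close> are therefore stated for finitely generated sets.\<close>

lemma fin_gen_independent:
  assumes "fin_gen W" "cvec.independent B" "B \<subseteq> W"
  shows "finite B" "card B \<le> cvec.dim W"
proof -
  from assms obtain T where T: "finite T" "W \<subseteq> cvec.span T"
    unfolding fin_gen_def by blast
  then show "finite B"
    using cvec.independent_span_bound[of T B] assms by blast
  obtain C where C: "C \<subseteq> W" "cvec.independent C" "W \<subseteq> cvec.span C" "card C = cvec.dim W"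
    by (rule cvec.basis_exists)
  have "finite C"
    using cvec.independent_span_bound[of T C] C T by blast
  then show "card B \<le> cvec.dim W"
    using cvec.independent_span_bound[of C B] C assms by auto
qed

lemma fin_gen_basis_extend:
  assumes "fin_gen W" "cvec.independent C" "C \<subseteq> W" "cvec.subspace W"
  obtains B where "C \<subseteq> B" "B \<subseteq> W" "cvec.independent B" "cvec.span B = W" "finite B" "card B = cvec.dim W"
proof -
  obtain B where B: "C \<subseteq> B" "B \<subseteq> W" "cvec.independent B" "W \<subseteq> cvec.span B"
    using cvec.maximal_independent_subset_extend[OF assms(3,2)] .
  have "cvec.span B = W"
    using B assms(4) by (simp add: cvec.span_subspace)
  then show ?thesis
    using that[of B] B fin_gen_independent[OF assms(1) B(3,2)] cvec.basis_card_eq_dim by blast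
qed

lemma fin_gen_basis:
  assumes "fin_gen W" "cvec.subspace W"
  obtains B where "B \<subseteq> W" "cvec.independent B" "cvec.span B = W" "finite B" "card B = cvec.dim W"
  using fin_gen_basis_extend[OF assms(1) cvec.independent_empty _ assms(2)] by blast

lemma dim_mono_fin_gen:
  assumes "fin_gen W" "U \<subseteq> W"
  shows "cvec.dim U \<le> cvec.dim W"
proof -
  obtain B where "B \<subseteq> U" "cvec.independent B" "U \<subseteq> cvec.span B" "card B = cvec.dim U"
    by (rule cvec.basis_exists)
  then show ?thesis
    using fin_gen_independent(2)[of W B] assms by auto
qed

lemma subspace_eq_fin_gen:
  assumes "fin_gen W" "cvec.subspace U" "cvec.subspace W" "U \<subseteq> W" "cvec.dim W \<le> cvec.dim U"
  shows "U = W"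
proof -
  obtain B where B: "B \<subseteq> U" "cvec.independent B" "cvec.span B = U" "finite B" "card B = cvec.dim U"
    using fin_gen_basis[OF fin_gen_subset[OF assms(1,4)] assms(2)] .
  obtain C where C: "B \<subseteq> C" "C \<subseteq> W" "cvec.independent C" "cvec.span C = W" "finite C" "card C = cvec.dim W"
    using fin_gen_basis_extend[OF assms(1) B(2) _ assms(3)] B(1) assms(4) by blast
  have "B = C"
    using B C assms(5) by (metis card_seteq)
  then show ?thesis using B C by simp
qed

text \<open>A basis of \<open>U\<close> is extended to one of \<open>W\<close>; a set of
  \<open>m\<close> vectors between the two bases spans \<open>X\<close>.\<close>

lemma subspace_between:
  assumes "fin_gen W" "cvec.subspace U" "cvec.subspace W" "U \<subseteq> W" "cvec.dim U \<le> m" "m \<le> cvec.dim W"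
  obtains X where "cvec.subspace X" "U \<subseteq> X" "X \<subseteq> W" "cvec.dim X = m"
proof -
  obtain B where B: "B \<subseteq> U" "cvec.independent B" "cvec.span B = U" "finite B" "card B = cvec.dim U"
    using fin_gen_basis[OF fin_gen_subset[OF assms(1,4)] assms(2)] .
  obtain C where C: "B \<subseteq> C" "C \<subseteq> W" "cvec.independent C" "cvec.span C = W" "finite C" "card C = cvec.dim W"
    using fin_gen_basis_extend[OF assms(1) B(2) _ assms(3)] B(1) assms(4) by blast
  obtain D where D: "B \<subseteq> D" "D \<subseteq> C" "card D = m"
    using exists_subset_between[of B m C] B C assms by metis
  show ?thesis
  proof (rule that)
    show "cvec.subspace (cvec.span D)" by simp
    show "U \<subseteq> cvec.span D" using B D cvec.span_mono by blast
    show "cvec.span D \<subseteq> W" using C D cvec.span_mono by blast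
    show "cvec.dim (cvec.span D) = m"
      using D C cvec.independent_mono cvec.dim_span_eq_card_independent by blast
  qed
qed

lemma independent_Un_span_Int:
  assumes "finite D" "finite F" "cvec.independent D" "cvec.independent F" "cvec.span D \<inter> cvec.span F \<subseteq> {0}"
  shows "cvec.independent (D \<union> F)" "D \<inter> F = {}"
proof -
  show disj: "D \<inter> F = {}"
    using assms(3,5) cvec.dependent_zero cvec.span_base by blast
  show "cvec.independent (D \<union> F)"
  proof (rule cvec.independent_if_scalars_zero)
    show "finite (D \<union> F)" using assms by simp
    fix f x assume s: "(\<Sum>x\<in>D \<union> F. scl (f x) x) = 0" and x: "x \<in> D \<union> F"
    have eq: "(\<Sum>x\<in>D. scl (f x) x) + (\<Sum>x\<in>F. scl (f x) x) = 0"
      using s sum.union_disjoint[OF assms(1,2) disj, of "\<lambda>x. scl (f x) x"] by simp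
    have inD: "(\<Sum>x\<in>D. scl (f x) x) \<in> cvec.span D" and inF: "(\<Sum>x\<in>F. scl (f x) x) \<in> cvec.span F"
      by (intro cvec.span_sum cvec.span_scale cvec.span_base; simp)+
    have "(\<Sum>x\<in>D. scl (f x) x) = - (\<Sum>x\<in>F. scl (f x) x)"
      using eq by (simp add: eq_neg_iff_add_eq_0)
    then have "(\<Sum>x\<in>D. scl (f x) x) \<in> cvec.span F"
      using cvec.span_neg[OF inF] by (simp only:)
    then have D0: "(\<Sum>x\<in>D. scl (f x) x) = 0" using inD assms(5) by blast
    then have F0: "(\<Sum>x\<in>F. scl (f x) x) = 0" using eq by simp
    show "f x = 0"
      using x cvec.independentD[OF assms(3) assms(1) subset_refl D0]
        cvec.independentD[OF assms(4) assms(2) subset_refl F0] by blast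
  qed
qed

text \<open>Bases \<open>D\<close> of \<open>U\<close> and \<open>E\<close> of \<open>W\<close>
  extend a common basis \<open>C\<close> of the intersection; then \<open>D \<union> (E - C)\<close>
  is a basis of the sum.\<close>

lemma dim_sums_Int_fin_gen:
  assumes "fin_gen U" "fin_gen W" "cvec.subspace U" "cvec.subspace W"
  shows "cvec.dim (cvec.span (U \<union> W)) + cvec.dim (U \<inter> W) = cvec.dim U + cvec.dim W"
proof -
  have sI: "cvec.subspace (U \<inter> W)" using assms cvec.subspace_inter by blast
  obtain C where C: "C \<subseteq> U \<inter> W" "cvec.independent C" "cvec.span C = U \<inter> W" "finite C" "card C = cvec.dim (U \<inter> W)"
    using fin_gen_basis[OF fin_gen_subset[OF assms(1)] sI] by blast
  obtain D where D: "C \<subseteq> D" "D \<subseteq> U" "cvec.independent D" "cvec.span D = U" "finite D" "card D = cvec.dim U"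
    using fin_gen_basis_extend[OF assms(1) C(2) _ assms(3)] C by blast
  obtain E where E: "C \<subseteq> E" "E \<subseteq> W" "cvec.independent E" "cvec.span E = W" "finite E" "card E = cvec.dim W"
    using fin_gen_basis_extend[OF assms(2) C(2) _ assms(4)] C by blast
  have "cvec.span D \<inter> cvec.span (E - C) \<subseteq> {0}"
  proof
    fix x assume x: "x \<in> cvec.span D \<inter> cvec.span (E - C)"
    have "cvec.span (E - C) \<subseteq> W" using E cvec.span_mono[of "E - C" E] by blast
    then have "x \<in> cvec.span C" using x C D by blast
    then obtain u where u: "x = (\<Sum>v\<in>C. scl (u v) v)"
      using cvec.span_finite[OF C(4)] by auto
    obtain w where w: "x = (\<Sum>v\<in>E-C. scl (w v) v)"
      using x cvec.span_finite[of "E - C"] E by auto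
    \<comment> \<open>\<open>x\<close> has an expansion over \<open>C\<close> and another one over
      \<open>E - C\<close>; their difference is a relation \<open>h\<close> of the basis
      \<open>E\<close>.\<close>
    define h where "h = (\<lambda>v. if v \<in> C then u v else - w v)"
    have "(\<Sum>v\<in>E. scl (h v) v) = (\<Sum>v\<in>E-C. scl (h v) v) + (\<Sum>v\<in>C. scl (h v) v)"
      by (rule sum.subset_diff[OF E(1,5)])
    also have "(\<Sum>v\<in>E-C. scl (h v) v) = - x"
      unfolding w by (simp add: h_def sum_negf)
    also have "(\<Sum>v\<in>C. scl (h v) v) = x"
      unfolding u by (simp add: h_def)
    finally have "(\<Sum>v\<in>E. scl (h v) v) = 0" by (simp only: left_minus)
    then have "\<forall>v\<in>C. u v = 0"
      using cvec.independentD[OF E(3,5) subset_refl, of h] E(1) h_def by fastforce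
    then show "x \<in> {0}" using u by simp
  qed
  then have DE: "cvec.independent (D \<union> (E - C))" "D \<inter> (E - C) = {}"
    using independent_Un_span_Int[of D "E - C"] D E cvec.independent_mono[of E "E - C"] by auto
  have "cvec.span (D \<union> (E - C)) = cvec.span (U \<union> W)"
  proof (rule cvec.span_eq[THEN iffD2], safe)
    fix x assume "x \<in> D" then show "x \<in> cvec.span (U \<union> W)" using D by (auto intro: cvec.span_base)
  next
    fix x assume "x \<in> E" then show "x \<in> cvec.span (U \<union> W)" using E by (auto intro: cvec.span_base)
  next
    fix x assume "x \<in> U" then show "x \<in> cvec.span (D \<union> (E - C))"
      using D cvec.span_mono[of D "D \<union> (E - C)"] by auto
  next
    fix x assume "x \<in> W" then show "x \<in> cvec.span (D \<union> (E - C))"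
      using E D cvec.span_mono[of E "D \<union> (E - C)"] by auto
  qed
  then have "cvec.dim (cvec.span (U \<union> W)) = card (D \<union> (E - C))"
    using DE(1) cvec.dim_eq_card by (metis cvec.dim_span)
  also have "\<dots> = card D + (card E - card C)"
    using DE(2) D E C card_Un_disjoint[of D "E - C"] by (simp add: card_Diff_subset)
  finally show ?thesis
    using C D E card_mono[OF E(5,1)] by simp
qed

lemma dim_span_insert_fin_gen:
  assumes "fin_gen U" "cvec.subspace U" "a \<notin> U"
  shows "cvec.dim (cvec.span (insert a U)) = Suc (cvec.dim U)"
proof -
  obtain B where B: "B \<subseteq> U" "cvec.independent B" "cvec.span B = U" "finite B" "card B = cvec.dim U"
    using fin_gen_basis[OF assms(1,2)] .
  have "cvec.span (insert a B) = cvec.span (insert a U)"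
    unfolding cvec.span_insert B(3) cvec.span_eq_iff[THEN iffD2, OF assms(2)] ..
  moreover have "cvec.independent (insert a B)" using B assms(3) cvec.independent_insertI by blast
  moreover have "a \<notin> B" using B assms(3) by blast
  ultimately show ?thesis
    using B cvec.dim_eq_card[of "insert a B" "cvec.span (insert a U)"] by (simp add: cvec.span_span)
qed


section \<open>Linear independence and maximal minors\<close>

lemma sum_fun_apply: "(sum f A) j = (\<Sum>i\<in>A. f i j)" for f :: "'i \<Rightarrow> 'a \<Rightarrow> 'b::comm_monoid_add"
  by (induction A rule: infinite_finite_induct) auto

lemma subspace_coord_space [simp]: "cvec.subspace (coord_space S)"
  by (auto simp: cvec.subspace_def coord_space_def scl_def)

definition unit_vec_at :: "nat \<Rightarrow> cvec" where
  "unit_vec_at i = (\<lambda>j. if j = i then 1 else 0)"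

lemma coord_space_span:
  assumes "finite S"
  shows "coord_space S \<subseteq> cvec.span (unit_vec_at ` S)"
proof
  fix v assume v: "v \<in> coord_space S"
  have "v = (\<Sum>i\<in>S. scl (v i) (unit_vec_at i))"
  proof
    fix j
    show "v j = (\<Sum>i\<in>S. scl (v i) (unit_vec_at i)) j"
      using v assms
      by (auto simp: sum_fun_apply scl_def unit_vec_at_def coord_space_def if_distrib cong: if_cong)
  qed
  also have "\<dots> \<in> cvec.span (unit_vec_at ` S)"
    by (intro cvec.span_sum cvec.span_scale cvec.span_base) simp
  finally show "v \<in> cvec.span (unit_vec_at ` S)" .
qed

lemma fin_gen_coord_space: "finite S \<Longrightarrow> V \<subseteq> coord_space S \<Longrightarrow> fin_gen V"
  using coord_space_span[of S] unfolding fin_gen_def by (meson finite_imageI subset_trans)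

lemma sum_scl_in_subspace:
  assumes "cvec.subspace W" "\<And>i. i \<in> I \<Longrightarrow> v i \<in> W"
  shows "(\<lambda>j. \<Sum>i\<in>I. l i * v i j) \<in> W"
proof -
  have "(\<lambda>j. \<Sum>i\<in>I. l i * v i j) = (\<Sum>i\<in>I. scl (l i) (v i))"
    unfolding fun_eq_iff sum_fun_apply scl_def by blast
  also have "\<dots> \<in> W"
    using assms by (intro cvec.subspace_sum cvec.subspace_scale) auto
  finally show ?thesis .
qed

text \<open>Indexing by \<open>i < k\<close> instead of by the set of vectors allows repetitions in
  \<open>v\<close>. These combinations form a subspace that contains the family.\<close>

lemma span_family:
  fixes v :: "nat \<Rightarrow> cvec"
  shows "w \<in> cvec.span (v ` {..<k}) \<longleftrightarrow> (\<exists>l. \<forall>j. w j = (\<Sum>i<k. l i * v i j))"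
proof
  assume "\<exists>l. \<forall>j. w j = (\<Sum>i<k. l i * v i j)"
  then obtain l where "\<forall>j. w j = (\<Sum>i<k. l i * v i j)" by blast
  then have "w = (\<Sum>i<k. scl (l i) (v i))"
    by (auto simp: sum_fun_apply scl_def)
  also have "\<dots> \<in> cvec.span (v ` {..<k})"
    by (intro cvec.span_sum cvec.span_scale cvec.span_base) simp
  finally show "w \<in> cvec.span (v ` {..<k})" .
next
  let ?U = "{w. \<exists>l. \<forall>j. w j = (\<Sum>i<k. l i * v i j)}"
  assume w: "w \<in> cvec.span (v ` {..<k})"
  have "cvec.subspace ?U"
  proof (rule cvec.subspaceI)
    show "0 \<in> ?U"
      by (rule CollectI, rule exI[of _ "\<lambda>_. 0"]) simp
  next
    fix x y assume "x \<in> ?U" "y \<in> ?U"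
    then obtain l m where "\<forall>j. x j = (\<Sum>i<k. l i * v i j)" "\<forall>j. y j = (\<Sum>i<k. m i * v i j)"
      by blast
    then show "x + y \<in> ?U"
      by (intro CollectI exI[of _ "\<lambda>i. l i + m i"]) (auto simp: algebra_simps sum.distrib)
  next
    fix c x assume "x \<in> ?U"
    then obtain l where "\<forall>j. x j = (\<Sum>i<k. l i * v i j)" by blast
    then show "scl c x \<in> ?U"
      by (intro CollectI exI[of _ "\<lambda>i. c * l i"]) (auto simp: scl_def sum_distrib_left mult.assoc)
  qed
  moreover have "v ` {..<k} \<subseteq> ?U"
  proof
    fix x assume "x \<in> v ` {..<k}"
    then obtain m where "m < k" "x = v m" by auto
    moreover have "(\<Sum>i<k. (if i = m then 1 else 0) * v i j) = v m j" if "m < k" for j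
      using that by (simp add: sum.remove[of _ m])
    ultimately show "x \<in> ?U"
      by (intro CollectI exI[of _ "\<lambda>i. if i = m then 1 else 0"]) simp
  qed
  ultimately show "\<exists>l. \<forall>j. w j = (\<Sum>i<k. l i * v i j)"
    using w cvec.span_minimal by blast
qed

text \<open>Independence of an indexed family, written in coordinates: a repeated vector makes the
  family dependent, although the set of its values may be independent.\<close>

definition lin_indep :: "nat \<Rightarrow> (nat \<Rightarrow> cvec) \<Rightarrow> bool" where
  "lin_indep k v \<longleftrightarrow> (\<forall>l. (\<forall>j. (\<Sum>i<k. l i * v i j) = 0) \<longrightarrow> (\<forall>i<k. l i = 0))"

lemma lin_indepD: "lin_indep k v \<Longrightarrow> (\<And>j. (\<Sum>i<k. l i * v i j) = 0) \<Longrightarrow> i < k \<Longrightarrow> l i = 0"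
  unfolding lin_indep_def by blast

lemma lin_indep_independent:
  assumes "lin_indep k v"
  shows "inj_on v {..<k}" "cvec.independent (v ` {..<k})"
proof -
  show inj: "inj_on v {..<k}"
  proof (rule inj_onI, rule ccontr)
    fix a b assume ab: "a \<in> {..<k}" "b \<in> {..<k}" "v a = v b" "a \<noteq> b"
    define l :: "nat \<Rightarrow> complex" where "l = (\<lambda>i. (if i = a then 1 else 0) - (if i = b then 1 else 0))"
    have "(\<Sum>i<k. l i * v i j) = 0" for j
      using ab by (simp add: l_def left_diff_distrib sum_subtractf if_distrib[of "\<lambda>c. c * _"] cong: if_cong)
    from lin_indepD[OF assms this, of a] ab show False by (simp add: l_def)
  qed
  show "cvec.independent (v ` {..<k})"
  proof (rule cvec.independent_if_scalars_zero)
    fix f x assume s: "(\<Sum>x\<in>v ` {..<k}. scl (f x) x) = 0" and x: "x \<in> v ` {..<k}"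
    have "(\<Sum>i<k. f (v i) * v i j) = 0" for j
    proof -
      have "(\<Sum>x\<in>v ` {..<k}. scl (f x) x) j = 0" unfolding s by simp
      then show ?thesis
        by (simp add: sum_fun_apply sum.reindex[OF inj] scl_def)
    qed
    from lin_indepD[OF assms, of "\<lambda>i. f (v i)", OF this] x show "f x = 0" by auto
  qed simp
qed

lemma lin_indep_dim:
  assumes "lin_indep k v"
  shows "cvec.dim (cvec.span (v ` {..<k})) = k"
  using lin_indep_independent[OF assms] cvec.dim_span_eq_card_independent by (simp add: card_image)

text \<open>A relation with \<open>l m \<noteq> 0\<close> puts \<open>v m\<close> into the span of
  the others, of which there are at most \<open>k - 1\<close>.\<close>

lemma dim_lin_indep:
  assumes "cvec.dim (cvec.span (v ` {..<k})) = k"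
  shows "lin_indep k v"
  unfolding lin_indep_def
proof (intro allI impI, rule ccontr)
  fix l m assume s: "\<forall>j. (\<Sum>i<k. l i * v i j) = 0" and m: "m < k" "l m \<noteq> 0"
  let ?R = "v ` ({..<k} - {m})"
  have vm: "v m = (\<Sum>i\<in>{..<k} - {m}. scl (- l i / l m) (v i))"
  proof
    fix j
    have "(\<Sum>i<k. l i * v i j) = l m * v m j + (\<Sum>i\<in>{..<k} - {m}. l i * v i j)"
      using m by (subst sum.remove[of _ m]) auto
    then have "l m * v m j = - (\<Sum>i\<in>{..<k} - {m}. l i * v i j)"
      using s by (simp add: eq_neg_iff_add_eq_0)
    then have "v m j = - (\<Sum>i\<in>{..<k} - {m}. l i * v i j) / l m"
      using m by (simp add: field_simps)
    then show "v m j = (\<Sum>i\<in>{..<k} - {m}. scl (- l i / l m) (v i)) j"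
      by (simp add: sum_fun_apply scl_def sum_divide_distrib sum_negf)
  qed
  have "v m \<in> cvec.span ?R"
    by (subst vm, intro cvec.span_sum cvec.span_scale cvec.span_base) simp
  then have "v i \<in> cvec.span ?R" if "i < k" for i
    using that by (cases "i = m") (auto intro: cvec.span_base)
  then have "v ` {..<k} \<subseteq> cvec.span ?R" by blast
  then have "cvec.span (v ` {..<k}) \<subseteq> cvec.span ?R"
    by (rule cvec.span_minimal) simp
  then have "cvec.dim (cvec.span (v ` {..<k})) \<le> card ?R"
    by (rule cvec.dim_le_card) simp
  also have "\<dots> \<le> k - 1"
    using card_image_le[of "{..<k} - {m}" v] m by simp
  finally show False using assms m by simp
qed

text \<open>The columns form a list, so that one of them can be replaced in place; the entries lie
  in any commutative ring, since matrices of polynomials occur later.\<close>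

definition minor_list :: "nat \<Rightarrow> (nat \<Rightarrow> nat \<Rightarrow> 'a::comm_ring_1) \<Rightarrow> nat list \<Rightarrow> 'a" where
  "minor_list k v xs = det (mat k k (\<lambda>(r, c). v r (xs ! c)))"

lemma minor_eq_minor_list: "minor k v S = minor_list k v (sorted_list_of_set S)"
  by (simp add: minor_def minor_list_def)

text \<open>A nonzero kernel vector of the transposed matrix is a relation among the rows on the
  listed columns.\<close>

lemma minor_list_zero_iff:
  fixes v :: "nat \<Rightarrow> cvec"
  assumes "length xs = k"
  shows "minor_list k v xs = 0 \<longleftrightarrow>
    (\<exists>l. (\<exists>i<k. l i \<noteq> 0) \<and> (\<forall>j\<in>set xs. (\<Sum>i<k. l i * v i j) = 0))"
proof -
  let ?M = "mat k k (\<lambda>(r, c). v r (xs ! c))"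
  let ?T = "transpose_mat ?M"
  have T: "?T \<in> carrier_mat k k" by simp
  have ev: "(?T *\<^sub>v u) $ c = (\<Sum>i<k. u $ i * v i (xs ! c))" if "c < k" "u \<in> carrier_vec k" for u c
    using that by (auto simp: scalar_prod_def atLeast0LessThan mult.commute intro!: sum.cong)
  have "minor_list k v xs = det ?T"
    unfolding minor_list_def by (rule det_transpose[symmetric, of _ k]) simp
  also have "\<dots> = 0 \<longleftrightarrow> (\<exists>u. u \<in> carrier_vec k \<and> u \<noteq> 0\<^sub>v k \<and> ?T *\<^sub>v u = 0\<^sub>v k)"
    by (rule det_0_iff_vec_prod_zero[OF T])
  also have "\<dots> \<longleftrightarrow> (\<exists>l. (\<exists>i<k. l i \<noteq> 0) \<and> (\<forall>j\<in>set xs. (\<Sum>i<k. l i * v i j) = 0))"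
  proof
    assume "\<exists>u. u \<in> carrier_vec k \<and> u \<noteq> 0\<^sub>v k \<and> ?T *\<^sub>v u = 0\<^sub>v k"
    then obtain u where u: "u \<in> carrier_vec k" "u \<noteq> 0\<^sub>v k" "?T *\<^sub>v u = 0\<^sub>v k" by blast
    have "\<exists>i<k. u $ i \<noteq> 0" using u(1,2) by (auto intro!: eq_vecI)
    moreover have "\<forall>j\<in>set xs. (\<Sum>i<k. u $ i * v i j) = 0"
      using ev[OF _ u(1)] u(3) assms by (auto simp: in_set_conv_nth)
    ultimately show "\<exists>l. (\<exists>i<k. l i \<noteq> 0) \<and> (\<forall>j\<in>set xs. (\<Sum>i<k. l i * v i j) = 0)" by blast
  next
    assume "\<exists>l. (\<exists>i<k. l i \<noteq> 0) \<and> (\<forall>j\<in>set xs. (\<Sum>i<k. l i * v i j) = 0)"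
    then obtain l where l: "\<exists>i<k. l i \<noteq> 0" "\<forall>j\<in>set xs. (\<Sum>i<k. l i * v i j) = 0" by blast
    let ?u = "vec k l"
    have "?T *\<^sub>v ?u = 0\<^sub>v k"
    proof (rule eq_vecI)
      fix c assume "c < dim_vec (0\<^sub>v k :: complex vec)"
      then have c: "c < k" by simp
      show "(?T *\<^sub>v ?u) $ c = 0\<^sub>v k $ c"
        using ev[OF c, of ?u] l(2) c assms by simp
    qed simp
    moreover have "?u \<noteq> 0\<^sub>v k" using l(1) by (metis index_vec index_zero_vec(1))
    ultimately show "\<exists>u. u \<in> carrier_vec k \<and> u \<noteq> 0\<^sub>v k \<and> ?T *\<^sub>v u = 0\<^sub>v k"
      by (intro exI[of _ ?u]) simp
  qed
  finally show ?thesis .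
qed

lemma ksubsets_simps:
  assumes "S \<in> ksubsets k n"
  shows "finite S" "card S = k" "S \<subseteq> {1..n}" "length (sorted_list_of_set S) = k"
    "set (sorted_list_of_set S) = S"
  using assms finite_subset[of S "{1..n}"] by (auto simp: ksubsets_def)

lemma minor_zero_iff:
  assumes "S \<in> ksubsets k n"
  shows "minor k v S = 0 \<longleftrightarrow>
    (\<exists>l. (\<exists>i<k. l i \<noteq> 0) \<and> (\<forall>j\<in>S. (\<Sum>i<k. l i * v i j) = 0))"
  using minor_list_zero_iff[of "sorted_list_of_set S" k v] ksubsets_simps[OF assms]
  by (simp add: minor_eq_minor_list)

text \<open>A minimal set of coordinates on which the family stays independent has exactly \<open>k\<close> elements.\<close>

lemma lin_indep_minor:
  assumes v: "lin_indep k v" "\<And>i. i < k \<Longrightarrow> v i \<in> coord_space {1..n}"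
  obtains S where "S \<in> ksubsets k n" "minor k v S \<noteq> 0"
proof -
  define good where "good = (\<lambda>T. T \<subseteq> {1..n} \<and>
    (\<forall>l. (\<forall>j\<in>T. (\<Sum>i<k. l i * v i j) = 0) \<longrightarrow> (\<forall>i<k. l i = 0)))"
  have "good {1..n}"
    unfolding good_def
  proof (intro conjI allI impI)
    fix l i assume z: "\<forall>j\<in>{1..n}. (\<Sum>i<k. l i * v i j) = 0" and i: "i < k"
    have "(\<Sum>i<k. l i * v i j) = 0" for j
      using z v(2) by (cases "j \<in> {1..n}") (auto simp: coord_space_def intro!: sum.neutral)
    then show "l i = 0" using lin_indepD[OF v(1) _ i] by blast
  qed simp
  then obtain T where T: "good T" and min: "\<And>T'. good T' \<Longrightarrow> card T \<le> card T'"
    using ex_has_least_nat[of good _ card] by blast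
  have fT: "finite T" using T finite_subset unfolding good_def by blast
  \<comment> \<open>Removing \<open>s\<close> destroys independence on the remaining coordinates, so
    some combination vanishes on \<open>T\<close> except at \<open>s\<close>.\<close>
  have "\<forall>s\<in>T. \<exists>l. (\<forall>j\<in>T - {s}. (\<Sum>i<k. l i * v i j) = 0) \<and> (\<Sum>i<k. l i * v i s) \<noteq> 0"
  proof
    fix s assume s: "s \<in> T"
    then have "\<not> good (T - {s})"
      using min[of "T - {s}"] fT card_Diff1_less[OF fT s] by linarith
    then obtain l where l: "\<forall>j\<in>T - {s}. (\<Sum>i<k. l i * v i j) = 0" "\<exists>i<k. l i \<noteq> 0"
      using T unfolding good_def by blast
    then have "(\<Sum>i<k. l i * v i s) \<noteq> 0"
      using T unfolding good_def by blast
    then show "\<exists>l. (\<forall>j\<in>T - {s}. (\<Sum>i<k. l i * v i j) = 0) \<and> (\<Sum>i<k. l i * v i s) \<noteq> 0"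
      using l by blast
  qed
  then obtain L where L: "\<And>s j. s \<in> T \<Longrightarrow> j \<in> T - {s} \<Longrightarrow> (\<Sum>i<k. L s i * v i j) = 0"
    "\<And>s. s \<in> T \<Longrightarrow> (\<Sum>i<k. L s i * v i s) \<noteq> 0"
    by metis
  \<comment> \<open>Up to nonzero scalars the \<open>w s\<close> are dual to the coordinates in
    \<open>T\<close>. They are independent in a space spanned by \<open>k\<close> vectors, hence
    \<open>card T \<le> k\<close>.\<close>
  define w where "w = (\<lambda>s j. \<Sum>i<k. L s i * v i j)"
  have inj: "inj_on w T"
  proof (rule inj_onI, rule ccontr)
    fix s t assume st: "s \<in> T" "t \<in> T" "w s = w t" "s \<noteq> t"
    then have "w t s = 0" "w s s \<noteq> 0" using L unfolding w_def by auto
    then show False using st by simp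
  qed
  have "cvec.independent (w ` T)"
  proof (rule cvec.independent_if_scalars_zero)
    fix f x assume s: "(\<Sum>x\<in>w ` T. scl (f x) x) = 0" and "x \<in> w ` T"
    then obtain t where t: "t \<in> T" "x = w t" by auto
    have "(\<Sum>x\<in>w ` T. scl (f x) x) t = 0" unfolding s by simp
    then have "(\<Sum>s\<in>T. f (w s) * w s t) = 0"
      by (simp add: sum_fun_apply sum.reindex[OF inj] scl_def)
    moreover have "(\<Sum>s\<in>T. f (w s) * w s t) = f (w t) * w t t"
      using t fT L(1) by (subst sum.remove[of _ t]) (auto simp: w_def intro!: sum.neutral)
    ultimately show "f x = 0" using L(2)[OF t(1)] t by (simp add: w_def)
  qed (use fT in simp)
  moreover have "w ` T \<subseteq> cvec.span (v ` {..<k})"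
    by (auto simp: span_family w_def)
  ultimately have "card (w ` T) \<le> card (v ` {..<k})"
    using cvec.independent_span_bound[of "v ` {..<k}" "w ` T"] by simp
  then have le: "card T \<le> k"
    using card_image_le[of "{..<k}" v] by (simp add: card_image[OF inj])
  \<comment> \<open>Conversely the family stays independent after projection to \<open>T\<close>,
    which gives \<open>k \<le> card T\<close>.\<close>
  define v' where "v' = (\<lambda>i. project T (v i))"
  have "lin_indep k v'"
    unfolding lin_indep_def
  proof (intro allI impI)
    fix l i assume z: "\<forall>j. (\<Sum>i<k. l i * v' i j) = 0" and i: "i < k"
    have "\<forall>j\<in>T. (\<Sum>i<k. l i * v i j) = 0"
    proof
      fix j assume "j \<in> T"
      then show "(\<Sum>i<k. l i * v i j) = 0" using z[rule_format, of j] by (simp add: v'_def project_def)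
    qed
    then show "l i = 0" using T i unfolding good_def by blast
  qed
  then have v': "inj_on v' {..<k}" "cvec.independent (v' ` {..<k})"
    by (rule lin_indep_independent)+
  have "v' ` {..<k} \<subseteq> coord_space T"
    by (auto simp: v'_def project_def coord_space_def)
  then have "v' ` {..<k} \<subseteq> cvec.span (unit_vec_at ` T)"
    using coord_space_span[OF fT] by blast
  then have "card (v' ` {..<k}) \<le> card (unit_vec_at ` T)"
    using cvec.independent_span_bound[of "unit_vec_at ` T"] v'(2) fT by blast
  then have "k \<le> card T"
    using card_image_le[OF fT, of unit_vec_at] by (simp add: card_image[OF v'(1)])
  with le T have Tk: "T \<in> ksubsets k n" by (simp add: ksubsets_def good_def)
  moreover have "minor k v T \<noteq> 0"
    using minor_zero_iff[OF Tk, of v] T unfolding good_def by blast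
  ultimately show thesis by (rule that)
qed

section \<open>Cramer's rule by the adjugate matrix\<close>

lemma scalar_mat_mult_vec:
  fixes b :: "'a::comm_ring_1 vec"
  assumes "b \<in> carrier_vec k"
  shows "(d \<cdot>\<^sub>m 1\<^sub>m k) *\<^sub>v b = d \<cdot>\<^sub>v b"
proof (rule eq_vecI)
  fix i assume "i < dim_vec (d \<cdot>\<^sub>v b)"
  then have "i < k" using assms by simp
  then show "((d \<cdot>\<^sub>m 1\<^sub>m k) *\<^sub>v b) $ i = (d \<cdot>\<^sub>v b) $ i"
    using assms by (simp add: scalar_prod_def sum.remove[of _ i])
qed (use assms in simp)

text \<open>The \<open>\<mu> i r\<close> are the entries of the adjugate matrix and do not depend on
  \<open>j\<close>. The second formula applies the product of the matrix with its adjugate to column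
  \<open>j\<close>.\<close>

lemma minor_list_cramer:
  fixes v :: "nat \<Rightarrow> nat \<Rightarrow> 'a::field"
  assumes "length xs = k" "minor_list k v xs \<noteq> 0"
  obtains \<mu> where "\<And>i j. i < k \<Longrightarrow> minor_list k v (xs[i := j]) = (\<Sum>r<k. \<mu> i r * v r j)"
    "\<And>r j. r < k \<Longrightarrow> minor_list k v xs * v r j = (\<Sum>i<k. v r (xs ! i) * minor_list k v (xs[i := j]))"
proof -
  let ?M = "mat k k (\<lambda>(r, c). v r (xs ! c))"
  let ?d = "minor_list k v xs"
  let ?A = "adj_mat ?M"
  have M: "?M \<in> carrier_mat k k" by simp
  note A = adj_mat[OF M]
  have d: "det ?M = ?d" by (simp add: minor_list_def)
  have rep: "replace_col ?M (vec k (\<lambda>r. v r j)) i = mat k k (\<lambda>(r, c). v r (xs[i := j] ! c))"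
    if "i < k" for i j
    using that assms(1) by (auto simp: replace_col_def nth_list_update intro!: eq_matI)
  have y: "minor_list k v (xs[i := j]) = (?A *\<^sub>v vec k (\<lambda>r. v r j)) $ i" if i: "i < k" for i j
  proof -
    let ?b = "vec k (\<lambda>r. v r j)"
    \<comment> \<open>\<open>x\<close> solves the linear system with column \<open>j\<close> on the
      right-hand side; Cramer's rule expresses its entries by minors with one column
      replaced.\<close>
    define x where "x = (1 / ?d) \<cdot>\<^sub>v (?A *\<^sub>v ?b)"
    have x: "x \<in> carrier_vec k" using A by (simp add: x_def)
    have Ab: "?A *\<^sub>v ?b \<in> carrier_vec k" using A by simp
    have "?M *\<^sub>v x = (1 / ?d) \<cdot>\<^sub>v (?M *\<^sub>v (?A *\<^sub>v ?b))"
      unfolding x_def by (rule mult_mat_vec[OF M Ab])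
    also have "?M *\<^sub>v (?A *\<^sub>v ?b) = (?M * ?A) *\<^sub>v ?b"
      using A(1) M by (intro assoc_mult_mat_vec[symmetric]) auto
    also have "\<dots> = (?d \<cdot>\<^sub>m 1\<^sub>m k) *\<^sub>v ?b" by (simp only: A d)
    also have "\<dots> = ?d \<cdot>\<^sub>v ?b" by (rule scalar_mat_mult_vec) simp
    finally have "?M *\<^sub>v x = ?b" using assms(2) by (simp add: smult_smult_assoc)
    then have "det (replace_col ?M ?b i) = x $ i * ?d"
      using cramer_lemma_mat[OF M x i] d by simp
    also have "\<dots> = (?A *\<^sub>v ?b) $ i" using i assms(2) carrier_matD[OF A(1)] by (simp add: x_def)
    finally show ?thesis unfolding rep[OF i] by (simp add: minor_list_def)
  qed
  show thesis
  proof (rule that)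
    fix i j assume i: "i < k"
    then show "minor_list k v (xs[i := j]) = (\<Sum>r<k. ?A $$ (i, r) * v r j)"
      unfolding y[OF i] using A(1) by (auto simp: scalar_prod_def atLeast0LessThan intro!: sum.cong)
  next
    fix r j assume r: "r < k"
    let ?b = "vec k (\<lambda>r. v r j)"
    have Ab: "?A *\<^sub>v ?b \<in> carrier_vec k" using A by simp
    have "?M *\<^sub>v (?A *\<^sub>v ?b) = (?M * ?A) *\<^sub>v ?b"
      using A(1) M by (intro assoc_mult_mat_vec[symmetric]) auto
    also have "\<dots> = (?d \<cdot>\<^sub>m 1\<^sub>m k) *\<^sub>v ?b" by (simp only: A d)
    also have "\<dots> = ?d \<cdot>\<^sub>v ?b" by (rule scalar_mat_mult_vec) simp
    finally have "?d * v r j = (?M *\<^sub>v (?A *\<^sub>v ?b)) $ r" using r by simp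
    also have "\<dots> = (\<Sum>i<k. v r (xs ! i) * (?A *\<^sub>v ?b) $ i)"
      using r A(1) by (auto simp: scalar_prod_def atLeast0LessThan intro!: sum.cong)
    also have "\<dots> = (\<Sum>i<k. v r (xs ! i) * minor_list k v (xs[i := j]))"
      using y by (auto intro!: sum.cong)
    finally show "?d * v r j = (\<Sum>i<k. v r (xs ! i) * minor_list k v (xs[i := j]))" .
  qed
qed


section \<open>Pluecker coordinates and affine charts\<close>

text \<open>The inclusion is an equality, as both lists have \<open>k\<close> distinct entries, and
  \<open>e\<close> is the sign of the permutation between them. It is chosen before
  \<open>v\<close>, so that one sign serves every family.\<close>

lemma minor_list_permute:
  assumes "set xs \<subseteq> set ys" "distinct xs" "distinct ys" "length xs = k" "length ys = k"
  shows "\<exists>e. \<forall>v :: nat \<Rightarrow> nat \<Rightarrow> 'a::comm_ring_1.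
    minor_list k v xs = of_int e * minor_list k v ys"
proof -
  have "set xs = set ys"
    using assms by (intro card_subset_eq) (auto simp: distinct_card)
  then have "mset ys = mset xs"
    using assms set_eq_iff_mset_eq_distinct by blast
  then obtain p where p: "p permutes {..<length ys}" "permute_list p ys = xs"
    using mset_eq_permutation[of xs ys] by metis
  have nth: "xs ! c = ys ! (p c)" if "c < k" for c
    using that p assms(5) permute_list_nth[of p ys c] by simp
  have pk: "p permutes {0..<k}" using p(1) assms(5) by (simp add: atLeast0LessThan)
  show ?thesis
  proof (intro exI allI)
    fix v :: "nat \<Rightarrow> nat \<Rightarrow> 'a"
    let ?X = "mat k k (\<lambda>(r, c). v r (xs ! c))"
    let ?Y = "mat k k (\<lambda>(r, c). v r (ys ! c))"
    have "minor_list k v xs = det (transpose_mat ?X)"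
      unfolding minor_list_def by (rule det_transpose[symmetric, of _ k]) simp
    also have "transpose_mat ?X = mat k k (\<lambda>(i, j). transpose_mat ?Y $$ (p i, j))"
      using nth permutes_in_image[OF pk] by (intro eq_matI) auto
    also have "det \<dots> = signof p * det (transpose_mat ?Y)"
      by (rule det_permute_rows[OF _ pk]) simp
    also have "det (transpose_mat ?Y) = minor_list k v ys"
      unfolding minor_list_def by (rule det_transpose[of _ k]) simp
    finally show "minor_list k v xs = of_int (sign p) * minor_list k v ys" .
  qed
qed

text \<open>
  For the Pluecker vector \<open>p\<close> of the row space of \<open>v\<close>, \<open>exchange S p i j\<close> is the minor obtained
  from the columns \<open>S\<close> by replacing the \<open>i\<close>-th one by column \<open>j\<close>; the sign accounts for sorting.
\<close>

definition exchange_sign :: "nat set \<Rightarrow> nat \<Rightarrow> nat \<Rightarrow> int" where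
  "exchange_sign S i j = (SOME e. \<forall>v :: nat \<Rightarrow> cvec.
     minor_list (card S) v ((sorted_list_of_set S)[i := j]) =
     of_int e * minor (card S) v (insert j (S - {sorted_list_of_set S ! i})))"

definition exchange :: "nat set \<Rightarrow> (nat set \<Rightarrow> 'a::comm_ring_1) \<Rightarrow> nat \<Rightarrow> nat \<Rightarrow> 'a" where
  "exchange S p i j =
     (if j \<in> S then if j = sorted_list_of_set S ! i then p S else 0
      else of_int (exchange_sign S i j) * p (insert j (S - {sorted_list_of_set S ! i})))"

lemma exchange_ksubset:
  assumes "S \<in> ksubsets k n" "i < k" "j \<in> {1..n}" "j \<notin> S"
  shows "insert j (S - {sorted_list_of_set S ! i}) \<in> ksubsets k n"
proof -
  have "sorted_list_of_set S ! i \<in> S"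
    using ksubsets_simps[OF assms(1)] assms(2) nth_mem by metis
  then show ?thesis
    using assms ksubsets_simps[OF assms(1)] by (auto simp: ksubsets_def)
qed

text \<open>A column outside \<open>S\<close> has to be sorted into place, which costs the sign; the
  column already at position \<open>i\<close> changes nothing; a column from another position of
  \<open>S\<close> occurs twice and makes the determinant vanish.\<close>

lemma exchange_minor:
  assumes "S \<in> ksubsets k n" "i < k" "j \<in> {1..n}"
  shows "exchange S (minor k v) i j = minor_list k v ((sorted_list_of_set S)[i := j])"
proof -
  let ?xs = "sorted_list_of_set S"
  note S = ksubsets_simps[OF assms(1)]
  have mem: "?xs ! i \<in> S" using S assms(2) nth_mem by metis
  consider "j \<notin> S" | "j = ?xs ! i" | "j \<in> S" "j \<noteq> ?xs ! i" by blast
  then show ?thesis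
  proof cases
    case 1
    define T where "T = insert j (S - {?xs ! i})"
    have "T \<in> ksubsets k n" unfolding T_def by (rule exchange_ksubset[OF assms 1])
    note T = ksubsets_simps[OF this]
    have "set (?xs[i := j]) = T"
      using S assms(2) unfolding T_def by (subst set_update_distinct) auto
    moreover have "distinct (?xs[i := j])"
      using S 1 by (intro distinct_list_update) auto
    ultimately have "\<exists>e. \<forall>v :: nat \<Rightarrow> cvec.
        minor_list k v (?xs[i := j]) = of_int e * minor_list k v (sorted_list_of_set T)"
      using T(4,5) S(4) by (intro minor_list_permute) (simp_all add: distinct_sorted_list_of_set)
    then obtain e where e: "\<And>v :: nat \<Rightarrow> cvec.
        minor_list k v (?xs[i := j]) = of_int e * minor_list k v (sorted_list_of_set T)"
      by blast
    then have "\<forall>v. minor_list (card S) v (?xs[i := j]) = of_int e * minor (card S) v T"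
      using S by (simp add: minor_eq_minor_list)
    then have "\<forall>v. minor_list (card S) v (?xs[i := j]) =
        of_int (exchange_sign S i j) * minor (card S) v T"
      unfolding exchange_sign_def T_def by (rule someI)
    then show ?thesis using S 1 by (simp add: exchange_def T_def)
  next
    case 2
    then show ?thesis using mem by (simp add: exchange_def minor_eq_minor_list)
  next
    case 3
    then obtain i' where i': "i' < k" "?xs ! i' = j" using S by (metis in_set_conv_nth)
    then have "i' \<noteq> i" using 3 by auto
    have "minor_list k v (?xs[i := j]) = 0"
      unfolding minor_list_def
    proof (rule det_identical_columns[of _ k i i'])
      show "col (mat k k (\<lambda>(r, c). v r (?xs[i := j] ! c))) i =
          col (mat k k (\<lambda>(r, c). v r (?xs[i := j] ! c))) i'"
        using i' \<open>i' \<noteq> i\<close> S assms(2) by (intro eq_vecI) auto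
    qed (use i' \<open>i' \<noteq> i\<close> assms(2) in auto)
    then show ?thesis using 3 by (simp add: exchange_def)
  qed
qed

lemma exchange_scale:
  assumes "S \<in> ksubsets k n" "i < k" "j \<in> {1..n}" "\<And>T. T \<in> ksubsets k n \<Longrightarrow> p T = c * q T"
  shows "exchange S p i j = c * exchange S q i j"
  using assms exchange_ksubset[OF assms(1-3)] by (auto simp: exchange_def)

text \<open>\<open>exchange\<close> is linear in \<open>p\<close> with integer coefficients, so it
  commutes with evaluation and likewise with taking coefficients.\<close>

lemma exchange_poly:
  fixes Q :: "nat set \<Rightarrow> complex poly"
  shows "poly (exchange S Q i j) t = exchange S (\<lambda>T. poly (Q T) t) i j"
  by (simp add: exchange_def)

lemma exchange_coeff:
  fixes Q :: "nat set \<Rightarrow> complex poly"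
  shows "coeff (exchange S Q i j) m = exchange S (\<lambda>T. coeff (Q T) m) i j"
proof -
  have "coeff (of_int c * q) m = of_int c * coeff q m" for c and q :: "complex poly"
    by (simp add: of_int_poly)
  then show ?thesis by (simp add: exchange_def)
qed

lemma exchange_degree:
  fixes Q :: "nat set \<Rightarrow> complex poly"
  assumes "S \<in> ksubsets k n" "i < k" "j \<in> {1..n}" "\<And>T. T \<in> ksubsets k n \<Longrightarrow> degree (Q T) \<le> e"
  shows "degree (exchange S Q i j) \<le> e"
proof -
  have "degree (of_int c * q) \<le> degree q" for c and q :: "complex poly"
    by (simp add: of_int_poly degree_smult_le)
  then have "degree (of_int c * Q T) \<le> e" if "T \<in> ksubsets k n" for c T
    using assms(4)[OF that] order_trans by blast
  then show ?thesis
    using assms(1,4) exchange_ksubset[OF assms(1-3)] by (simp add: exchange_def)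
qed

lemma pluecker_coords_basis:
  assumes "pluecker_coords k n V p"
  obtains v c where "c \<noteq> 0" "lin_indep k v" "\<And>i. i < k \<Longrightarrow> v i \<in> coord_space {1..n}"
    "cvec.span (v ` {..<k}) = V" "\<And>S. S \<in> ksubsets k n \<Longrightarrow> p S = c * minor k v S"
proof -
  obtain v c where v: "c \<noteq> 0" "cvec.span (v ` {..<k}) = V"
    "\<And>S. S \<in> ksubsets k n \<Longrightarrow> p S = c * minor k v S" and V: "V \<in> Gr k n"
    using assms unfolding pluecker_coords_def by blast
  have "v i \<in> coord_space {1..n}" if "i < k" for i
    using that v(2) V cvec.span_base[of "v i" "v ` {..<k}"] by (auto simp: Gr_def)
  moreover have "lin_indep k v"
    using V v(2) by (intro dim_lin_indep) (simp add: Gr_def)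
  ultimately show thesis using that v by blast
qed

lemma pluecker_coords_nonzero:
  assumes "pluecker_coords k n V p"
  obtains S where "S \<in> ksubsets k n" "p S \<noteq> 0"
proof -
  obtain v c where v: "c \<noteq> 0" "lin_indep k v" "\<And>i. i < k \<Longrightarrow> v i \<in> coord_space {1..n}"
    "\<And>S. S \<in> ksubsets k n \<Longrightarrow> p S = c * minor k v S"
    using pluecker_coords_basis[OF assms] by metis
  obtain S where "S \<in> ksubsets k n" "minor k v S \<noteq> 0"
    using lin_indep_minor[OF v(2,3)] by metis
  then show thesis using that[of S] v(1,4) by simp
qed

text \<open>In the affine chart \<open>p S \<noteq> 0\<close> a subspace is the graph of a linear map given by Cramer's rule.\<close>

lemma pluecker_chart:
  assumes "pluecker_coords k n V p" "S \<in> ksubsets k n" "p S \<noteq> 0"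
  shows "w \<in> V \<longleftrightarrow> w \<in> coord_space {1..n} \<and>
    (\<forall>j\<in>{1..n}. p S * w j = (\<Sum>i<k. w (sorted_list_of_set S ! i) * exchange S p i j))"
proof -
  let ?xs = "sorted_list_of_set S"
  note S = ksubsets_simps[OF assms(2)]
  obtain v c where v: "c \<noteq> 0" "lin_indep k v" "\<And>i. i < k \<Longrightarrow> v i \<in> coord_space {1..n}"
    "cvec.span (v ` {..<k}) = V" "\<And>S. S \<in> ksubsets k n \<Longrightarrow> p S = c * minor k v S"
    by (rule pluecker_coords_basis[OF assms(1)]) blast
  have pS: "p S = c * minor_list k v ?xs"
    using v(5)[OF assms(2)] by (simp add: minor_eq_minor_list)
  have ex: "exchange S p i j = c * minor_list k v (?xs[i := j])" if "i < k" "j \<in> {1..n}" for i j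
    using exchange_scale[OF assms(2) that v(5)] exchange_minor[OF assms(2) that] by simp
  have nz: "minor_list k v ?xs \<noteq> 0" using pS assms(3) by auto
  obtain \<mu> where mu: "\<And>i j. i < k \<Longrightarrow> minor_list k v (?xs[i := j]) = (\<Sum>r<k. \<mu> i r * v r j)"
    "\<And>r j. r < k \<Longrightarrow> minor_list k v ?xs * v r j = (\<Sum>i<k. v r (?xs ! i) * minor_list k v (?xs[i := j]))"
    by (rule minor_list_cramer[OF S(4) nz]) blast
  show ?thesis
  proof (intro iffI conjI ballI)
    assume "w \<in> V"
    then obtain l where l: "\<And>j. w j = (\<Sum>r<k. l r * v r j)"
      using v(4) span_family by blast
    show "w \<in> coord_space {1..n}" using \<open>w \<in> V\<close> assms(1) by (auto simp: pluecker_coords_def Gr_def)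
    fix j assume j: "j \<in> {1..n}"
    have "p S * w j = (\<Sum>r<k. l r * (c * (minor_list k v ?xs * v r j)))"
      by (simp add: pS l sum_distrib_left mult_ac)
    also have "\<dots> = (\<Sum>r<k. \<Sum>i<k. l r * v r (?xs ! i) * exchange S p i j)"
      using mu(2) ex[OF _ j] by (auto intro!: sum.cong simp: sum_distrib_left mult_ac)
    also have "\<dots> = (\<Sum>i<k. w (?xs ! i) * exchange S p i j)"
      by (subst sum.swap) (simp add: l sum_distrib_right)
    finally show "p S * w j = (\<Sum>i<k. w (?xs ! i) * exchange S p i j)" .
  next
    assume w: "w \<in> coord_space {1..n} \<and>
      (\<forall>j\<in>{1..n}. p S * w j = (\<Sum>i<k. w (?xs ! i) * exchange S p i j))"
    \<comment> \<open>The minors with a replaced column are combinations of the rows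
      \<open>v r\<close> with coefficients independent of \<open>j\<close>; inserting them exhibits
      \<open>w\<close> as a combination of the rows.\<close>
    have "w j = (\<Sum>r<k. (\<Sum>i<k. w (?xs ! i) * c * \<mu> i r / p S) * v r j)" for j
    proof (cases "j \<in> {1..n}")
      case True
      have "p S * w j = (\<Sum>i<k. \<Sum>r<k. w (?xs ! i) * (c * (\<mu> i r * v r j)))"
        using w True ex[OF _ True] mu(1) by (simp add: sum_distrib_left)
      also have "\<dots> = p S * (\<Sum>r<k. (\<Sum>i<k. w (?xs ! i) * c * \<mu> i r / p S) * v r j)"
        using assms(3) by (subst sum.swap) (simp add: sum_distrib_left sum_distrib_right mult_ac)
      finally show ?thesis using assms(3) by simp
    next
      case False
      then show ?thesis using w v(3) by (auto simp: coord_space_def intro!: sum.neutral[symmetric])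
    qed
    then show "w \<in> V" unfolding v(4)[symmetric] span_family
      by (intro exI[of _ "\<lambda>r. \<Sum>i<k. w (?xs ! i) * c * \<mu> i r / p S"] allI)
  qed
qed

text \<open>\<open>\<mu>\<close> is the determinant of the matrix that expresses \<open>u\<close> by
  \<open>v\<close>, hence the same for all \<open>S\<close>.\<close>

lemma minor_change_of_basis:
  fixes u v :: "nat \<Rightarrow> cvec"
  assumes "\<And>i. i < k \<Longrightarrow> u i \<in> cvec.span (v ` {..<k})"
  obtains \<mu> where "\<And>S. minor k u S = \<mu> * minor k v S"
proof -
  have "\<forall>i. \<exists>l. i < k \<longrightarrow> (\<forall>j. u i j = (\<Sum>r<k. l r * v r j))"
    using assms span_family by blast
  then obtain L where L: "\<And>i j. i < k \<Longrightarrow> u i j = (\<Sum>r<k. L i r * v r j)" by metis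
  show thesis
  proof (rule that)
    fix S :: "nat set"
    let ?xs = "sorted_list_of_set S"
    have "mat k k (\<lambda>(r, c). u r (?xs ! c)) = mat k k (\<lambda>(r, c). L r c) * mat k k (\<lambda>(r, c). v r (?xs ! c))"
      using L by (intro eq_matI) (auto simp: scalar_prod_def atLeast0LessThan)
    then show "minor k u S = det (mat k k (\<lambda>(r, c). L r c)) * minor k v S"
      unfolding minor_def by (simp add: det_mult[of _ k])
  qed
qed


section \<open>Degrees and orders of polynomials\<close>

lemma poly_zero_cofinite:
  fixes p :: "'a::{idom,ring_char_0} poly"
  assumes "finite X" "\<And>t. t \<notin> X \<Longrightarrow> poly p t = 0"
  shows "p = 0"
proof (rule ccontr)
  assume "p \<noteq> 0"
  then have "finite ({t. poly p t = 0} \<union> X)" using assms(1) poly_roots_finite by auto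
  moreover have "{t. poly p t = 0} \<union> X = UNIV" using assms(2) by auto
  ultimately show False using infinite_UNIV_char_0 by metis
qed

text \<open>A nonconstant complex polynomial \<open>p\<close> has a root, which is also a root of
  \<open>q\<close>; cancelling the linear factor in both keeps the inequality of orders at every
  point and lowers the degree.\<close>

lemma order_le_imp_dvd:
  fixes p q :: "complex poly"
  assumes "p \<noteq> 0" "q \<noteq> 0" "\<And>t. order t p \<le> order t q"
  shows "p dvd q"
  using assms
proof (induction "degree p" arbitrary: p q rule: less_induct)
  case less
  show ?case
  proof (cases "degree p = 0")
    case True
    then show ?thesis using less.prems(1) is_unit_iff_degree unit_imp_dvd by blast
  next
    case False
    then obtain t where t: "poly p t = 0" using alg_closed_imp_poly_has_root[of p] by auto
    have "order t p \<noteq> 0" using t less.prems(1) order_root by blast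
    then have "poly q t = 0" using less.prems(2) less.prems(3)[of t] order_root[of q t] by auto
    obtain p' where p': "p = [:-t, 1:] * p'" using t by (auto simp: poly_eq_0_iff_dvd)
    obtain q' where q': "q = [:-t, 1:] * q'" using \<open>poly q t = 0\<close> by (auto simp: poly_eq_0_iff_dvd)
    have nz: "p' \<noteq> 0" "q' \<noteq> 0" using p' q' less.prems(1,2) by auto
    have "degree p' < degree p" unfolding p' using nz by (simp add: degree_mult_eq del: mult_pCons_left)
    moreover have "order s p' \<le> order s q'" for s
      using less.prems(3)[of s] order_mult[where p = "[:-t, 1:]" and q = p'] order_mult[where p = "[:-t, 1:]" and q = q']
        less.prems(1,2) unfolding p' q' by (simp del: mult_pCons_left)
    ultimately have "p' dvd q'" using less.hyps nz by blast
    then show ?thesis unfolding p' q' by (rule mult_dvd_mono[OF dvd_refl])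
  qed
qed

lemma coeff_mult_degree_bound:
  assumes "degree p \<le> a" "degree q \<le> b"
  shows "coeff (p * q) (a + b) = coeff p a * coeff q b"
proof -
  have "coeff (p * q) (a + b) = (\<Sum>i\<le>a + b. coeff p i * coeff q (a + b - i))"
    by (rule coeff_mult)
  also have "\<dots> = (\<Sum>i\<in>{a}. coeff p i * coeff q (a + b - i))"
  proof (rule sum.mono_neutral_right)
    show "\<forall>i\<in>{..a + b} - {a}. coeff p i * coeff q (a + b - i) = 0"
    proof
      fix i assume "i \<in> {..a + b} - {a}"
      then consider "i > a" | "a + b - i > b" by fastforce
      then show "coeff p i * coeff q (a + b - i) = 0"
        using assms by cases (auto simp: coeff_eq_0)
    qed
  qed auto
  finally show ?thesis by simp
qed

lemma coeff_prod_degree_bound: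
  fixes f :: "'i \<Rightarrow> 'a::comm_semiring_1 poly"
  assumes "finite A" "\<And>i. i \<in> A \<Longrightarrow> degree (f i) \<le> a i"
  shows "degree (prod f A) \<le> sum a A \<and> coeff (prod f A) (sum a A) = (\<Prod>i\<in>A. coeff (f i) (a i))"
  using assms
proof (induction A rule: finite_induct)
  case (insert x A)
  then have IH: "degree (prod f A) \<le> sum a A" "coeff (prod f A) (sum a A) = (\<Prod>i\<in>A. coeff (f i) (a i))"
    and x: "degree (f x) \<le> a x" by auto
  have "degree (f x * prod f A) \<le> a x + sum a A"
    using degree_mult_le[of "f x" "prod f A"] x IH(1) by linarith
  then show ?case
    using insert.hyps IH coeff_mult_degree_bound[OF x IH(1)] by simp
qed simp

lemma coeff_of_int_mult: "coeff (of_int c * q) m = of_int c * coeff q m"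
  for q :: "'a::comm_ring_1 poly"
  by (simp add: of_int_poly)

section \<open>Evaluation and leading coefficients of minors of polynomial matrices\<close>

lemma minor_list_expand:
  "minor_list k v xs = (\<Sum>p | p permutes {0..<k}. of_int (sign p) * (\<Prod>i = 0..<k. v i (xs ! p i)))"
proof -
  have "minor_list k v xs = (\<Sum>p | p permutes {0..<k}. of_int (sign p) *
      (\<Prod>i = 0..<k. mat k k (\<lambda>(r, c). v r (xs ! c)) $$ (i, p i)))"
    unfolding minor_list_def by (rule det_def') simp
  also have "\<dots> = (\<Sum>p | p permutes {0..<k}. of_int (sign p) * (\<Prod>i = 0..<k. v i (xs ! p i)))"
    by (intro sum.cong refl arg_cong2[where f = times] prod.cong) (auto dest: permutes_in_image)
  finally show ?thesis .
qed

lemma minor_list_poly: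
  "poly (minor_list k b xs) t = minor_list k (\<lambda>i j. poly (b i j) t) xs"
  by (simp add: minor_list_expand poly_sum poly_prod)

text \<open>Each product in the Leibniz formula has one factor from every row, so its coefficient at
  the sum of the bounds is the product of the coefficients of degree \<open>a i\<close>.\<close>

lemma minor_list_coeff:
  assumes "\<And>i j. i < k \<Longrightarrow> degree (b i j) \<le> a i"
  shows "coeff (minor_list k b xs) (\<Sum>i<k. a i) = minor_list k (\<lambda>i j. coeff (b i j) (a i)) xs"
proof -
  have "coeff (\<Prod>i = 0..<k. b i (xs ! p i)) (\<Sum>i<k. a i) = (\<Prod>i = 0..<k. coeff (b i (xs ! p i)) (a i))"
    for p
    using coeff_prod_degree_bound[of "{0..<k}" "\<lambda>i. b i (xs ! p i)" a] assms by (simp add: lessThan_atLeast0)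
  then show ?thesis by (simp add: minor_list_expand coeff_sum coeff_of_int_mult)
qed

text \<open>A relation \<open>x\<close> of the new family unfolds to the relation \<open>y\<close>
  of the old one. Its coefficient at \<open>m\<close> gives \<open>x m = 0\<close>, because
  \<open>c\<close> and \<open>l m\<close> are nonzero, and then \<open>y\<close> agrees with
  \<open>x\<close>.\<close>

lemma lin_indep_replace:
  assumes "lin_indep k v" "m < k" "l m \<noteq> 0" "c \<noteq> 0"
  shows "lin_indep k (v(m := \<lambda>j. c * (\<Sum>i<k. l i * v i j)))"
  unfolding lin_indep_def
proof (intro allI impI)
  fix x i
  assume z: "\<forall>j. (\<Sum>i<k. x i * (v(m := \<lambda>j. c * (\<Sum>i<k. l i * v i j))) i j) = 0" and i: "i < k"
  define y where "y = (\<lambda>i. x m * c * l i + (if i = m then 0 else x i))"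
  have "(\<Sum>i<k. y i * v i j) = 0" for j
  proof -
    have "(\<Sum>i<k. y i * v i j) = x m * c * (\<Sum>i<k. l i * v i j) + (\<Sum>i<k. (if i = m then 0 else x i) * v i j)"
      unfolding sum_distrib_left sum.distrib[symmetric] by (intro sum.cong) (auto simp: y_def algebra_simps)
    also have "(\<Sum>i<k. (if i = m then 0 else x i) * v i j) = (\<Sum>i\<in>{..<k} - {m}. x i * v i j)"
      using assms(2) by (subst sum.remove[of _ m]) (auto intro!: sum.cong)
    also have "x m * c * (\<Sum>i<k. l i * v i j) + \<dots> =
        (\<Sum>i<k. x i * (v(m := \<lambda>j. c * (\<Sum>i<k. l i * v i j))) i j)"
      using assms(2) by (subst (3) sum.remove[of _ m]) (auto intro!: sum.cong)
    finally show ?thesis using z by simp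
  qed
  then have y0: "y i = 0" if "i < k" for i
    using lin_indepD[OF assms(1) _ that, of y] by blast
  then have "x m = 0" using assms(2-4) by (force simp: y_def)
  then show "x i = 0" using y0[OF i] by (cases "i = m") (auto simp: y_def)
qed

text \<open>Selects the vector to be replaced in a reduction: among those occurring in a relation,
  one with the largest degree bound, so that the combination obeys the same bound.\<close>

lemma obtain_maximal_index:
  fixes a :: "nat \<Rightarrow> nat"
  assumes "\<exists>i<k. P i"
  obtains m where "m < k" "P m" "\<And>i. i < k \<Longrightarrow> P i \<Longrightarrow> a i \<le> a m"
proof -
  let ?A = "{i. i < k \<and> P i}"
  have fin: "finite ?A" "?A \<noteq> {}" using assms by auto
  then have "Max (a ` ?A) \<in> a ` ?A" by (intro Max_in) auto
  then obtain m where m: "m \<in> ?A" "a m = Max (a ` ?A)" by auto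
  have "a i \<le> a m" if "i < k" "P i" for i
    unfolding m(2) using fin that by (intro Max_ge) auto
  then show thesis using m that by blast
qed

lemma sum_fun_upd_less:
  fixes a :: "nat \<Rightarrow> nat"
  assumes "m < k" "0 < a m"
  shows "(\<Sum>i<k. (a(m := a m - 1)) i) < (\<Sum>i<k. a i)"
  using assms by (intro sum_strict_mono_ex1) auto


section \<open>Minimal polynomial bases of a curve in the Grassmannian\<close>

definition eval_vec :: "(nat \<Rightarrow> complex poly) \<Rightarrow> complex \<Rightarrow> cvec" where
  "eval_vec v t = (\<lambda>j. poly (v j) t)"

text \<open>Passing from \<open>v t\<close> to \<open>v (2 * t) - 2 ^ e * v t\<close> removes the coefficient of degree \<open>e\<close>.\<close>

lemma coeff_in_subspace:
  assumes "cvec.subspace B" "\<And>j. degree (v j) \<le> e" "\<And>t. eval_vec v t \<in> B"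
  shows "(\<lambda>j. coeff (v j) m) \<in> B"
  using assms(2,3)
proof (induction e arbitrary: v m)
  case 0
  have "coeff (v j) m = (if m = 0 then poly (v j) 0 else 0)" for j
    using 0(1)[of j] by (auto simp: poly_0_coeff_0 coeff_eq_0)
  then have "(\<lambda>j. coeff (v j) m) = (if m = 0 then eval_vec v 0 else 0)"
    by (auto simp: eval_vec_def)
  then show ?case using 0(2) cvec.subspace_0[OF assms(1)] by simp
next
  case (Suc e)
  define u where "u = (\<lambda>j. pcompose (v j) [:0, 2:] - smult (2 ^ Suc e) (v j))"
  have cu: "coeff (u j) m = (2 ^ m - 2 ^ Suc e) * coeff (v j) m" for j m
    by (simp add: u_def coeff_pcompose_linear left_diff_distrib)
  have "degree (u j) \<le> e" for j
  proof (rule degree_le, intro allI impI)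
    fix i assume "e < i"
    then consider "i = Suc e" | "Suc e < i" by linarith
    then show "coeff (u j) i = 0"
      using Suc.prems(1)[of j] by cases (auto simp: cu coeff_eq_0)
  qed
  moreover have "eval_vec u t \<in> B" for t
  proof -
    have "eval_vec u t = eval_vec v (2 * t) - scl (2 ^ Suc e) (eval_vec v t)"
      by (auto simp: eval_vec_def u_def poly_pcompose scl_def mult.commute)
    also have "\<dots> \<in> B"
      by (intro cvec.subspace_diff cvec.subspace_scale assms(1) Suc.prems(2))
    finally show ?thesis .
  qed
  ultimately have IH: "(\<lambda>j. coeff (u j) m) \<in> B" for m using Suc.IH[of u m] by blast
  have low: "(\<lambda>j. coeff (v j) m) \<in> B" if "m \<noteq> Suc e" for m
  proof -
    \<comment> \<open>Distinct powers of two have distinct absolute values, so the factor acquired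
      by \<open>coeff (v j) m\<close> is invertible.\<close>
    have "(2::complex) ^ m \<noteq> 2 ^ Suc e"
    proof
      assume "(2::complex) ^ m = 2 ^ Suc e"
      then have "norm ((2::complex) ^ m) = norm ((2::complex) ^ Suc e)" by (rule arg_cong)
      then have "(2::real) ^ m = 2 ^ Suc e" by (simp only: norm_power norm_numeral)
      then show False using that by (simp only: power_inject_exp)
    qed
    then have "(2::complex) ^ m - 2 ^ Suc e \<noteq> 0" by simp
    then have "(\<lambda>j. coeff (v j) m) = scl (1 / (2 ^ m - 2 ^ Suc e)) (\<lambda>j. coeff (u j) m)"
      by (simp add: cu scl_def)
    also have "\<dots> \<in> B" by (intro cvec.subspace_scale assms(1) IH)
    finally show ?thesis .
  qed
  show ?case
  proof (cases "m = Suc e")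
    case True
    \<comment> \<open>The coefficient lost in \<open>u\<close> is recovered as the value at 1 minus
      all lower coefficients.\<close>
    have "poly (v j) 1 = (\<Sum>m\<le>Suc e. coeff (v j) m)" for j
      by (subst poly_as_sum_of_monoms'[OF Suc.prems(1), symmetric]) (simp only: poly_sum poly_monom power_one mult_1_right)
    then have "(\<lambda>j. coeff (v j) m) = eval_vec v 1 - (\<Sum>m\<le>e. (\<lambda>j. coeff (v j) m))"
      using True by (auto simp: eval_vec_def sum_fun_apply)
    also have "\<dots> \<in> B"
      using low by (intro cvec.subspace_diff cvec.subspace_sum assms(1) Suc.prems(2)) auto
    finally show ?thesis .
  next
    case False
    then show ?thesis by (rule low)
  qed
qed

text \<open>The affine part of a morphism. Nothing is assumed at infinity; that point enters in
  \<open>constant_in_limit\<close> and \<open>limit_subset\<close> through the coefficients of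
  degree \<open>e\<close>.\<close>

locale polynomial_curve =
  fixes k n e :: nat and G :: "complex \<Rightarrow> cvec set" and Q :: "nat set \<Rightarrow> complex poly"
  assumes degree_Q: "S \<in> ksubsets k n \<Longrightarrow> degree (Q S) \<le> e"
    and pluecker_Q: "pluecker_coords k n (G t) (\<lambda>S. poly (Q S) t)"
begin

lemma subspace_G: "cvec.subspace (G t)" "G t \<subseteq> coord_space {1..n}" "cvec.dim (G t) = k"
  using pluecker_Q[of t] by (auto simp: pluecker_coords_def Gr_def)

text \<open>In a chart with \<open>Q S\<close> nonzero at \<open>t\<close>, membership amounts to
  polynomial identities, and these hold everywhere once they hold at all but finitely many
  parameters.\<close>

lemma eval_vec_closed:
  assumes "finite X" "\<And>t. t \<notin> X \<Longrightarrow> eval_vec v t \<in> G t"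
  shows "eval_vec v t \<in> G t"
proof -
  obtain S where S: "S \<in> ksubsets k n" "poly (Q S) t \<noteq> 0"
    using pluecker_coords_nonzero[OF pluecker_Q] by blast
  let ?xs = "sorted_list_of_set S"
  let ?R = "X \<union> {s. poly (Q S) s = 0}"
  have fin: "finite ?R" using assms(1) S(2) poly_roots_finite[of "Q S"] by (cases "Q S = 0") auto
  have chart: "w \<in> G s \<longleftrightarrow> w \<in> coord_space {1..n} \<and> (\<forall>j\<in>{1..n}. poly (Q S) s * w j =
      (\<Sum>i<k. w (?xs ! i) * poly (exchange S Q i j) s))" if "poly (Q S) s \<noteq> 0" for w s
    using pluecker_chart[OF pluecker_Q S(1) that] by (simp add: exchange_poly)
  have "Q S * v j - (\<Sum>i<k. v (?xs ! i) * exchange S Q i j) = 0" if j: "j \<in> {1..n}" for j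
  proof (rule poly_zero_cofinite[OF fin])
    fix s assume "s \<notin> ?R"
    then have "eval_vec v s \<in> G s" "poly (Q S) s \<noteq> 0" using assms(2) by auto
    then show "poly (Q S * v j - (\<Sum>i<k. v (?xs ! i) * exchange S Q i j)) s = 0"
      using chart j by (simp add: eval_vec_def poly_sum)
  qed
  then have *: "poly (Q S) t * eval_vec v t j = (\<Sum>i<k. eval_vec v t (?xs ! i) * poly (exchange S Q i j) t)"
    if "j \<in> {1..n}" for j
    using that by (simp add: eval_vec_def poly_sum flip: poly_mult)
  have "v j = 0" if "j \<notin> {1..n}" for j
  proof (rule poly_zero_cofinite[OF fin])
    fix s assume "s \<notin> ?R"
    then have "eval_vec v s \<in> coord_space {1..n}" using assms(2) subspace_G(2) by blast
    then show "poly (v j) s = 0" using that by (simp add: eval_vec_def coord_space_def)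
  qed
  then have "eval_vec v t \<in> coord_space {1..n}" by (simp add: eval_vec_def coord_space_def)
  with * show ?thesis using chart[OF S(2)] by blast
qed

text \<open>\<open>a i\<close> only bounds the degrees, and independence is asked at a single
  parameter, so the condition is easily checked after one vector has been replaced. Independence at
  all parameters follows from minimality.\<close>

definition admissible :: "(nat \<Rightarrow> nat) \<Rightarrow> (nat \<Rightarrow> nat \<Rightarrow> complex poly) \<Rightarrow> bool" where
  "admissible a b \<longleftrightarrow> (\<forall>i<k. \<forall>j. degree (b i j) \<le> a i) \<and> (\<forall>i<k. \<forall>t. eval_vec (b i) t \<in> G t) \<and>
     (\<exists>t. lin_indep k (\<lambda>i. eval_vec (b i) t))"

text \<open>In the chart of \<open>S\<close> these are the rows of the reduced echelon basis
  multiplied by the common denominator \<open>Q S\<close>: on the columns of \<open>S\<close> they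
  form \<open>Q S\<close> times the identity matrix.\<close>

definition exchange_vec :: "nat set \<Rightarrow> nat \<Rightarrow> nat \<Rightarrow> complex poly" where
  "exchange_vec S i j = (if j \<in> {1..n} then exchange S Q i j else 0)"

lemma exchange_vec_nth:
  assumes "S \<in> ksubsets k n" "i < k" "l < k"
  shows "exchange_vec S i (sorted_list_of_set S ! l) = (if i = l then Q S else 0)"
proof -
  let ?xs = "sorted_list_of_set S"
  note Sk = ksubsets_simps[OF assms(1)]
  have "?xs ! l \<in> S" "?xs ! l \<in> {1..n}"
    using Sk assms(3) nth_mem[of l ?xs] by auto
  then show ?thesis
    using assms Sk(4) by (auto simp: exchange_vec_def exchange_def nth_eq_iff_index_eq)
qed

text \<open>Off the roots of \<open>Q S\<close> the chart equations hold, since among the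
  coordinates in \<open>S\<close> only the \<open>i\<close>-th is nonzero, with value
  \<open>Q S\<close>; closedness covers the roots.\<close>

lemma exchange_vec_in_G:
  assumes S: "S \<in> ksubsets k n" "Q S \<noteq> 0" and i: "i < k"
  shows "eval_vec (exchange_vec S i) t \<in> G t"
proof (rule eval_vec_closed[of "{s. poly (Q S) s = 0}"])
  let ?xs = "sorted_list_of_set S"
  show "finite {s. poly (Q S) s = 0}" using S(2) by (rule poly_roots_finite)
  fix s assume "s \<notin> {s. poly (Q S) s = 0}"
  then have nz: "poly (Q S) s \<noteq> 0" by simp
  have "(\<Sum>l<k. eval_vec (exchange_vec S i) s (?xs ! l) * exchange S (\<lambda>S. poly (Q S) s) l j) =
      poly (Q S) s * eval_vec (exchange_vec S i) s j" if "j \<in> {1..n}" for j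
  proof -
    have "(\<Sum>l<k. eval_vec (exchange_vec S i) s (?xs ! l) * exchange S (\<lambda>S. poly (Q S) s) l j) =
        (\<Sum>l<k. if i = l then poly (Q S) s * exchange S (\<lambda>S. poly (Q S) s) l j else 0)"
      using exchange_vec_nth[OF S(1) i] by (intro sum.cong) (auto simp: eval_vec_def)
    also have "\<dots> = poly (Q S) s * eval_vec (exchange_vec S i) s j"
      using i that by (simp add: eval_vec_def exchange_vec_def exchange_poly)
    finally show ?thesis .
  qed
  moreover have "eval_vec (exchange_vec S i) s \<in> coord_space {1..n}"
    by (simp add: eval_vec_def exchange_vec_def coord_space_def)
  ultimately show "eval_vec (exchange_vec S i) s \<in> G s"
    using pluecker_chart[OF pluecker_Q S(1) nz] by simp
qed

lemma degree_exchange_vec: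
  assumes "S \<in> ksubsets k n" "i < k"
  shows "degree (exchange_vec S i j) \<le> e"
  using exchange_degree[OF assms _ degree_Q] by (simp add: exchange_vec_def)

lemma admissible_exists: "\<exists>a b. admissible a b"
proof -
  obtain S where S: "S \<in> ksubsets k n" "poly (Q S) 0 \<noteq> 0"
    using pluecker_coords_nonzero[OF pluecker_Q] by blast
  then have "Q S \<noteq> 0" by auto
  let ?xs = "sorted_list_of_set S"
  have "lin_indep k (\<lambda>i. eval_vec (exchange_vec S i) 0)"
    unfolding lin_indep_def
  proof (intro allI impI)
    fix x l assume z: "\<forall>j. (\<Sum>i<k. x i * eval_vec (exchange_vec S i) 0 j) = 0" and l: "l < k"
    have "(\<Sum>i<k. x i * eval_vec (exchange_vec S i) 0 (?xs ! l)) =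
        (\<Sum>i<k. if i = l then x i * poly (Q S) 0 else 0)"
      using exchange_vec_nth[OF S(1) _ l] by (intro sum.cong) (auto simp: eval_vec_def)
    also have "\<dots> = x l * poly (Q S) 0" using l by simp
    finally show "x l = 0" using z S(2) by auto
  qed
  then have "admissible (\<lambda>_. e) (exchange_vec S)"
    unfolding admissible_def
    using exchange_vec_in_G[OF S(1) \<open>Q S \<noteq> 0\<close>] degree_exchange_vec[OF S(1)] by blast
  then show ?thesis by blast
qed

text \<open>Minimal polynomial bases in the sense of Forney; geometrically the \<open>a i\<close>
  describe the splitting of the pulled-back tautological bundle into line bundles.\<close>

definition minimal_basis :: "(nat \<Rightarrow> nat) \<Rightarrow> (nat \<Rightarrow> nat \<Rightarrow> complex poly) \<Rightarrow> bool" where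
  "minimal_basis a b \<longleftrightarrow> admissible a b \<and>
     (\<forall>a' b'. admissible a' b' \<longrightarrow> (\<Sum>i<k. a i) \<le> (\<Sum>i<k. a' i))"

lemma minimal_basis_exists: "\<exists>a b. minimal_basis a b"
proof -
  obtain a0 where "\<exists>b. admissible a0 b" using admissible_exists by blast
  then obtain a where "\<exists>b. admissible a b"
    "\<forall>a'. (\<exists>b. admissible a' b) \<longrightarrow> (\<Sum>i<k. a i) \<le> (\<Sum>i<k. a' i)"
    using ex_has_least_nat[of "\<lambda>a. \<exists>b. admissible a b" a0 "\<lambda>a. \<Sum>i<k. a i"] by blast
  then show ?thesis unfolding minimal_basis_def by blast
qed

lemma minimal_basisD:
  assumes "minimal_basis a b"
  shows "i < k \<Longrightarrow> degree (b i j) \<le> a i" "i < k \<Longrightarrow> eval_vec (b i) t \<in> G t"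
    "\<exists>t. lin_indep k (\<lambda>i. eval_vec (b i) t)"
  using assms unfolding minimal_basis_def admissible_def by blast+

text \<open>Both reductions below end here: replacing one vector by \<open>v\<close> lowers the
  total of the bounds by one.\<close>

lemma minimal_basis_no_smaller:
  assumes "minimal_basis a b" "m < k" "0 < a m"
    "\<And>j. degree (v j) \<le> a m - 1" "\<And>t. eval_vec v t \<in> G t"
    "lin_indep k ((\<lambda>i. eval_vec (b i) t)(m := eval_vec v t))"
  shows False
proof -
  note b = minimal_basisD[OF assms(1)]
  have eq: "(\<lambda>i. eval_vec ((b(m := v)) i) t) = (\<lambda>i. eval_vec (b i) t)(m := eval_vec v t)" by auto
  have "admissible (a(m := a m - 1)) (b(m := v))"
    unfolding admissible_def
  proof (intro conjI exI)
    show "lin_indep k (\<lambda>i. eval_vec ((b(m := v)) i) t)" unfolding eq by (rule assms(6))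
  qed (use b(1,2) assms(4,5) in auto)
  then show False
    using assms(1) sum_fun_upd_less[where a = a, OF assms(2,3)] unfolding minimal_basis_def by (meson leD)
qed

lemma sum_in_G:
  assumes "\<And>i. i < k \<Longrightarrow> w i \<in> G t"
  shows "(\<lambda>j. \<Sum>i<k. c i * w i j) \<in> G t"
  using assms by (intro sum_scl_in_subspace subspace_G) auto

text \<open>
  If the values at \<open>t0\<close> were dependent, the combination vanishing there could be divided by the
  linear polynomial with root \<open>t0\<close>, which lowers a degree.
\<close>

lemma minimal_basis_lin_indep:
  assumes "minimal_basis a b"
  shows "lin_indep k (\<lambda>i. eval_vec (b i) t0)"
proof (rule ccontr)
  assume "\<not> lin_indep k (\<lambda>i. eval_vec (b i) t0)"
  then obtain l where l: "\<And>j. (\<Sum>i<k. l i * eval_vec (b i) t0 j) = 0" "\<exists>i<k. l i \<noteq> 0"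
    unfolding lin_indep_def by blast
  note b = minimal_basisD[OF assms]
  obtain t1 where t1: "lin_indep k (\<lambda>i. eval_vec (b i) t1)" using b(3) by blast
  then have "t1 \<noteq> t0" using \<open>\<not> lin_indep k (\<lambda>i. eval_vec (b i) t0)\<close> by blast
  obtain m where m: "m < k" "l m \<noteq> 0" and max: "\<And>i. i < k \<Longrightarrow> l i \<noteq> 0 \<Longrightarrow> a i \<le> a m"
    using obtain_maximal_index[OF l(2), of a] by metis
  define v where "v = (\<lambda>j. \<Sum>i<k. smult (l i) (b i j))"
  have v: "poly (v j) t = (\<Sum>i<k. l i * eval_vec (b i) t j)" for t j
    by (simp add: v_def eval_vec_def poly_sum)
  have deg: "degree (v j) \<le> a m" for j
    unfolding v_def
  proof (rule degree_sum_le)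
    fix i assume "i \<in> {..<k}"
    then show "degree (smult (l i) (b i j)) \<le> a m"
      using b(1)[of i j] max[of i] by (cases "l i = 0") auto
  qed simp
  have root: "poly (v j) t0 = 0" for j using v l(1) by simp
  have "\<forall>j. \<exists>q. v j = [:-t0, 1:] * q"
    using root by (auto simp del: mult_pCons_left simp: poly_eq_0_iff_dvd dvd_def)
  then obtain q where q: "\<And>j. v j = [:-t0, 1:] * q j" by metis
  have dq: "v j = 0 \<and> q j = 0 \<or> degree (v j) = Suc (degree (q j))" for j
  proof (cases "q j = 0")
    case False
    then show ?thesis unfolding q by (simp add: degree_mult_eq del: mult_pCons_left)
  qed (simp add: q)
  \<comment> \<open>With \<open>a m = 0\<close> the combination would be constant with a zero, hence
    identically zero, against independence at \<open>t1\<close>.\<close>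
  have "a m > 0"
  proof (rule ccontr)
    assume "\<not> a m > 0"
    then have "v j = 0" for j using dq[of j] deg[of j] by auto
    then have "(\<Sum>i<k. l i * eval_vec (b i) t1 j) = 0" for j using v[of j t1] by simp
    then show False using lin_indepD[OF t1 _ m(1), of l] m(2) by blast
  qed
  have qt: "poly (q j) t = 1 / (t - t0) * (\<Sum>i<k. l i * eval_vec (b i) t j)" if "t \<noteq> t0" for t j
    using v[of j t] that by (simp add: q field_simps)
  show False
  proof (rule minimal_basis_no_smaller[OF assms m(1) \<open>a m > 0\<close>])
    show "degree (q j) \<le> a m - 1" for j using dq[of j] deg[of j] by auto
    \<comment> \<open>Away from \<open>t0\<close> the quotient is a multiple of a vector of the
      subspace; closedness adds \<open>t0\<close>.\<close>
    show "eval_vec q t \<in> G t" for t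
    proof (rule eval_vec_closed[of "{t0}"])
      fix s assume "s \<notin> {t0}"
      then have "eval_vec q s = scl (1 / (s - t0)) (\<lambda>j. \<Sum>i<k. l i * eval_vec (b i) s j)"
        using qt by (simp add: eval_vec_def scl_def)
      also have "\<dots> \<in> G s"
        using b(2) by (intro cvec.subspace_scale subspace_G sum_in_G)
      finally show "eval_vec q s \<in> G s" .
    qed simp
    have "eval_vec q t1 = (\<lambda>j. 1 / (t1 - t0) * (\<Sum>i<k. l i * eval_vec (b i) t1 j))"
      using qt[OF \<open>t1 \<noteq> t0\<close>] unfolding eval_vec_def by blast
    then show "lin_indep k ((\<lambda>i. eval_vec (b i) t1)(m := eval_vec q t1))"
      using lin_indep_replace[OF t1 m(1), of l "1 / (t1 - t0)"] m(2) \<open>t1 \<noteq> t0\<close> by simp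
  qed
qed

text \<open>Dependent leading coefficients would likewise allow a reduction of the highest degree.\<close>

lemma minimal_basis_leading_lin_indep:
  assumes "minimal_basis a b"
  shows "lin_indep k (\<lambda>i j. coeff (b i j) (a i))"
proof (rule ccontr)
  assume "\<not> lin_indep k (\<lambda>i j. coeff (b i j) (a i))"
  then obtain l where l: "\<And>j. (\<Sum>i<k. l i * coeff (b i j) (a i)) = 0" "\<exists>i<k. l i \<noteq> 0"
    unfolding lin_indep_def by blast
  note b = minimal_basisD[OF assms]
  obtain t1 where t1: "lin_indep k (\<lambda>i. eval_vec (b i) t1)" using b(3) by blast
  obtain m where m: "m < k" "l m \<noteq> 0" and max: "\<And>i. i < k \<Longrightarrow> l i \<noteq> 0 \<Longrightarrow> a i \<le> a m"
    using obtain_maximal_index[OF l(2), of a] by metis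
  \<comment> \<open>Powers of the variable raise all occurring vectors to the common degree bound
    \<open>a m\<close>, where the relation \<open>l\<close> cancels the top coefficients. Where
    \<open>a m - a i\<close> is truncated, \<open>l i\<close> is zero.\<close>
  define v where "v = (\<lambda>j. \<Sum>i<k. monom (l i) (a m - a i) * b i j)"
  have v: "poly (v j) t = (\<Sum>i<k. (l i * t ^ (a m - a i)) * eval_vec (b i) t j)" for t j
    by (simp add: v_def eval_vec_def poly_sum poly_monom mult_ac)
  have degi: "degree (monom (l i) (a m - a i) * b i j) \<le> a m" if "i < k" for i j
  proof (cases "l i = 0")
    case False
    then show ?thesis
      using degree_mult_le[of "monom (l i) (a m - a i)" "b i j"] b(1)[OF that, of j] max[OF that]
        degree_monom_eq[OF False] by auto
  qed simp
  have deg: "degree (v j) \<le> a m" for j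
    unfolding v_def by (rule degree_sum_le) (use degi in auto)
  have "coeff (v j) (a m) = (\<Sum>i<k. l i * coeff (b i j) (a i))" for j
  proof -
    have "coeff (monom (l i) (a m - a i) * b i j) (a m) = l i * coeff (b i j) (a i)" if "i < k" for i
      using max[OF that] by (cases "l i = 0") (auto simp: coeff_monom_mult)
    then show ?thesis by (simp add: v_def coeff_sum)
  qed
  then have top: "coeff (v j) (a m) = 0" for j using l(1) by simp
  have "a m > 0"
  proof (rule ccontr)
    assume "\<not> a m > 0"
    then have "v j = 0" for j using deg[of j] top[of j] by (auto elim!: degree_eq_zeroE)
    then have "(\<Sum>i<k. (l i * t1 ^ (a m - a i)) * eval_vec (b i) t1 j) = 0" for j using v[of j t1] by simp
    then have "l m * t1 ^ (a m - a m) = 0"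
      by (rule lin_indepD[OF t1 _ m(1), of "\<lambda>i. l i * t1 ^ (a m - a i)"])
    then show False using m(2) by simp
  qed
  show False
  proof (rule minimal_basis_no_smaller[OF assms m(1) \<open>a m > 0\<close>])
    show "degree (v j) \<le> a m - 1" for j
    proof (rule degree_le, intro allI impI)
      fix i assume "a m - 1 < i"
      then have "i = a m \<or> i > a m" by linarith
      then show "coeff (v j) i = 0" using top[of j] deg[of j] by (auto intro: coeff_eq_0)
    qed
    show "eval_vec v t \<in> G t" for t
      unfolding eval_vec_def[of v] v using b(2) by (intro sum_in_G)
    have "eval_vec v t1 = (\<lambda>j. 1 * (\<Sum>i<k. (l i * t1 ^ (a m - a i)) * eval_vec (b i) t1 j))"
      unfolding eval_vec_def[of v] v by simp
    then show "lin_indep k ((\<lambda>i. eval_vec (b i) t1)(m := eval_vec v t1))"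
      using lin_indep_replace[OF t1 m(1), of "\<lambda>i. l i * t1 ^ (a m - a i)" 1] m(2) by simp
  qed
qed

lemma minimal_basis_span:
  assumes "minimal_basis a b"
  shows "cvec.span ((\<lambda>i. eval_vec (b i) t) ` {..<k}) = G t"
proof (rule subspace_eq_fin_gen)
  show "fin_gen (G t)" using fin_gen_coord_space[OF _ subspace_G(2)] by simp
  show "cvec.span ((\<lambda>i. eval_vec (b i) t) ` {..<k}) \<subseteq> G t"
    using minimal_basisD(2)[OF assms] by (intro cvec.span_minimal subspace_G) auto
  show "cvec.dim (G t) \<le> cvec.dim (cvec.span ((\<lambda>i. eval_vec (b i) t) ` {..<k}))"
    using lin_indep_dim[OF minimal_basis_lin_indep[OF assms]] subspace_G(3) by simp
qed (auto simp: subspace_G)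

lemma minimal_basis_in_coord_space:
  assumes "minimal_basis a b" "i < k"
  shows "eval_vec (b i) t \<in> coord_space {1..n}" "(\<lambda>j. coeff (b i j) m) \<in> coord_space {1..n}"
proof -
  show *: "eval_vec (b i) t \<in> coord_space {1..n}" for t
    using minimal_basisD(2)[OF assms] subspace_G(2) by blast
  have "b i j = 0" if "j \<notin> {1..n}" for j
    by (rule poly_zero_cofinite[of "{}"]) (use * that in \<open>auto simp: eval_vec_def coord_space_def\<close>)
  then show "(\<lambda>j. coeff (b i j) m) \<in> coord_space {1..n}" by (simp add: coord_space_def)
qed

text \<open>
  Both the maximal minors of a minimal basis and the \<open>Q S\<close> have no common zero, and they are
  pointwise proportional; hence each minor divides the corresponding \<open>Q S\<close>.
\<close>

lemma minimal_basis_degree_sum: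
  assumes "minimal_basis a b"
  shows "(\<Sum>i<k. a i) \<le> e"
proof -
  note b = minimal_basisD[OF assms]
  define D where "D = (\<lambda>S. minor_list k b (sorted_list_of_set S))"
  have D: "poly (D S) t = minor k (\<lambda>i. eval_vec (b i) t) S" for S t
    by (simp add: D_def minor_list_poly minor_eq_minor_list eval_vec_def)
  have ratio: "\<exists>c. \<forall>S\<in>ksubsets k n. poly (D S) t = c * poly (Q S) t" for t
  proof -
    obtain v c where v: "c \<noteq> 0" "cvec.span (v ` {..<k}) = G t"
      "\<And>S. S \<in> ksubsets k n \<Longrightarrow> poly (Q S) t = c * minor k v S"
      using pluecker_coords_basis[OF pluecker_Q[of t]] by metis
    have "eval_vec (b i) t \<in> cvec.span (v ` {..<k})" if "i < k" for i
      using b(2)[OF that] v(2) by simp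
    then obtain \<mu> where "\<And>S. minor k (\<lambda>i. eval_vec (b i) t) S = \<mu> * minor k v S"
      using minor_change_of_basis[of k "\<lambda>i. eval_vec (b i) t" v] by blast
    then have "\<forall>S\<in>ksubsets k n. poly (D S) t = \<mu> / c * poly (Q S) t"
      using D v(1,3) by simp
    then show ?thesis by blast
  qed
  \<comment> \<open>Eliminating the pointwise factor turns proportionality into polynomial
    identities.\<close>
  have cross: "D S * Q T = D T * Q S" if "S \<in> ksubsets k n" "T \<in> ksubsets k n" for S T
  proof -
    have "poly (D S * Q T) t = poly (D T * Q S) t" for t
      using ratio[of t] that by auto
    then show ?thesis using poly_eq_poly_eq_iff by blast
  qed
  have Q_nz: "poly (Q S) t \<noteq> 0" if "S \<in> ksubsets k n" "poly (D S) t \<noteq> 0" for S t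
    using ratio[of t] that by auto
  have exD: "\<exists>S\<in>ksubsets k n. poly (D S) t \<noteq> 0" for t
    unfolding D using lin_indep_minor[OF minimal_basis_lin_indep[OF assms]]
      minimal_basis_in_coord_space(1)[OF assms] by metis
  \<comment> \<open>Independent leading coefficients provide a minor whose degree is at least the
    sum of the \<open>a i\<close>.\<close>
  obtain S where S: "S \<in> ksubsets k n" "minor k (\<lambda>i j. coeff (b i j) (a i)) S \<noteq> 0"
    by (rule lin_indep_minor[OF minimal_basis_leading_lin_indep[OF assms]
      minimal_basis_in_coord_space(2)[OF assms]]) blast+
  have "coeff (D S) (\<Sum>i<k. a i) \<noteq> 0"
    using S(2) minor_list_coeff[of k b a, OF b(1)] by (simp add: D_def minor_eq_minor_list)
  then have le: "(\<Sum>i<k. a i) \<le> degree (D S)" and DS: "D S \<noteq> 0" by (auto intro: le_degree)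
  have "\<exists>t. poly (D S) t \<noteq> 0" using DS poly_all_0_iff_0 by blast
  then have QS: "Q S \<noteq> 0" using Q_nz[OF S(1)] by fastforce
  have "D S dvd Q S"
  proof (rule order_le_imp_dvd[OF DS QS])
    fix t
    \<comment> \<open>A minor that is nonzero at \<open>t\<close> has order 0 there, so
      \<open>cross\<close> leaves the desired inequality between the orders of \<open>D S\<close>
      and \<open>Q S\<close>.\<close>
    obtain T where T: "T \<in> ksubsets k n" "poly (D T) t \<noteq> 0" using exD by blast
    have nz: "D T \<noteq> 0" "Q T \<noteq> 0" using T(2) Q_nz[OF T] by auto
    have "order t (D S) + order t (Q T) = order t (D T) + order t (Q S)"
      using order_mult[of "D S" "Q T" t] order_mult[of "D T" "Q S" t] cross[OF S(1) T(1)] nz DS QS by simp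
    moreover have "order t (D T) = 0" using T(2) by (rule order_0I)
    ultimately show "order t (D S) \<le> order t (Q S)" by simp
  qed
  then have "degree (D S) \<le> degree (Q S)" using QS by (rule dvd_imp_degree_le)
  then show ?thesis using le degree_Q[OF S(1)] by simp
qed

text \<open>The basis vectors with \<open>a i = 0\<close> are constant and span \<open>A\<close>;
  each of the others uses at least one unit of the total degree, so at most \<open>e\<close> are
  missing. \<open>B\<close> is spanned by all coefficient vectors, of which \<open>b i\<close>
  contributes at most \<open>a i + 1\<close>.\<close>

lemma kernel_span_affine:
  obtains A B where "cvec.subspace A" "A \<subseteq> coord_space {1..n}" "k \<le> cvec.dim A + e"
    "cvec.subspace B" "B \<subseteq> coord_space {1..n}" "cvec.dim B \<le> k + e"
    "\<And>t. A \<subseteq> G t" "\<And>t. G t \<subseteq> B"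
proof -
  obtain a b where ab: "minimal_basis a b" using minimal_basis_exists by blast
  note b = minimal_basisD[OF ab]
  note sum = minimal_basis_degree_sum[OF ab]
  define Z where "Z = {i. i < k \<and> a i = 0}"
  define A where "A = cvec.span ((\<lambda>i. eval_vec (b i) 0) ` Z)"
  define W where "W = (\<Union>i<k. (\<lambda>m. \<lambda>j. coeff (b i j) m) ` {..a i})"
  define B where "B = cvec.span W"
  note ind = lin_indep_independent[OF minimal_basis_lin_indep[OF ab, of 0]]
  have Z: "Z \<subseteq> {..<k}" by (auto simp: Z_def)
  have const: "eval_vec (b i) 0 = eval_vec (b i) t" if "i \<in> Z" for i t
  proof -
    have "degree (b i j) = 0" for j using b(1)[of i j] that by (auto simp: Z_def)
    then have "poly (b i j) 0 = poly (b i j) t" for j by (metis degree_eq_zeroE poly_const_conv)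
    then show ?thesis by (simp add: eval_vec_def)
  qed
  have "k - card Z = card ({..<k} - Z)" using Z finite_subset[OF Z] by (simp add: card_Diff_subset)
  also have "\<dots> = (\<Sum>i\<in>{..<k} - Z. 1)" by simp
  also have "\<dots> \<le> (\<Sum>i\<in>{..<k} - Z. a i)" by (rule sum_mono) (auto simp: Z_def)
  also have "\<dots> \<le> (\<Sum>i<k. a i)" by (rule sum_mono2) auto
  finally have cZ: "k \<le> card Z + e" using sum by simp
  have dA: "cvec.dim A = card Z"
  proof -
    have "cvec.independent ((\<lambda>i. eval_vec (b i) 0) ` Z)"
      by (rule cvec.independent_mono[OF ind(2) image_mono[OF Z]])
    then have "cvec.dim A = card ((\<lambda>i. eval_vec (b i) 0) ` Z)"
      unfolding A_def by (rule cvec.dim_span_eq_card_independent)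
    also have "\<dots> = card Z" by (rule card_image[OF inj_on_subset[OF ind(1) Z]])
    finally show ?thesis .
  qed
  have AG: "A \<subseteq> G t" for t
  proof -
    have "eval_vec (b i) 0 \<in> G t" if "i \<in> Z" for i
      using const[OF that, of t] b(2)[of i t] that Z by auto
    then show ?thesis unfolding A_def by (intro cvec.span_minimal subspace_G) auto
  qed
  have dB: "cvec.dim B \<le> k + e"
  proof -
    have "card W \<le> (\<Sum>i<k. card ((\<lambda>m. \<lambda>j. coeff (b i j) m) ` {..a i}))"
      unfolding W_def by (rule card_UN_le) simp
    also have "\<dots> \<le> (\<Sum>i<k. Suc (a i))"
      by (rule sum_mono) (use card_image_le[of "{..a _}"] in fastforce)
    also have "\<dots> \<le> k + e" using sum by (simp add: sum.distrib[of "\<lambda>_. 1" a, simplified] )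
    finally show ?thesis
      using cvec.dim_le_card[of B W] unfolding B_def by (simp add: W_def)
  qed
  have GB: "G t \<subseteq> B" for t
  proof -
    have "eval_vec (b i) t \<in> B" if i: "i < k" for i
    proof -
      have "poly (b i j) t = (\<Sum>m\<le>a i. t ^ m * coeff (b i j) m)" for j
        by (subst poly_as_sum_of_monoms'[OF b(1)[OF i], symmetric]) (simp add: poly_sum poly_monom mult.commute)
      then have "eval_vec (b i) t = (\<Sum>m\<le>a i. scl (t ^ m) (\<lambda>j. coeff (b i j) m))"
        by (auto simp: eval_vec_def sum_fun_apply scl_def)
      also have "\<dots> \<in> B"
        unfolding B_def using i by (intro cvec.span_sum cvec.span_scale cvec.span_base) (auto simp: W_def)
      finally show ?thesis .
    qed
    then have "cvec.span ((\<lambda>i. eval_vec (b i) t) ` {..<k}) \<subseteq> B"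
      unfolding B_def by (intro cvec.span_minimal) auto
    then show ?thesis using minimal_basis_span[OF ab] by simp
  qed
  have "B \<subseteq> coord_space {1..n}"
    unfolding B_def W_def using minimal_basis_in_coord_space(2)[OF ab]
    by (intro cvec.span_minimal) auto
  moreover have "A \<subseteq> coord_space {1..n}" using AG subspace_G(2) by blast
  ultimately show thesis
    using that[of A B] AG GB cZ dA dB by (simp add: A_def B_def)
qed

text \<open>For a constant vector the chart equations are polynomial identities in \<open>t\<close>;
  their coefficients of degree \<open>e\<close> are the chart equations of the limit.\<close>

lemma constant_in_limit:
  assumes "pluecker_coords k n V (\<lambda>S. coeff (Q S) e)" "\<And>t. w \<in> G t"
  shows "w \<in> V"
proof -
  obtain S where S: "S \<in> ksubsets k n" "coeff (Q S) e \<noteq> 0"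
    using pluecker_coords_nonzero[OF assms(1)] by blast
  then have "Q S \<noteq> 0" by auto
  let ?xs = "sorted_list_of_set S"
  have "smult (w j) (Q S) - (\<Sum>i<k. smult (w (?xs ! i)) (exchange S Q i j)) = 0" if j: "j \<in> {1..n}" for j
  proof (rule poly_zero_cofinite[OF poly_roots_finite[OF \<open>Q S \<noteq> 0\<close>]])
    fix t assume "t \<notin> {t. poly (Q S) t = 0}"
    then show "poly (smult (w j) (Q S) - (\<Sum>i<k. smult (w (?xs ! i)) (exchange S Q i j))) t = 0"
      using pluecker_chart[OF pluecker_Q S(1), of t w] assms(2)[of t] j
      by (simp add: exchange_poly poly_sum mult.commute)
  qed
  then have "coeff (smult (w j) (Q S)) e = coeff (\<Sum>i<k. smult (w (?xs ! i)) (exchange S Q i j)) e"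
    if "j \<in> {1..n}" for j
    using that by simp
  then have "\<forall>j\<in>{1..n}. coeff (Q S) e * w j =
      (\<Sum>i<k. w (?xs ! i) * exchange S (\<lambda>T. coeff (Q T) e) i j)"
    by (simp add: coeff_sum exchange_coeff mult.commute)
  moreover have "w \<in> coord_space {1..n}" using assms(2) subspace_G(2) by blast
  ultimately show ?thesis
    using pluecker_chart[OF assms(1) S(1), of w] S(2) by blast
qed

text \<open>The chart at infinity writes \<open>w\<close> as a combination of the coefficient
  vectors of degree \<open>e\<close> of the \<open>exchange_vec S i\<close>, and these lie in
  \<open>B\<close> because all values do.\<close>

lemma limit_subset:
  assumes "pluecker_coords k n V (\<lambda>S. coeff (Q S) e)" "cvec.subspace B" "\<And>t. G t \<subseteq> B"
  shows "V \<subseteq> B"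
proof
  fix w assume "w \<in> V"
  obtain S where S: "S \<in> ksubsets k n" "coeff (Q S) e \<noteq> 0"
    using pluecker_coords_nonzero[OF assms(1)] by blast
  then have "Q S \<noteq> 0" by auto
  let ?xs = "sorted_list_of_set S"
  define u where "u = (\<lambda>i j. coeff (exchange_vec S i j) e)"
  have u: "u i \<in> B" if "i < k" for i
    unfolding u_def
    by (rule coeff_in_subspace[OF assms(2) degree_exchange_vec[OF S(1) that]])
      (use exchange_vec_in_G[OF S(1) \<open>Q S \<noteq> 0\<close> that] assms(3) in blast)
  have w: "w \<in> coord_space {1..n}" "\<And>j. j \<in> {1..n} \<Longrightarrow> coeff (Q S) e * w j =
      (\<Sum>i<k. w (?xs ! i) * exchange S (\<lambda>T. coeff (Q T) e) i j)"
    using pluecker_chart[OF assms(1) S(1), of w] S(2) \<open>w \<in> V\<close> by blast+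
  have coords: "w j = (\<Sum>i<k. w (?xs ! i) / coeff (Q S) e * u i j)" for j
  proof (cases "j \<in> {1..n}")
    case True
    have "w j = coeff (Q S) e * w j / coeff (Q S) e" using S(2) by simp
    also have "\<dots> = (\<Sum>i<k. w (?xs ! i) / coeff (Q S) e * u i j)"
      unfolding w(2)[OF True] using True
      by (simp add: u_def exchange_vec_def exchange_coeff sum_divide_distrib)
    finally show ?thesis .
  next
    case False
    then have "exchange_vec S i j = 0" "w j = 0" for i
      using w(1) by (auto simp: exchange_vec_def coord_space_def)
    then show ?thesis by (simp add: u_def)
  qed
  have "w = (\<Sum>i<k. scl (w (?xs ! i) / coeff (Q S) e) (u i))"
    unfolding fun_eq_iff sum_fun_apply scl_def by (intro allI coords)
  also have "\<dots> \<in> B"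
    using u by (intro cvec.subspace_sum cvec.subspace_scale assms(2)) auto
  finally show "w \<in> B" .
qed

end


section \<open>Kernel and span of a stable map\<close>

definition hom_pt :: "complex \<Rightarrow> complex \<Rightarrow> cvec" where
  "hom_pt s t = (\<lambda>i. if i = 1 then s else if i = 2 then t else 0)"

lemma hom_pt_simps [simp]: "hom_pt s t 1 = s" "hom_pt s t (Suc 0) = s" "hom_pt s t 2 = t"
  by (simp_all add: hom_pt_def)

lemma hom_pt_in: "hom_pt s t \<in> coord_space {1..2}"
  by (auto simp: coord_space_def hom_pt_def)

lemma hom_pt_eq_0: "hom_pt s t = 0 \<longleftrightarrow> s = 0 \<and> t = 0"
proof
  assume "hom_pt s t = 0"
  then have "hom_pt s t 1 = 0" "hom_pt s t 2 = 0" by (simp_all only: zero_fun_apply)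
  then show "s = 0 \<and> t = 0" by simp
next
  assume "s = 0 \<and> t = 0"
  then show "hom_pt s t = 0" by (intro ext) (simp add: hom_pt_def)
qed

lemma coord_space_2: "x \<in> coord_space {1..2} \<Longrightarrow> x = hom_pt (x 1) (x 2)"
proof
  fix i :: nat assume x: "x \<in> coord_space {1..2}"
  consider "i = 1" | "i = 2" | "i \<notin> {1..2}" by force
  then show "x i = hom_pt (x 1) (x 2) i"
    using x by cases (auto simp: hom_pt_def coord_space_def)
qed

lemma span_scl:
  assumes "c \<noteq> 0"
  shows "cvec.span {scl c x} = cvec.span {x}"
proof (rule cvec.span_eq[THEN iffD2], intro conjI subsetI)
  fix y assume "y \<in> {scl c x}"
  then show "y \<in> cvec.span {x}" by (auto intro: cvec.span_scale cvec.span_base)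
next
  fix y assume "y \<in> {x}"
  then have y: "y = scl (1 / c) (scl c x)" using assms by (auto simp: scl_def)
  show "y \<in> cvec.span {scl c x}"
    by (subst y, intro cvec.span_scale cvec.span_base) simp
qed

lemma span_in_P1:
  assumes "x \<in> coord_space {1..2}" "x \<noteq> 0"
  shows "cvec.span {x} \<in> P1"
proof -
  have "cvec.dim (cvec.span {x}) = card {x}"
    using assms(2) by (intro cvec.dim_span_eq_card_independent) simp
  moreover have "cvec.span {x} \<subseteq> coord_space {1..2}"
    using assms(1) by (intro cvec.span_minimal) auto
  ultimately show ?thesis by (simp add: Gr_def)
qed

lemma P1_cases:
  assumes "L \<in> P1"
  obtains t where "L = cvec.span {hom_pt t 1}" | "L = cvec.span {hom_pt 1 0}"
proof -
  have L: "cvec.subspace L" "L \<subseteq> coord_space {1..2}" "cvec.dim L = 1"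
    using assms by (auto simp: Gr_def)
  obtain B where B: "B \<subseteq> L" "cvec.independent B" "cvec.span B = L" "finite B" "card B = cvec.dim L"
    using fin_gen_basis[OF fin_gen_coord_space[OF _ L(2)] L(1)] by blast
  then obtain x where "B = {x}" using L(3) by (metis card_1_singletonE)
  then have x: "x \<in> coord_space {1..2}" "x \<noteq> 0" "L = cvec.span {x}"
    using B L(2) by auto
  define s t where "s = x 1" and "t = x 2"
  have xst: "x = hom_pt s t" using coord_space_2[OF x(1)] by (simp add: s_def t_def)
  show thesis
  proof (cases "t = 0")
    case True
    then have "s \<noteq> 0" using x(2) xst hom_pt_eq_0 by auto
    moreover have "x = scl s (hom_pt 1 0)" using xst True by (auto simp: hom_pt_def scl_def)
    ultimately show thesis using that(2) x(3) span_scl by simp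
  next
    case False
    then have "x = scl t (hom_pt (s / t) 1)" using xst by (auto simp: hom_pt_def scl_def)
    then show thesis using that(1)[of "s / t"] x(3) span_scl[OF False] by simp
  qed
qed

lemma hom_pt_in_P1: "s \<noteq> 0 \<or> t \<noteq> 0 \<Longrightarrow> cvec.span {hom_pt s t} \<in> P1"
  using span_in_P1[OF hom_pt_in] hom_pt_eq_0 by blast

lemma pluecker_coords_cong:
  assumes "pluecker_coords k n V p" "\<And>S. S \<in> ksubsets k n \<Longrightarrow> p S = q S"
  shows "pluecker_coords k n V q"
  using assms by (auto simp: pluecker_coords_def)

text \<open>Dehomogenization: the point \<open>[1 : 0]\<close> corresponds to the coefficients of degree \<open>e\<close>.\<close>

lemma morphism_affine:
  assumes "morphism_of_degree k n e F"
  obtains Q where "\<And>S. S \<in> ksubsets k n \<Longrightarrow> degree (Q S) \<le> e"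
    "\<And>t. pluecker_coords k n (F (cvec.span {hom_pt t 1})) (\<lambda>S. poly (Q S) t)"
    "pluecker_coords k n (F (cvec.span {hom_pt 1 0})) (\<lambda>S. coeff (Q S) e)"
proof -
  obtain P where P: "\<And>S. S \<in> ksubsets k n \<Longrightarrow> binary_form e (P S)"
    "\<And>x. x \<in> coord_space {1..2} - {0} \<Longrightarrow> pluecker_coords k n (F (cvec.span {x})) (\<lambda>S. P S x)"
    using assms unfolding morphism_of_degree_def by blast
  have "\<forall>S. \<exists>a. S \<in> ksubsets k n \<longrightarrow> (\<forall>x. P S x = (\<Sum>i\<le>e. a i * x 1 ^ i * x 2 ^ (e - i)))"
    using P(1) unfolding binary_form_def by blast
  then obtain a where a: "\<And>S x. S \<in> ksubsets k n \<Longrightarrow> P S x = (\<Sum>i\<le>e. a S i * x 1 ^ i * x 2 ^ (e - i))"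
    by metis
  define Q where "Q = (\<lambda>S. \<Sum>i\<le>e. monom (a S i) i)"
  have "degree (Q S) \<le> e" for S
    unfolding Q_def by (rule degree_sum_le) (auto intro: order_trans[OF degree_monom_le])
  moreover have "pluecker_coords k n (F (cvec.span {hom_pt t 1})) (\<lambda>S. poly (Q S) t)" for t
  proof -
    have "P S (hom_pt t 1) = poly (Q S) t" if "S \<in> ksubsets k n" for S
      using a[OF that] by (simp add: Q_def poly_sum poly_monom)
    then show ?thesis
      using hom_pt_in hom_pt_eq_0 by (intro pluecker_coords_cong[OF P(2)]) simp_all
  qed
  moreover have "pluecker_coords k n (F (cvec.span {hom_pt 1 0})) (\<lambda>S. coeff (Q S) e)"
  proof -
    have "P S (hom_pt 1 0) = coeff (Q S) e" if "S \<in> ksubsets k n" for S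
    proof -
      have "P S (hom_pt 1 0) = (\<Sum>i\<le>e. if i = e then a S i else 0)"
        unfolding a[OF that] by (intro sum.cong) auto
      then show ?thesis by (simp add: Q_def coeff_sum)
    qed
    then show ?thesis
      using hom_pt_in hom_pt_eq_0 by (intro pluecker_coords_cong[OF P(2)]) simp_all
  qed
  ultimately show thesis using that by blast
qed

lemma morphism_in_Gr:
  assumes "morphism_of_degree k n e F" "L \<in> P1"
  shows "F L \<in> Gr k n"
proof -
  obtain Q where "\<And>t. pluecker_coords k n (F (cvec.span {hom_pt t 1})) (\<lambda>S. poly (Q S) t)"
    "pluecker_coords k n (F (cvec.span {hom_pt 1 0})) (\<lambda>S. coeff (Q S) e)"
    by (rule morphism_affine[OF assms(1)]) blast
  then have "F (cvec.span {hom_pt t 1}) \<in> Gr k n" "F (cvec.span {hom_pt 1 0}) \<in> Gr k n" for t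
    unfolding pluecker_coords_def by blast+
  then show ?thesis by (cases rule: P1_cases[OF assms(2)]) simp_all
qed

lemma kernel_span_morphism:
  assumes "morphism_of_degree k n e F"
  obtains A B where "cvec.subspace A" "A \<subseteq> coord_space {1..n}" "k \<le> cvec.dim A + e"
    "cvec.subspace B" "B \<subseteq> coord_space {1..n}" "cvec.dim B \<le> k + e"
    "\<And>L. L \<in> P1 \<Longrightarrow> A \<subseteq> F L \<and> F L \<subseteq> B"
proof -
  obtain Q where Q: "\<And>S. S \<in> ksubsets k n \<Longrightarrow> degree (Q S) \<le> e"
    "\<And>t. pluecker_coords k n (F (cvec.span {hom_pt t 1})) (\<lambda>S. poly (Q S) t)"
    "pluecker_coords k n (F (cvec.span {hom_pt 1 0})) (\<lambda>S. coeff (Q S) e)"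
    by (rule morphism_affine[OF assms(1)]) blast
  interpret polynomial_curve k n e "\<lambda>t. F (cvec.span {hom_pt t 1})" Q
    by unfold_locales (use Q in blast)+
  obtain A B where AB: "cvec.subspace A" "A \<subseteq> coord_space {1..n}" "k \<le> cvec.dim A + e"
    "cvec.subspace B" "B \<subseteq> coord_space {1..n}" "cvec.dim B \<le> k + e"
    "\<And>t. A \<subseteq> F (cvec.span {hom_pt t 1})" "\<And>t. F (cvec.span {hom_pt t 1}) \<subseteq> B"
    by (rule kernel_span_affine) blast
  have "A \<subseteq> F (cvec.span {hom_pt 1 0})"
    using constant_in_limit[OF Q(3)] AB(7) by blast
  moreover have "F (cvec.span {hom_pt 1 0}) \<subseteq> B"
    using limit_subset[OF Q(3) AB(4,8)] by blast
  ultimately have "A \<subseteq> F L \<and> F L \<subseteq> B" if "L \<in> P1" for L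
    using AB(7,8) by (cases rule: P1_cases[OF that]) simp_all
  then show thesis using that[OF AB(1-6)] by blast
qed

text \<open>There is only one Pluecker coordinate. As a polynomial in \<open>t\<close> it has no
  root and is therefore constant, while at [1 : 0] its coefficient of degree \<open>e\<close> must
  be nonzero.\<close>

lemma morphism_to_point_degree_0:
  assumes "morphism_of_degree k n e F" "k = 0 \<or> k = n"
  shows "e = 0"
proof (rule ccontr)
  assume "e \<noteq> 0"
  obtain Q where Q: "\<And>S. S \<in> ksubsets k n \<Longrightarrow> degree (Q S) \<le> e"
    "\<And>t. pluecker_coords k n (F (cvec.span {hom_pt t 1})) (\<lambda>S. poly (Q S) t)"
    "pluecker_coords k n (F (cvec.span {hom_pt 1 0})) (\<lambda>S. coeff (Q S) e)"
    by (rule morphism_affine[OF assms(1)]) blast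
  define S0 where "S0 = (if k = 0 then {} else {1..n})"
  have S0: "S = S0" if "S \<in> ksubsets k n" for S
    using that assms(2) finite_subset[of S "{1..n}"] card_subset_eq[of "{1..n}" S]
    by (auto simp: ksubsets_def S0_def)
  have "poly (Q S0) t \<noteq> 0" for t
    using pluecker_coords_nonzero[OF Q(2)[of t]] S0 by metis
  moreover have e: "S0 \<in> ksubsets k n" "coeff (Q S0) e \<noteq> 0"
    using pluecker_coords_nonzero[OF Q(3)] S0 by metis+
  moreover have "degree (Q S0) > 0"
    using e(2) \<open>e \<noteq> 0\<close> le_degree[OF e(2)] by simp
  ultimately show False using alg_closed_imp_poly_has_root[of "Q S0"] by blast
qed

lemma dim_GrD:
  assumes "V \<in> Gr k n"
  shows "cvec.subspace V" "V \<subseteq> coord_space {1..n}" "cvec.dim V = k" "fin_gen V"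
  using assms fin_gen_coord_space[of "{1..n}" V] by (auto simp: Gr_def)

lemma rtrancl_leaves:
  assumes "(v, w) \<in> r\<^sup>*" "v \<in> T" "w \<notin> T"
  obtains x y where "(x, y) \<in> r" "x \<in> T" "y \<notin> T"
  using assms by (induction rule: rtrancl_induct) blast+

text \<open>
  Adding one component to a connected set of components costs at most its degree, since both
  kernels lie in, and both spans contain, the \<open>k\<close>-plane at the common node.
\<close>

lemma kernel_span_stable_map:
  assumes "stable_map k n d C"
  obtains A B where "cvec.subspace A" "A \<subseteq> coord_space {1..n}" "k \<le> cvec.dim A + d"
    "cvec.subspace B" "B \<subseteq> coord_space {1..n}" "cvec.dim B \<le> k + d"
    "\<And>v L. v \<in> comps C \<Longrightarrow> L \<in> P1 \<Longrightarrow> A \<subseteq> cmap C v L \<and> cmap C v L \<subseteq> B"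
proof -
  obtain e where e: "\<And>v. v \<in> comps C \<Longrightarrow> morphism_of_degree k n (e v) (cmap C v)"
    "(\<Sum>v\<in>comps C. e v) = d"
    using assms unfolding stable_map_def by blast
  have nodes: "cmap C v (node C v w) = cmap C w (node C w v)" if "(v, w) \<in> edges C" for v w
    using assms that unfolding stable_map_def by blast
  have pre: "prestable_curve C" using assms unfolding stable_map_def by (rule conjunct1)
  have tr: "tree_of_lines C" using pre unfolding prestable_curve_def by (rule conjunct1)
  have tree: "finite (comps C)" "comps C \<noteq> {}" "edges C \<subseteq> comps C \<times> comps C" "sym (edges C)"
    "\<And>v w. v \<in> comps C \<Longrightarrow> w \<in> comps C \<Longrightarrow> (v, w) \<in> (edges C)\<^sup>*"
    using tr unfolding tree_of_lines_def by simp_all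
  have node_P1: "node C v w \<in> P1" if "(v, w) \<in> edges C" for v w
  proof -
    have "v \<in> comps C" using tree(3) that by blast
    then have "node C v ` (edges C `` {v}) \<subseteq> P1"
      using pre unfolding prestable_curve_def by blast
    then show ?thesis using that by blast
  qed
  define good where "good = (\<lambda>T. T \<subseteq> comps C \<and> T \<noteq> {} \<and> (\<exists>A B.
    cvec.subspace A \<and> A \<subseteq> coord_space {1..n} \<and> k \<le> cvec.dim A + (\<Sum>v\<in>T. e v) \<and>
    cvec.subspace B \<and> B \<subseteq> coord_space {1..n} \<and> cvec.dim B \<le> k + (\<Sum>v\<in>T. e v) \<and>
    (\<forall>v\<in>T. \<forall>L\<in>P1. A \<subseteq> cmap C v L \<and> cmap C v L \<subseteq> B)))"
  obtain v0 where v0: "v0 \<in> comps C" using tree(2) by blast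
  have "good {v0}"
    unfolding good_def
    using v0 by (rule_tac kernel_span_morphism[OF e(1)[OF v0]]) (auto, blast)
  \<comment> \<open>A good set of maximal size replaces an induction along the tree: an edge leaving
    it would lead to a larger good set.\<close>
  moreover have "\<forall>T. good T \<longrightarrow> card T < Suc (card (comps C))"
    using card_mono[OF tree(1)] unfolding good_def less_Suc_eq_le by blast
  ultimately have "\<exists>T. good T \<and> (\<forall>T'. good T' \<longrightarrow> card T' \<le> card T)"
    by (rule ex_has_greatest_nat)
  then obtain T where T: "good T" and max: "\<And>T'. good T' \<Longrightarrow> card T' \<le> card T"
    by blast
  have "T = comps C"
  proof (rule ccontr)
    assume "T \<noteq> comps C"
    then obtain v w where vw: "v \<in> T" "w \<in> comps C" "w \<notin> T" using T unfolding good_def by blast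
    then have "(v, w) \<in> (edges C)\<^sup>*" using tree(5) T unfolding good_def by blast
    then obtain x y where xy: "(x, y) \<in> edges C" "x \<in> T" "y \<notin> T"
      using rtrancl_leaves[OF _ vw(1,3)] by blast
    have yx: "(y, x) \<in> edges C" using tree(4) xy(1) by (rule symD)
    have y: "y \<in> comps C" using xy(1) tree(3) by blast
    define V where "V = cmap C x (node C x y)"
    have V': "V = cmap C y (node C y x)" unfolding V_def by (rule nodes[OF xy(1)])
    obtain A B where AB: "cvec.subspace A" "A \<subseteq> coord_space {1..n}" "k \<le> cvec.dim A + (\<Sum>v\<in>T. e v)"
      "cvec.subspace B" "B \<subseteq> coord_space {1..n}" "cvec.dim B \<le> k + (\<Sum>v\<in>T. e v)"
      "\<forall>v\<in>T. \<forall>L\<in>P1. A \<subseteq> cmap C v L \<and> cmap C v L \<subseteq> B"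
      using T unfolding good_def by blast
    obtain K M where KM: "cvec.subspace K" "K \<subseteq> coord_space {1..n}" "k \<le> cvec.dim K + e y"
      "cvec.subspace M" "M \<subseteq> coord_space {1..n}" "cvec.dim M \<le> k + e y"
      "\<And>L. L \<in> P1 \<Longrightarrow> K \<subseteq> cmap C y L \<and> cmap C y L \<subseteq> M"
      by (rule kernel_span_morphism[OF e(1)[OF y]]) blast
    note fg = fin_gen_coord_space[of "{1..n}", OF finite_atLeastAtMost]
    have "V \<in> Gr k n" unfolding V' by (rule morphism_in_Gr[OF e(1)[OF y] node_P1[OF yx]])
    note V = dim_GrD[OF this]
    have AV: "A \<subseteq> V" "V \<subseteq> B" using AB(7) xy(2) node_P1[OF xy(1)] unfolding V_def by blast+
    have KV: "K \<subseteq> V" "V \<subseteq> M" using KM(7)[OF node_P1[OF yx]] unfolding V' by blast+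
    have "cvec.dim (cvec.span (A \<union> K)) \<le> k"
      using dim_mono_fin_gen[OF V(4), of "cvec.span (A \<union> K)"] AV KV V(1,3)
      by (simp add: cvec.span_minimal)
    then have dA: "k \<le> cvec.dim (A \<inter> K) + ((\<Sum>v\<in>T. e v) + e y)"
      using dim_sums_Int_fin_gen[OF fg[OF AB(2)] fg[OF KM(2)] AB(1) KM(1)] AB(3) KM(3) by linarith
    have "k \<le> cvec.dim (B \<inter> M)"
      using dim_mono_fin_gen[of "B \<inter> M" V] fg[OF AB(5)] fin_gen_subset[of B "B \<inter> M"] AV KV V(3)
      by auto
    then have dB: "cvec.dim (cvec.span (B \<union> M)) \<le> k + ((\<Sum>v\<in>T. e v) + e y)"
      using dim_sums_Int_fin_gen[OF fg[OF AB(5)] fg[OF KM(5)] AB(4) KM(4)] AB(6) KM(6) by linarith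
    have fT: "finite T" using T finite_subset[OF _ tree(1)] unfolding good_def by blast
    have sumT: "(\<Sum>v\<in>insert y T. e v) = (\<Sum>v\<in>T. e v) + e y"
      using fT xy(3) by simp
    have BM: "B \<subseteq> cvec.span (B \<union> M)" "M \<subseteq> cvec.span (B \<union> M)"
      using cvec.span_superset[of "B \<union> M"] by blast+
    have "good (insert y T)"
      unfolding good_def sumT
    proof (intro conjI exI)
      show "insert y T \<subseteq> comps C" using T y unfolding good_def by blast
      show "cvec.subspace (A \<inter> K)" using AB(1) KM(1) by (rule cvec.subspace_inter)
      show "A \<inter> K \<subseteq> coord_space {1..n}" using AB(2) by blast
      show "cvec.span (B \<union> M) \<subseteq> coord_space {1..n}"
        using AB(5) KM(5) by (intro cvec.span_minimal) auto
      show "\<forall>v\<in>insert y T. \<forall>L\<in>P1. A \<inter> K \<subseteq> cmap C v L \<and> cmap C v L \<subseteq> cvec.span (B \<union> M)"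
      proof (intro ballI conjI)
        fix v L assume v: "v \<in> insert y T" and L: "L \<in> P1"
        show "A \<inter> K \<subseteq> cmap C v L" using AB(7) KM(7)[OF L] v L by blast
        have "cmap C v L \<subseteq> B \<or> cmap C v L \<subseteq> M" using AB(7) KM(7)[OF L] v L by blast
        then show "cmap C v L \<subseteq> cvec.span (B \<union> M)" using BM by blast
      qed
    qed (use dA dB in auto)
    then show False using max[of "insert y T"] fT xy(3) by simp
  qed
  then obtain A B where AB: "cvec.subspace A" "A \<subseteq> coord_space {1..n}" "k \<le> cvec.dim A + d"
    "cvec.subspace B" "B \<subseteq> coord_space {1..n}" "cvec.dim B \<le> k + d"
    "\<forall>v\<in>comps C. \<forall>L\<in>P1. A \<subseteq> cmap C v L \<and> cmap C v L \<subseteq> B"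
    using T e(2) unfolding good_def by blast
  then show thesis using that by blast
qed

lemma stable_map_to_point_degree_0:
  assumes "stable_map k n d C" "k = 0 \<or> k = n"
  shows "d = 0"
proof -
  obtain e where "\<And>v. v \<in> comps C \<Longrightarrow> morphism_of_degree k n (e v) (cmap C v)"
    "(\<Sum>v\<in>comps C. e v) = d"
    using assms unfolding stable_map_def by blast
  then show ?thesis using morphism_to_point_degree_0[OF _ assms(2)] by (metis sum.neutral)
qed


section \<open>Ruled curves\<close>

lemma binary_form_const: "binary_form 0 (\<lambda>x. c)"
  unfolding binary_form_def by (rule exI[of _ "\<lambda>_. c"]) simp

lemma binary_form_scale: "binary_form e p \<Longrightarrow> binary_form e (\<lambda>x. c * p x)"
  unfolding binary_form_def
proof (elim exE)
  fix a assume "\<forall>x. p x = (\<Sum>i\<le>e. a i * x 1 ^ i * x 2 ^ (e - i))"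
  then show "\<exists>a. \<forall>x. c * p x = (\<Sum>i\<le>e. a i * x 1 ^ i * x 2 ^ (e - i))"
    by (intro exI[of _ "\<lambda>i. c * a i"]) (simp add: sum_distrib_left mult.assoc)
qed

lemma binary_form_add:
  assumes "binary_form e p" "binary_form e q"
  shows "binary_form e (\<lambda>x. p x + q x)"
proof -
  obtain a b where "\<forall>x. p x = (\<Sum>i\<le>e. a i * x 1 ^ i * x 2 ^ (e - i))"
    "\<forall>x. q x = (\<Sum>i\<le>e. b i * x 1 ^ i * x 2 ^ (e - i))"
    using assms unfolding binary_form_def by blast
  then show ?thesis
    unfolding binary_form_def
    by (intro exI[of _ "\<lambda>i. a i + b i"]) (simp add: sum.distrib distrib_right)
qed

lemma binary_form_sum:
  assumes "\<And>i. i \<in> A \<Longrightarrow> binary_form e (p i)"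
  shows "binary_form e (\<lambda>x. \<Sum>i\<in>A. p i x)"
  using assms
proof (induction A rule: infinite_finite_induct)
  case (insert y A)
  then show ?case using binary_form_add[of e "p y"] by simp
qed (auto simp: binary_form_def intro!: exI[of _ "\<lambda>_. 0"])

lemma binary_form_times_coords:
  assumes "binary_form e p"
  shows "binary_form (Suc e) (\<lambda>x. x 1 * p x)" "binary_form (Suc e) (\<lambda>x. x 2 * p x)"
proof -
  obtain a where a: "\<And>x. p x = (\<Sum>i\<le>e. a i * x 1 ^ i * x 2 ^ (e - i))"
    using assms unfolding binary_form_def by blast
  have "x 1 * p x = (\<Sum>i\<le>Suc e. (case i of 0 \<Rightarrow> 0 | Suc j \<Rightarrow> a j) * x 1 ^ i * x 2 ^ (Suc e - i))" for x
    unfolding a by (subst sum.atMost_Suc_shift) (simp add: sum_distrib_left mult_ac)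
  then show "binary_form (Suc e) (\<lambda>x. x 1 * p x)"
    unfolding binary_form_def by (intro exI[of _ "\<lambda>i. case i of 0 \<Rightarrow> 0 | Suc j \<Rightarrow> a j"] allI)
  have "x 2 * p x = (\<Sum>i\<le>Suc e. (if i \<le> e then a i else 0) * x 1 ^ i * x 2 ^ (Suc e - i))" for x
    unfolding a by (simp add: sum_distrib_left mult_ac Suc_diff_le)
  then show "binary_form (Suc e) (\<lambda>x. x 2 * p x)"
    unfolding binary_form_def by (intro exI[of _ "\<lambda>i. if i \<le> e then a i else 0"] allI)
qed

text \<open>The first \<open>p\<close> factors are constant and each later one adds one to the
  degree. The truncated difference \<open>k - p\<close> keeps degree 0 up to \<open>k = p\<close>,
  which carries the induction through the constant factors.\<close>

lemma binary_form_prod_linear: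
  assumes "\<And>i x. i < k \<Longrightarrow> E i x = (if i < p then c i else a i * x 1 + b i * x 2)"
  shows "binary_form (k - p) (\<lambda>x. \<Prod>i<k. E i x)"
  using assms
proof (induction k)
  case 0
  show ?case using binary_form_const[of 1] by simp
next
  case (Suc k)
  then have IH: "binary_form (k - p) (\<lambda>x. \<Prod>i<k. E i x)" by simp
  show ?case
  proof (cases "k < p")
    case True
    then show ?thesis using Suc.prems[of k] binary_form_scale[OF IH, of "c k"] by (simp add: mult.commute)
  next
    case False
    have "binary_form (Suc (k - p)) (\<lambda>x. a k * (x 1 * (\<Prod>i<k. E i x)) + b k * (x 2 * (\<Prod>i<k. E i x)))"
      by (intro binary_form_add binary_form_scale binary_form_times_coords IH)
    then show ?thesis using False Suc.prems[of k] by (simp add: Suc_diff_le algebra_simps)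
  qed
qed

text \<open>
  The vectors \<open>g i\<close> with \<open>i < p\<close> span the fixed part of the subspaces in the family; the
  remaining generators move on the lines joining \<open>g i\<close> and \<open>h i\<close>.
\<close>

definition ruled_row :: "nat \<Rightarrow> (nat \<Rightarrow> cvec) \<Rightarrow> (nat \<Rightarrow> cvec) \<Rightarrow> cvec \<Rightarrow> nat \<Rightarrow> cvec" where
  "ruled_row p g h x i = (if i < p then g i else (\<lambda>j. x 1 * g i j + x 2 * h i j))"

text \<open>The union runs over all vectors of the line \<open>L\<close>, so no representative is
  chosen. Rescaling a vector of \<open>L\<close> rescales the moving rows and leaves the fixed ones,
  so one nonzero vector already gives the span.\<close>

definition ruled_map :: "nat \<Rightarrow> nat \<Rightarrow> (nat \<Rightarrow> cvec) \<Rightarrow> (nat \<Rightarrow> cvec) \<Rightarrow> cvec set \<Rightarrow> cvec set" where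
  "ruled_map p k g h L = cvec.span (\<Union>x\<in>L. ruled_row p g h x ` {..<k})"

lemma ruled_row_in_subspace:
  assumes "cvec.subspace W" "\<And>i. i < p \<Longrightarrow> g i \<in> W"
    "\<And>i. p \<le> i \<Longrightarrow> i < k \<Longrightarrow> (\<lambda>j. x 1 * g i j + x 2 * h i j) \<in> W" "i < k"
  shows "ruled_row p g h x i \<in> W"
  using assms by (simp add: ruled_row_def)

lemma ruled_map_span:
  assumes "x \<noteq> 0" "p \<le> k"
  shows "ruled_map p k g h (cvec.span {x}) = cvec.span (ruled_row p g h x ` {..<k})"
    (is "_ = ?W")
proof
  have "ruled_row p g h y i \<in> ?W" if y: "y \<in> cvec.span {x}" and i: "i < k" for y i
  proof -
    obtain c where c: "y = scl c x" using y by (auto simp: cvec.span_singleton)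
    have base: "ruled_row p g h x i \<in> ?W" using i by (intro cvec.span_base) simp
    show ?thesis
    proof (cases "i < p")
      case True
      then show ?thesis using base by (simp add: ruled_row_def)
    next
      case False
      then have "ruled_row p g h y i = scl c (ruled_row p g h x i)"
        unfolding c by (auto simp: ruled_row_def scl_def algebra_simps)
      then show ?thesis using cvec.span_scale[OF base] by simp
    qed
  qed
  then show "ruled_map p k g h (cvec.span {x}) \<subseteq> ?W"
    unfolding ruled_map_def by (intro cvec.span_minimal) auto
  have "x \<in> cvec.span {x}" by (simp add: cvec.span_base)
  then show "?W \<subseteq> ruled_map p k g h (cvec.span {x})"
    unfolding ruled_map_def by (intro cvec.span_mono) blast
qed

text \<open>Each product in the Leibniz formula has \<open>p\<close> constant and
  \<open>k - p\<close> linear factors, so the minors of the rows are binary forms of degree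
  \<open>k - p\<close>; independence at every point makes them Pluecker coordinates.\<close>

lemma ruled_map_morphism:
  assumes "p \<le> k" "\<And>i. i < k \<Longrightarrow> g i \<in> coord_space {1..n}"
    "\<And>i. p \<le> i \<Longrightarrow> i < k \<Longrightarrow> h i \<in> coord_space {1..n}"
    "\<And>x. x \<in> coord_space {1..2} \<Longrightarrow> x \<noteq> 0 \<Longrightarrow> lin_indep k (ruled_row p g h x)"
  shows "morphism_of_degree k n (k - p) (ruled_map p k g h)"
  unfolding morphism_of_degree_def
proof (intro exI[of _ "\<lambda>S x. minor k (ruled_row p g h x) S"] conjI ballI)
  fix S :: "nat set"
  let ?xs = "sorted_list_of_set S"
  have "binary_form (k - p) (\<lambda>x. \<Prod>i<k. ruled_row p g h x i (?xs ! q i))" for q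
    by (rule binary_form_prod_linear[where c = "\<lambda>i. g i (?xs ! q i)" and a = "\<lambda>i. g i (?xs ! q i)"
        and b = "\<lambda>i. h i (?xs ! q i)"]) (simp add: ruled_row_def mult.commute)
  then have "binary_form (k - p) (\<lambda>x. \<Sum>q | q permutes {0..<k}.
      of_int (sign q) * (\<Prod>i<k. ruled_row p g h x i (?xs ! q i)))"
    by (intro binary_form_sum binary_form_scale)
  then show "binary_form (k - p) (\<lambda>x. minor k (ruled_row p g h x) S)"
    by (simp only: minor_eq_minor_list minor_list_expand lessThan_atLeast0)
next
  fix x :: cvec assume x: "x \<in> coord_space {1..2} - {0}"
  let ?W = "cvec.span (ruled_row p g h x ` {..<k})"
  have eq: "ruled_map p k g h (cvec.span {x}) = ?W"
    using ruled_map_span[OF _ assms(1)] x by simp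
  have "ruled_row p g h x i \<in> coord_space {1..n}" if "i < k" for i
    using assms(2)[of i] assms(3)[of i] that by (auto simp: ruled_row_def coord_space_def)
  then have "?W \<subseteq> coord_space {1..n}" by (intro cvec.span_minimal) auto
  then have "?W \<in> Gr k n"
    using lin_indep_dim[OF assms(4)] x by (simp add: Gr_def)
  then show "pluecker_coords k n (ruled_map p k g h (cvec.span {x}))
      (\<lambda>S. minor k (ruled_row p g h x) S)"
    unfolding eq pluecker_coords_def
    by (intro conjI exI[of _ "ruled_row p g h x"] exI[of _ 1]) simp_all
qed

section \<open>Curves through two or three prescribed points\<close>

lemma adapted_basis:
  assumes "fin_gen V" "cvec.subspace A" "cvec.subspace V" "A \<subseteq> V" "cvec.dim A = p" "cvec.dim V = k"
  obtains g where "lin_indep k g" "cvec.span (g ` {..<p}) = A" "cvec.span (g ` {..<k}) = V"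
proof -
  obtain C where C: "C \<subseteq> A" "cvec.independent C" "cvec.span C = A" "finite C" "card C = p"
    using fin_gen_basis[OF fin_gen_subset[OF assms(1,4)] assms(2)] assms(5) by blast
  have "C \<subseteq> V" using C(1) assms(4) by blast
  obtain D where D: "C \<subseteq> D" "D \<subseteq> V" "cvec.independent D" "cvec.span D = V" "finite D" "card D = k"
    using fin_gen_basis_extend[OF assms(1) C(2) \<open>C \<subseteq> V\<close> assms(3)] assms(6) by blast
  have pk: "p \<le> k" using C D card_mono by blast
  obtain g1 where g1: "bij_betw g1 {0..<p} C" using ex_bij_betw_nat_finite[OF C(4)] C(5) by blast
  have "card (D - C) = k - p" using C D by (simp add: card_Diff_subset)
  then obtain g2 where g2: "bij_betw g2 {0..<k - p} (D - C)"
    using ex_bij_betw_nat_finite[of "D - C"] D(5) by auto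
  define g where "g = (\<lambda>i. if i < p then g1 i else g2 (i - p))"
  have gC: "g ` {..<p} = C"
    using bij_betw_imp_surj_on[OF g1] by (auto simp: g_def image_def)
  have "g ` {p..<k} = g2 ` ((\<lambda>i. i - p) ` {p..<k})" by (auto simp: g_def image_def)
  also have "(\<lambda>i. i - p) ` {p..<k} = {0..<k - p}"
  proof
    show "{0..<k - p} \<subseteq> (\<lambda>i. i - p) ` {p..<k}"
    proof
      fix i assume "i \<in> {0..<k - p}"
      then show "i \<in> (\<lambda>i. i - p) ` {p..<k}" by (intro image_eqI[of _ _ "i + p"]) auto
    qed
  qed auto
  also have "g2 ` {0..<k - p} = D - C" using bij_betw_imp_surj_on[OF g2] .
  finally have gDC: "g ` {p..<k} = D - C" .
  have "{..<k} = {..<p} \<union> {p..<k}" using pk by auto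
  then have "g ` {..<k} = D" using gC gDC D(1) by (simp only: image_Un) blast
  then have "cvec.span (g ` {..<k}) = V" "cvec.span (g ` {..<p}) = A" using gC C D by simp_all
  moreover from this have "lin_indep k g" using assms(6) by (intro dim_lin_indep) simp
  ultimately show thesis using that by blast
qed

lemma Gr_eqI:
  assumes "V \<in> Gr k n" "W \<in> Gr k n" "V \<subseteq> W"
  shows "V = W"
  using subspace_eq_fin_gen[OF dim_GrD(4)[OF assms(2)] dim_GrD(1)[OF assms(1)] dim_GrD(1)[OF assms(2)] assms(3)]
    dim_GrD(3)[OF assms(1)] dim_GrD(3)[OF assms(2)] by simp

text \<open>In a relation, the combination \<open>\<beta>\<close> of the moving \<open>g i\<close>
  lies in \<open>A\<close>: for \<open>x 1 \<noteq> 0\<close> because the relation puts it into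
  \<open>V2\<close>, and at [0 : 1] because \<open>H\<close> transfers this from the
  \<open>h i\<close>. So \<open>H\<close> expresses that passing from the \<open>g i\<close> to the
  \<open>h i\<close> is injective modulo \<open>A\<close>.\<close>

lemma ruled_row_lin_indep:
  assumes g: "lin_indep k g" "p \<le> k" "cvec.span (g ` {..<p}) = A" "cvec.span (g ` {..<k}) = V1"
    and V2: "cvec.subspace V2" "V1 \<inter> V2 = A" "\<And>i. p \<le> i \<Longrightarrow> i < k \<Longrightarrow> h i \<in> V2"
    and H: "\<And>l. (\<lambda>j. \<Sum>i\<in>{p..<k}. l i * h i j) \<in> A \<Longrightarrow> (\<lambda>j. \<Sum>i\<in>{p..<k}. l i * g i j) \<in> A"
    and x: "x \<in> coord_space {1..2}" "x \<noteq> 0"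
  shows "lin_indep k (ruled_row p g h x)"
  unfolding lin_indep_def
proof (intro allI impI)
  fix l i assume z: "\<forall>j. (\<Sum>i<k. l i * ruled_row p g h x i j) = 0" and i: "i < k"
  have split: "(\<Sum>i<k. f i) = (\<Sum>i<p. f i) + (\<Sum>i\<in>{p..<k}. f i)" for f :: "nat \<Rightarrow> complex"
    using sum.atLeastLessThan_concat[of 0 p k f] g(2) by (simp add: lessThan_atLeast0)
  define \<alpha> \<beta> \<gamma> where "\<alpha> = (\<lambda>j. \<Sum>i<p. l i * g i j)" and "\<beta> = (\<lambda>j. \<Sum>i\<in>{p..<k}. l i * g i j)"
    and "\<gamma> = (\<lambda>j. \<Sum>i\<in>{p..<k}. l i * h i j)"
  have sA: "cvec.subspace A" and sV1: "cvec.subspace V1" using g(3,4) by auto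
  have gV1: "g i \<in> V1" if "i < k" for i
    using that g(4) cvec.span_base[of "g i" "g ` {..<k}"] by blast
  have "\<alpha> \<in> A" unfolding g(3)[symmetric] span_family \<alpha>_def by (intro exI[of _ l]) simp
  have "\<beta> \<in> V1" unfolding \<beta>_def using gV1 by (intro sum_scl_in_subspace sV1) auto
  have "\<gamma> \<in> V2" unfolding \<gamma>_def using V2 by (intro sum_scl_in_subspace) auto
  have rel: "\<alpha> j + x 1 * \<beta> j + x 2 * \<gamma> j = 0" for j
  proof -
    have "(\<Sum>i\<in>{p..<k}. l i * ruled_row p g h x i j) = x 1 * \<beta> j + x 2 * \<gamma> j"
      unfolding \<beta>_def \<gamma>_def sum_distrib_left sum.distrib[symmetric]
      by (intro sum.cong) (auto simp: ruled_row_def algebra_simps)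
    moreover have "(\<Sum>i<p. l i * ruled_row p g h x i j) = \<alpha> j"
      by (simp add: \<alpha>_def ruled_row_def)
    ultimately show ?thesis using z[rule_format, of j] unfolding split by (simp add: add.assoc)
  qed
  have "\<beta> \<in> A"
  proof (cases "x 1 = 0")
    case False
    have "\<beta> j = - (1 / x 1) * (\<alpha> j + x 2 * \<gamma> j)" for j
    proof -
      have "x 1 * \<beta> j = - (\<alpha> j + x 2 * \<gamma> j)" using rel[of j] by (simp add: eq_neg_iff_add_eq_0 algebra_simps)
      then show ?thesis using False by (simp add: field_simps)
    qed
    then have "\<beta> = scl (- (1 / x 1)) (\<alpha> + scl (x 2) \<gamma>)"
      unfolding scl_def plus_fun_apply by blast
    also have "\<dots> \<in> V2"
      using \<open>\<gamma> \<in> V2\<close> \<open>\<alpha> \<in> A\<close> V2(2) by (intro cvec.subspace_scale cvec.subspace_add V2(1)) auto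
    finally show ?thesis using \<open>\<beta> \<in> V1\<close> V2(2) by blast
  next
    case True
    have "x 2 \<noteq> 0"
    proof
      assume "x 2 = 0"
      then have "x = hom_pt 0 0" using coord_space_2[OF x(1)] True by simp
      then show False using x(2) hom_pt_eq_0 by simp
    qed
    have "\<gamma> j = - (1 / x 2) * \<alpha> j" for j
    proof -
      have "x 2 * \<gamma> j = - \<alpha> j" using rel[of j] True by (simp add: eq_neg_iff_add_eq_0 algebra_simps)
      then show ?thesis using \<open>x 2 \<noteq> 0\<close> by (simp add: field_simps)
    qed
    then have "\<gamma> = scl (- (1 / x 2)) \<alpha>" unfolding scl_def by blast
    also have "\<dots> \<in> A" using \<open>\<alpha> \<in> A\<close> by (intro cvec.subspace_scale sA)
    finally show ?thesis unfolding \<beta>_def \<gamma>_def by (rule H)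
  qed
  then obtain m where m: "\<And>j. \<beta> j = (\<Sum>i<p. m i * g i j)"
    unfolding g(3)[symmetric] span_family by blast
  \<comment> \<open>Writing \<open>\<beta>\<close> by the first \<open>p\<close> vectors gives a
    relation of the basis \<open>g\<close>, which kills \<open>l i\<close> for
    \<open>p \<le> i\<close>; what remains is a relation among the fixed vectors.\<close>
  have "(\<Sum>i<k. (if i < p then - m i else l i) * g i j) = 0" for j
    unfolding split using m[of j] by (simp add: \<beta>_def sum_negf)
  then have big: "l i = 0" if "p \<le> i" "i < k" for i
    using lin_indepD[OF g(1), of "\<lambda>i. if i < p then - m i else l i" i] that by simp
  then have "\<beta> j = 0" "\<gamma> j = 0" for j unfolding \<beta>_def \<gamma>_def by (auto intro!: sum.neutral)
  then have "\<alpha> j = 0" for j using rel[of j] by simp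
  then have "(\<Sum>i<k. (if i < p then l i else 0) * g i j) = 0" for j
    unfolding split by (simp add: \<alpha>_def)
  then show "l i = 0"
    using lin_indepD[OF g(1), of "\<lambda>i. if i < p then l i else 0" i] big[of i] i by (cases "i < p") auto
qed

text \<open>Each value is found by containment of the rows, since both sides are
  \<open>k\<close>-planes. The value at [1 : 1] is left as an implication because a line through two
  points prescribes no third one.\<close>

lemma ruled_curve_through:
  assumes g: "lin_indep k g" "p \<le> k" "cvec.span (g ` {..<p}) = A" "cvec.span (g ` {..<k}) = V1"
    and V: "V1 \<in> Gr k n" "V2 \<in> Gr k n" "V1 \<inter> V2 = A" "\<And>i. p \<le> i \<Longrightarrow> i < k \<Longrightarrow> h i \<in> V2"
    and H: "\<And>l. (\<lambda>j. \<Sum>i\<in>{p..<k}. l i * h i j) \<in> A \<Longrightarrow> (\<lambda>j. \<Sum>i\<in>{p..<k}. l i * g i j) \<in> A"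
  obtains F where "morphism_of_degree k n (k - p) F" "F (cvec.span {hom_pt 1 0}) = V1"
    "F (cvec.span {hom_pt 0 1}) = V2"
    "\<And>W. W \<in> Gr k n \<Longrightarrow> A \<subseteq> W \<Longrightarrow> (\<And>i. p \<le> i \<Longrightarrow> i < k \<Longrightarrow> g i + h i \<in> W) \<Longrightarrow>
       F (cvec.span {hom_pt 1 1}) = W"
proof -
  let ?F = "ruled_map p k g h"
  have gV1: "g i \<in> V1" if "i < k" for i
    using that g(4) cvec.span_base[of "g i" "g ` {..<k}"] by blast
  have gA: "g i \<in> A" if "i < p" for i
    using that g(3) cvec.span_base[of "g i" "g ` {..<p}"] by blast
  have morph: "morphism_of_degree k n (k - p) ?F"
  proof (rule ruled_map_morphism[OF g(2)])
    show "g i \<in> coord_space {1..n}" if "i < k" for i using gV1[OF that] dim_GrD(2)[OF V(1)] by blast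
    show "h i \<in> coord_space {1..n}" if "p \<le> i" "i < k" for i using V(4)[OF that] dim_GrD(2)[OF V(2)] by blast
    show "lin_indep k (ruled_row p g h x)" if "x \<in> coord_space {1..2}" "x \<noteq> 0" for x
      by (rule ruled_row_lin_indep[OF g dim_GrD(1)[OF V(2)] V(3,4) H that])
  qed
  have eval: "?F (cvec.span {hom_pt s t}) = W" if W: "W \<in> Gr k n" "A \<subseteq> W"
    and st: "s \<noteq> 0 \<or> t \<noteq> 0"
    and rows: "\<And>i. p \<le> i \<Longrightarrow> i < k \<Longrightarrow> (\<lambda>j. s * g i j + t * h i j) \<in> W" for s t W
  proof -
    have nz: "hom_pt s t \<noteq> 0" using st hom_pt_eq_0 by blast
    note eq = ruled_map_span[OF nz g(2), of g h]
    have "ruled_row p g h (hom_pt s t) i \<in> W" if "i < k" for i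
      using gA W(2) rows that by (intro ruled_row_in_subspace[OF dim_GrD(1)[OF W(1)]]) auto
    then have "?F (cvec.span {hom_pt s t}) \<subseteq> W"
      unfolding eq by (intro cvec.span_minimal dim_GrD(1)[OF W(1)]) auto
    moreover have "?F (cvec.span {hom_pt s t}) \<in> Gr k n"
      by (rule morphism_in_Gr[OF morph hom_pt_in_P1[OF st]])
    ultimately show ?thesis using Gr_eqI[OF _ W(1)] by blast
  qed
  show thesis
  proof (rule that[OF morph])
    show "?F (cvec.span {hom_pt 1 0}) = V1" using gV1 V(1,3) by (intro eval) auto
    show "?F (cvec.span {hom_pt 0 1}) = V2" using V by (intro eval) auto
    fix W assume W: "W \<in> Gr k n" "A \<subseteq> W" "\<And>i. p \<le> i \<Longrightarrow> i < k \<Longrightarrow> g i + h i \<in> W"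
    have "(\<lambda>j. 1 * g i j + 1 * h i j) = g i + h i" for i by auto
    then show "?F (cvec.span {hom_pt 1 1}) = W" using W by (intro eval) auto
  qed
qed

text \<open>The intersection has dimension \<open>k - 1\<close>, so a single vector moves, towards
  some \<open>b\<close> in \<open>U'\<close> outside \<open>U\<close>. The condition modulo
  \<open>A\<close> holds since only the zero multiple of \<open>b\<close> lies in
  \<open>U\<close>.\<close>

lemma line_through:
  assumes "U \<in> Gr k n" "U' \<in> Gr k n" "U \<noteq> U'" "k \<le> Suc (cvec.dim (U \<inter> U'))"
  obtains F where "morphism_of_degree k n 1 F" "F (cvec.span {hom_pt 1 0}) = U"
    "F (cvec.span {hom_pt 0 1}) = U'"
proof -
  let ?A = "U \<inter> U'"
  note U = dim_GrD[OF assms(1)] and U' = dim_GrD[OF assms(2)]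
  have sA: "cvec.subspace ?A" using U(1) U'(1) by (rule cvec.subspace_inter)
  have lt: "cvec.dim ?A < k"
  proof (rule ccontr)
    assume "\<not> cvec.dim ?A < k"
    then have "?A = U" "?A = U'"
      using subspace_eq_fin_gen[OF U(4) sA U(1)] subspace_eq_fin_gen[OF U'(4) sA U'(1)] U(3) U'(3) by auto
    then show False using assms(3) by blast
  qed
  then have dA: "cvec.dim ?A = k - 1" and k: "k > 0" using assms(4) by auto
  obtain g where g: "lin_indep k g" "cvec.span (g ` {..<k - 1}) = ?A" "cvec.span (g ` {..<k}) = U"
    using adapted_basis[OF U(4) sA U(1) _ dA U(3)] by blast
  obtain b where b: "b \<in> U'" "b \<notin> U"
    using Gr_eqI[OF assms(2,1)] assms(3) by blast
  have one: "{k - 1..<k} = {k - 1}" using k by auto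
  have H: "(\<lambda>j. \<Sum>i\<in>{k - 1..<k}. l i * g i j) \<in> ?A"
    if "(\<lambda>j. \<Sum>i\<in>{k - 1..<k}. l i * b j) \<in> ?A" for l
  proof -
    have "scl (l (k - 1)) b \<in> ?A" using that unfolding one scl_def by simp
    have "l (k - 1) = 0"
    proof (rule ccontr)
      assume nz: "l (k - 1) \<noteq> 0"
      have "scl (1 / l (k - 1)) (scl (l (k - 1)) b) \<in> ?A"
        using \<open>scl (l (k - 1)) b \<in> ?A\<close> by (rule cvec.subspace_scale[OF sA])
      then show False using nz b(2) by (simp add: scl_def)
    qed
    then have "(\<lambda>j. \<Sum>i\<in>{k - 1..<k}. l i * g i j) = 0" unfolding one by auto
    then show ?thesis using cvec.subspace_0[OF sA] by simp
  qed
  obtain F where "morphism_of_degree k n (k - (k - 1)) F" "F (cvec.span {hom_pt 1 0}) = U"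
    "F (cvec.span {hom_pt 0 1}) = U'"
    by (rule ruled_curve_through[OF g(1) diff_le_self g(2,3) assms(1,2) refl, of "\<lambda>_. b"])
      (use b(1) H in blast)+
  moreover have "k - (k - 1) = 1" using k by simp
  ultimately show thesis using that by simp
qed

text \<open>By dimension \<open>V2\<close> and \<open>V3\<close> together span \<open>B\<close>,
  since \<open>k + k - (k - d) = k + d\<close>. Hence each \<open>g i\<close> in \<open>V1\<close>
  splits as \<open>x + y\<close> with \<open>x\<close> in \<open>V2\<close> and \<open>y\<close> in
  \<open>V3\<close>, and \<open>h i = - x\<close> makes \<open>g i + h i\<close> lie in
  \<open>V3\<close>. Injectivity modulo \<open>A\<close> comes from
  \<open>V1 \<inter> V3 = A\<close>.\<close>

lemma transversal_curve_through:
  assumes A: "cvec.subspace A" "cvec.dim A = k - d" "d \<le> k"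
    and B: "B \<in> Gr (k + d) n"
    and V: "V1 \<in> Gr k n" "V2 \<in> Gr k n" "V3 \<in> Gr k n"
    and VB: "V1 \<subseteq> B" "V2 \<subseteq> B" "V3 \<subseteq> B"
    and int: "V1 \<inter> V2 = A" "V1 \<inter> V3 = A" "V2 \<inter> V3 = A"
  obtains F where "morphism_of_degree k n d F" "F (cvec.span {hom_pt 1 0}) = V1"
    "F (cvec.span {hom_pt 0 1}) = V2" "F (cvec.span {hom_pt 1 1}) = V3"
proof -
  let ?p = "k - d"
  note V1 = dim_GrD[OF V(1)] and V2 = dim_GrD[OF V(2)] and V3 = dim_GrD[OF V(3)] and B' = dim_GrD[OF B]
  obtain g where g: "lin_indep k g" "cvec.span (g ` {..<?p}) = A" "cvec.span (g ` {..<k}) = V1"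
    using adapted_basis[OF V1(4) A(1) V1(1) _ A(2) V1(3)] int(1) by blast
  have gV1: "g i \<in> V1" if "i < k" for i
    using that g(3) cvec.span_base[of "g i" "g ` {..<k}"] by blast
  have "cvec.span (V2 \<union> V3) = B"
  proof (rule subspace_eq_fin_gen[OF B'(4) _ B'(1)])
    show "cvec.span (V2 \<union> V3) \<subseteq> B" using VB by (intro cvec.span_minimal B'(1)) auto
    show "cvec.dim B \<le> cvec.dim (cvec.span (V2 \<union> V3))"
      using dim_sums_Int_fin_gen[OF V2(4) V3(4) V2(1) V3(1)] int(3) A(2,3) V2(3) V3(3) B'(3) by simp
  qed simp
  moreover have "cvec.span V2 = V2" "cvec.span V3 = V3"
    using V2(1) V3(1) cvec.span_eq_iff by blast+
  ultimately have sum: "B = {x + y |x y. x \<in> V2 \<and> y \<in> V3}"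
    using cvec.span_Un[of V2 V3] by simp
  have "\<exists>c. c \<in> V2 \<and> g i + c \<in> V3" if i: "i < k" for i
  proof -
    obtain x y where xy: "g i = x + y" "x \<in> V2" "y \<in> V3"
      using gV1[OF i] VB(1) sum by blast
    have "- x \<in> V2" using xy(2) V2(1) by (rule cvec.subspace_neg[rotated])
    moreover have "g i + - x = y" unfolding xy(1) by (simp only: add.commute[of x] add.assoc right_minus add_0_right)
    ultimately show ?thesis using xy(3) by metis
  qed
  then obtain h where h: "\<And>i. i < k \<Longrightarrow> h i \<in> V2" "\<And>i. i < k \<Longrightarrow> g i + h i \<in> V3"
    by metis
  have H: "(\<lambda>j. \<Sum>i\<in>{?p..<k}. l i * g i j) \<in> A"
    if "(\<lambda>j. \<Sum>i\<in>{?p..<k}. l i * h i j) \<in> A" (is "?\<gamma> \<in> A") for l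
  proof -
    let ?\<beta> = "\<lambda>j. \<Sum>i\<in>{?p..<k}. l i * g i j"
    have "?\<beta> \<in> V1" using gV1 by (intro sum_scl_in_subspace V1(1)) auto
    have "(\<lambda>j. \<Sum>i\<in>{?p..<k}. l i * (g i + h i) j) \<in> V3" 
      by (rule sum_scl_in_subspace[where v = "\<lambda>i. g i + h i", OF V3(1)], rule h(2)) simp
    moreover have "?\<gamma> \<in> V3" using that int(2) by blast
    ultimately have "(\<lambda>j. \<Sum>i\<in>{?p..<k}. l i * (g i + h i) j) - ?\<gamma> \<in> V3"
      by (intro cvec.subspace_diff V3(1))
    moreover have "(\<lambda>j. \<Sum>i\<in>{?p..<k}. l i * (g i + h i) j) - ?\<gamma> = ?\<beta>"
      by (simp add: fun_eq_iff distrib_left sum.distrib)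
    ultimately show ?thesis using \<open>?\<beta> \<in> V1\<close> int(2) by auto
  qed
  obtain F where F: "morphism_of_degree k n (k - ?p) F" "F (cvec.span {hom_pt 1 0}) = V1"
    "F (cvec.span {hom_pt 0 1}) = V2"
    "\<And>W. W \<in> Gr k n \<Longrightarrow> A \<subseteq> W \<Longrightarrow> (\<And>i. ?p \<le> i \<Longrightarrow> i < k \<Longrightarrow> g i + h i \<in> W) \<Longrightarrow>
       F (cvec.span {hom_pt 1 1}) = W"
    by (rule ruled_curve_through[OF g(1) diff_le_self g(2,3) V(1,2) int(1), of h])
      (use h(1) H in blast)+
  have "F (cvec.span {hom_pt 1 1}) = V3" using F(4)[OF V(3)] h(2) int(2) by blast
  then show thesis using that F(1-3) A(3) by simp
qed


section \<open>Stable maps through three given points\<close>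

lemma span_hom_pt_eq:
  assumes "cvec.span {hom_pt s t} = cvec.span {hom_pt s' t'}"
  shows "s * t' = t * s'"
proof -
  have "hom_pt s t \<in> cvec.span {hom_pt s' t'}"
    unfolding assms[symmetric] by (simp add: cvec.span_base)
  then obtain c where c: "hom_pt s t = scl c (hom_pt s' t')"
    by (auto simp: cvec.span_singleton)
  have "s = c * s'" "t = c * t'"
    using fun_cong[OF c, of 1] fun_cong[OF c, of 2] by (simp_all add: scl_def)
  then show ?thesis by simp
qed

lemma infinite_P1: "infinite P1"
proof
  assume "finite P1"
  have "inj (\<lambda>t. cvec.span {hom_pt t 1})"
    by (rule injI) (auto dest: span_hom_pt_eq)
  moreover have "range (\<lambda>t. cvec.span {hom_pt t 1}) \<subseteq> P1"
    using hom_pt_in_P1 by auto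
  ultimately have "finite (UNIV :: complex set)"
    using \<open>finite P1\<close> finite_subset finite_imageD by metis
  then show False using infinite_UNIV_char_0 by blast
qed

definition mark_value :: "pointed_map \<Rightarrow> nat \<Rightarrow> cvec set" where
  "mark_value C i = cmap C (mark_comp C i) (mark_pt C i)"

definition one_component_map :: "(cvec set \<Rightarrow> cvec set) \<Rightarrow> pointed_map" where
  "one_component_map F = \<lparr>comps = {0}, edges = {}, node = (\<lambda>_ _. {}), mark_comp = (\<lambda>_. 0),
     mark_pt = (\<lambda>i. if i = 1 then cvec.span {hom_pt 1 0}
       else if i = 2 then cvec.span {hom_pt 0 1} else cvec.span {hom_pt 1 1}),
     cmap = (\<lambda>_. F)\<rparr>"

text \<open>Three marked points keep the component stable even if \<open>F\<close> is constant, as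
  happens for \<open>d = 0\<close>.\<close>

lemma one_component_map_stable:
  assumes "morphism_of_degree k n d F"
  shows "stable_map k n d (one_component_map F)"
proof -
  let ?C = "one_component_map F"
  have dist: "cvec.span {hom_pt 1 0} \<noteq> cvec.span {hom_pt 0 1}"
    "cvec.span {hom_pt 1 0} \<noteq> cvec.span {hom_pt 1 1}"
    "cvec.span {hom_pt 0 1} \<noteq> cvec.span {hom_pt 1 1}"
    using span_hom_pt_eq[of 1 0 0 1] span_hom_pt_eq[of 1 0 1 1] span_hom_pt_eq[of 0 1 1 1] by auto
  have "special_points ?C 0 = {cvec.span {hom_pt 1 0}, cvec.span {hom_pt 0 1}, cvec.span {hom_pt 1 1}}"
  proof -
    have "edges ?C = {}" "mark_comp ?C i = 0" for i by (simp_all add: one_component_map_def)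
    then have "special_points ?C 0 = mark_pt ?C ` {1, 2, 3}"
      unfolding special_points_def by auto
    then show ?thesis by (simp add: one_component_map_def insert_commute)
  qed
  then have card: "card (special_points ?C 0) = 3" using dist by simp
  have "tree_of_lines ?C"
    by (simp add: tree_of_lines_def one_component_map_def sym_def irrefl_def)
  moreover have "comps ?C = {0}" "edges ?C = {}" "mark_comp ?C i = 0" for i
    by (simp_all add: one_component_map_def)
  moreover have "mark_pt ?C i \<in> P1" for i
    using hom_pt_in_P1[of 1 0] hom_pt_in_P1[of 0 1] hom_pt_in_P1[of 1 1]
    by (simp add: one_component_map_def)
  moreover have "inj_on (mark_pt ?C) {1, 2, 3}"
    using dist dist[symmetric] by (simp add: one_component_map_def)
  ultimately have "prestable_curve ?C"
    unfolding prestable_curve_def by (simp add: inj_on_def)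
  moreover have "\<exists>e. (\<forall>v\<in>comps ?C. morphism_of_degree k n (e v) (cmap ?C v)) \<and> (\<Sum>v\<in>comps ?C. e v) = d"
    using assms by (intro exI[of _ "\<lambda>_. d"]) (simp add: one_component_map_def)
  ultimately show ?thesis
    using card by (simp add: stable_map_def one_component_map_def)
qed

text \<open>Glues the point \<open>x\<close> of component \<open>v\<close> to the point
  \<open>y\<close> of a new component \<open>w\<close>. The marks are arguments, because a mark
  located at \<open>x\<close> has to move when \<open>x\<close> becomes a node.\<close>

definition attach :: "pointed_map \<Rightarrow> nat \<Rightarrow> cvec set \<Rightarrow> nat \<Rightarrow> (cvec set \<Rightarrow> cvec set) \<Rightarrow> cvec set \<Rightarrow>
    (nat \<Rightarrow> nat) \<Rightarrow> (nat \<Rightarrow> cvec set) \<Rightarrow> pointed_map" where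
  "attach C v x w F y mc mp = \<lparr>comps = insert w (comps C), edges = edges C \<union> {(v, w), (w, v)},
     node = (\<lambda>a b. if a = v \<and> b = w then x else if a = w \<and> b = v then y else node C a b),
     mark_comp = mc, mark_pt = mp, cmap = (cmap C)(w := F)\<rparr>"

lemma attach_simps [simp]:
  "comps (attach C v x w F y mc mp) = insert w (comps C)"
  "edges (attach C v x w F y mc mp) = edges C \<union> {(v, w), (w, v)}"
  "node (attach C v x w F y mc mp) a b =
     (if a = v \<and> b = w then x else if a = w \<and> b = v then y else node C a b)"
  "mark_comp (attach C v x w F y mc mp) = mc"
  "mark_pt (attach C v x w F y mc mp) = mp"
  "cmap (attach C v x w F y mc mp) = (cmap C)(w := F)"
  by (simp_all add: attach_def)

lemma stable_mapD:
  assumes "stable_map k n d C"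
  shows "prestable_curve C" "tree_of_lines C" "finite (comps C)" "edges C \<subseteq> comps C \<times> comps C"
    "finite (edges C)"
proof -
  show "prestable_curve C" using assms unfolding stable_map_def by (rule conjunct1)
  then show t: "tree_of_lines C" unfolding prestable_curve_def by (rule conjunct1)
  then show "finite (comps C)" "edges C \<subseteq> comps C \<times> comps C" by (simp_all add: tree_of_lines_def)
  then show "finite (edges C)" using finite_subset by blast
qed

lemma finite_special_points:
  assumes "stable_map k n d C"
  shows "finite (special_points C v)"
proof -
  have "{mark_pt C i |i. i \<in> {1, 2, 3} \<and> mark_comp C i = v} \<subseteq> mark_pt C ` {1, 2, 3}" by blast
  then have "finite {mark_pt C i |i. i \<in> {1, 2, 3} \<and> mark_comp C i = v}" by (rule finite_subset) simp
  moreover have "finite (edges C `` {v})" using stable_mapD(5)[OF assms] by (rule finite_Image)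
  ultimately show ?thesis by (simp add: special_points_def)
qed

lemma attach_tree:
  assumes C: "tree_of_lines C" and v: "v \<in> comps C" and w: "w \<notin> comps C"
  shows "tree_of_lines (attach C v x w F y mc mp)"
proof -
  let ?C = "attach C v x w F y mc mp"
  note t = C[unfolded tree_of_lines_def]
  have fin: "finite (comps C)" "edges C \<subseteq> comps C \<times> comps C" "finite (edges C)"
    using t finite_subset[of "edges C" "comps C \<times> comps C"] by auto
  have vw: "v \<noteq> w" using v w by blast
  have mono: "(edges C)\<^sup>* \<subseteq> (edges ?C)\<^sup>*" by (intro rtrancl_mono) auto
  have to: "(a, v) \<in> (edges ?C)\<^sup>* \<and> (v, a) \<in> (edges ?C)\<^sup>*" if a: "a \<in> insert w (comps C)" for a
  proof (cases "a = w")
    case True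
    then show ?thesis by auto
  next
    case False
    then have "(a, v) \<in> (edges C)\<^sup>*" "(v, a) \<in> (edges C)\<^sup>*" using a v t by auto
    then show ?thesis using mono by blast
  qed
  have "(a, b) \<in> (edges ?C)\<^sup>*" if "a \<in> insert w (comps C)" "b \<in> insert w (comps C)" for a b
    using to[OF that(1)] to[OF that(2)] rtrancl_trans by fast
  moreover have "card (edges ?C) = card (edges C) + 2"
  proof -
    have "edges C \<inter> {(v, w), (w, v)} = {}" using fin(2) w by blast
    then have "card (edges C \<union> {(v, w), (w, v)}) = card (edges C) + card {(v, w), (w, v)}"
      using fin(3) by (intro card_Un_disjoint) auto
    then show ?thesis using vw by simp
  qed
  moreover have "sym (edges ?C)" using t by (auto simp: sym_def)
  moreover have "irrefl (edges ?C)" using t vw by (auto simp: irrefl_def)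
  ultimately show ?thesis
    unfolding tree_of_lines_def using t fin v w by auto
qed

text \<open>
  The conditions on the new marked points \<open>mc\<close>, \<open>mp\<close> say that each of them is either an old one
  away from the new node, or lies on the new component and replaces an old one at the new node.
\<close>

lemma attach_stable:
  assumes C: "stable_map k n d C" and v: "v \<in> comps C" and w: "w \<notin> comps C"
    and x: "x \<in> P1" "x \<notin> node C v ` (edges C `` {v})" and y: "y \<in> P1"
    and F: "morphism_of_degree k n e1 F" "F y = cmap C v x" "L \<in> P1" "F L \<noteq> F y"
    and m: "\<And>i. i \<in> {1, 2, 3} \<Longrightarrow>
      (mc i = mark_comp C i \<and> mp i = mark_pt C i \<and> (mark_comp C i, mark_pt C i) \<noteq> (v, x)) \<or>
      (mc i = w \<and> mp i \<in> P1 \<and> mp i \<noteq> y \<and> (mark_comp C i, mark_pt C i) = (v, x))"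
  shows "stable_map k n (d + e1) (attach C v x w F y mc mp)"
proof -
  let ?C = "attach C v x w F y mc mp"
  note D = stable_mapD[OF C]
  note pre = D(1)[unfolded prestable_curve_def]
  have nodes: "node C u ` (edges C `` {u}) \<subseteq> P1" "inj_on (node C u) (edges C `` {u})" if "u \<in> comps C" for u
    using pre that by blast+
  have marks: "mark_comp C i \<in> comps C" "mark_pt C i \<in> P1"
    "mark_pt C i \<notin> node C (mark_comp C i) ` (edges C `` {mark_comp C i})" if "i \<in> {1, 2, 3}" for i
    using pre that by blast+
  have marks_inj: "i = j" if "i \<in> {1, 2, 3}" "j \<in> {1, 2, 3}"
    "(mark_comp C i, mark_pt C i) = (mark_comp C j, mark_pt C j)" for i j
    using pre that unfolding inj_on_def by blast
  have vw: "v \<noteq> w" using v w by blast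
  have now: "(w, u) \<notin> edges C" "(u, w) \<notin> edges C" for u using D(4) w by blast+
  have nbr: "edges ?C `` {w} = {v}" "edges ?C `` {v} = insert w (edges C `` {v})"
    "\<And>u. u \<noteq> v \<Longrightarrow> u \<noteq> w \<Longrightarrow> edges ?C `` {u} = edges C `` {u}"
    using now vw by auto
  have nd: "node ?C w v = y" "node ?C v w = x" "\<And>a b. b \<noteq> w \<Longrightarrow> a \<noteq> w \<Longrightarrow> node ?C a b = node C a b"
    using vw by auto
  have old_nodes: "node ?C u ` (edges C `` {u}) = node C u ` (edges C `` {u})" if "u \<noteq> w" for u
  proof -
    have "node ?C u b = node C u b" if "b \<in> edges C `` {u}" for b
      using that \<open>u \<noteq> w\<close> now(2) by (intro nd(3)) auto
    then show ?thesis by (rule image_cong[OF refl])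
  qed
  have nimg: "node ?C w ` (edges ?C `` {w}) = {y}"
    "node ?C v ` (edges ?C `` {v}) = insert x (node C v ` (edges C `` {v}))"
    "\<And>u. u \<noteq> v \<Longrightarrow> u \<noteq> w \<Longrightarrow> node ?C u ` (edges ?C `` {u}) = node C u ` (edges C `` {u})"
    unfolding nbr(1,2) image_insert nd(1,2) old_nodes[OF vw] using nbr(3) old_nodes nd(1)
    by (simp_all del: attach_simps)
  have inj': "inj_on (node ?C u) (edges ?C `` {u})" if u: "u \<in> insert w (comps C)" for u
  proof -
    have cong: "inj_on (node ?C u) (edges C `` {u})" if "u \<in> comps C"
    proof -
      have "node ?C u b = node C u b" if "b \<in> edges C `` {u}" for b
        using that now(2) \<open>u \<in> comps C\<close> w by (intro nd(3)) auto
      then show ?thesis using nodes(2)[OF that] by (metis (no_types, lifting) inj_on_cong)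
    qed
    consider "u = w" | "u = v" | "u \<in> comps C" "u \<noteq> v" "u \<noteq> w" using u w by blast
    then show ?thesis
    proof cases
      case 2
      have "x \<notin> node ?C v ` (edges C `` {v})"
        using x(2) unfolding old_nodes[OF vw] .
      then show ?thesis unfolding 2 nbr(2) using cong[unfolded 2] v nd(2) by auto
    qed (use nbr cong in auto)
  qed
  have "prestable_curve ?C"
    unfolding prestable_curve_def
  proof (intro conjI ballI)
    show "tree_of_lines ?C" using attach_tree[OF D(2) v w] .
    fix u assume u: "u \<in> comps ?C"
    then consider "u = w" | "u = v" | "u \<in> comps C" "u \<noteq> v" "u \<noteq> w" by auto
    then show "node ?C u ` (edges ?C `` {u}) \<subseteq> P1"
      using nimg nodes(1) x(1) y v by cases (auto simp del: attach_simps)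
    show "inj_on (node ?C u) (edges ?C `` {u})" using u inj' by simp
  next
    fix i :: nat assume i: "i \<in> {1, 2, 3}"
    note mi = m[OF i]
    have "mc i = mark_comp C i \<or> mc i = w" using mi by blast
    then show "mark_comp ?C i \<in> comps ?C" using marks(1)[OF i] by auto
    have "mp i = mark_pt C i \<or> mp i \<in> P1" using mi by blast
    then show "mark_pt ?C i \<in> P1" using marks(2)[OF i] by (elim disjE) simp_all
    show "mark_pt ?C i \<notin> node ?C (mark_comp ?C i) ` (edges ?C `` {mark_comp ?C i})"
    proof (cases "mc i = w")
      case True
      have "mc i \<noteq> mark_comp C i" using True marks(1)[OF i] w by metis
      then have "mp i \<noteq> y" using mi by blast
      then show ?thesis using nimg(1) True by (simp del: attach_simps(2,3))
    next
      case False
      then have old: "mc i = mark_comp C i" "mp i = mark_pt C i" "(mark_comp C i, mark_pt C i) \<noteq> (v, x)"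
        using mi by blast+
      show ?thesis
      proof (cases "mc i = v")
        case True
        then have "mp i \<noteq> x" "mp i \<notin> node C v ` (edges C `` {v})"
          using old marks(3)[OF i] by simp_all
        then show ?thesis using nimg(2) True by (simp del: attach_simps(2,3))
      next
        case ne: False
        show ?thesis using nimg(3)[OF ne False] marks(3)[OF i] old by (simp del: attach_simps(2,3))
      qed
    qed
  next
    show "inj_on (\<lambda>i. (mark_comp ?C i, mark_pt ?C i)) {1, 2, 3}"
    proof (rule inj_onI)
      fix i j :: nat assume ij: "i \<in> {1, 2, 3}" "j \<in> {1, 2, 3}"
        "(mark_comp ?C i, mark_pt ?C i) = (mark_comp ?C j, mark_pt ?C j)"
      then have "(mark_comp C i, mark_pt C i) = (mark_comp C j, mark_pt C j)"
        using m[OF ij(1)] m[OF ij(2)] marks(1)[OF ij(1)] marks(1)[OF ij(2)] w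
        unfolding attach_simps prod.inject by metis
      then show "i = j" using marks_inj ij by blast
    qed
  qed
  moreover have "\<exists>e. (\<forall>u\<in>comps ?C. morphism_of_degree k n (e u) (cmap ?C u)) \<and> (\<Sum>u\<in>comps ?C. e u) = d + e1"
  proof -
    obtain e where e: "\<forall>u\<in>comps C. morphism_of_degree k n (e u) (cmap C u)" "(\<Sum>u\<in>comps C. e u) = d"
      using C unfolding stable_map_def by blast
    have "(\<Sum>u\<in>comps C. (e(w := e1)) u) = d"
      unfolding e(2)[symmetric] using w by (intro sum.cong) auto
    then show ?thesis
      using e(1) F(1) w D(3) by (intro exI[of _ "e(w := e1)"]) auto
  qed
  moreover have "\<forall>(a, b)\<in>edges ?C. cmap ?C a (node ?C a b) = cmap ?C b (node ?C b a)"
  proof -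
    have old: "cmap C a (node C a b) = cmap C b (node C b a)" if "(a, b) \<in> edges C" for a b
      using C that unfolding stable_map_def by blast
    have old': "cmap ?C a (node ?C a b) = cmap ?C b (node ?C b a)" if "(a, b) \<in> edges C" for a b
    proof -
      have "a \<noteq> w" "b \<noteq> w" using that now by auto
      then show ?thesis using old[OF that] by simp
    qed
    have new: "cmap ?C v (node ?C v w) = cmap ?C w (node ?C w v)" using F(2) vw by simp
    have "cmap ?C a (node ?C a b) = cmap ?C b (node ?C b a)" if ab: "(a, b) \<in> edges ?C" for a b
    proof -
      consider "(a, b) \<in> edges C" | "a = v" "b = w" | "a = w" "b = v" using ab by auto
      then show ?thesis using old' new by cases (simp_all only:)
    qed
    then show ?thesis by blast
  qed
  moreover have "\<forall>u\<in>comps ?C. (\<exists>V. \<forall>L\<in>P1. cmap ?C u L = V) \<longrightarrow> card (special_points ?C u) \<ge> 3"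
  proof (intro ballI impI)
    fix u assume u: "u \<in> comps ?C" and const: "\<exists>V. \<forall>L\<in>P1. cmap ?C u L = V"
    \<comment> \<open>The map on the new component is nonconstant, since
      \<open>F L \<noteq> F y\<close>.\<close>
    have "u \<noteq> w"
    proof
      assume "u = w"
      then have "\<exists>V. \<forall>L\<in>P1. F L = V" using const by simp
      then show False using F(3,4) y by metis
    qed
    then have uC: "u \<in> comps C" using u by simp
    have "\<exists>V. \<forall>L\<in>P1. cmap C u L = V" using const \<open>u \<noteq> w\<close> by simp
    then have "card (special_points C u) \<ge> 3" using C uC unfolding stable_map_def by blast
    \<comment> \<open>No special point is lost: a mark that moves to the new component leaves the
      node \<open>x\<close> in its place.\<close>
    moreover have "special_points C u \<subseteq> special_points ?C u"
    proof
      fix z assume z: "z \<in> special_points C u"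
      have sub: "node C u ` (edges C `` {u}) \<subseteq> node ?C u ` (edges ?C `` {u})"
        using nimg(2) nimg(3)[of u] \<open>u \<noteq> w\<close> by (cases "u = v") (auto simp del: attach_simps)
      from z consider "z \<in> node C u ` (edges C `` {u})"
        | i where "i \<in> {1, 2, 3}" "mark_comp C i = u" "z = mark_pt C i"
        unfolding special_points_def by blast
      then show "z \<in> special_points ?C u"
      proof cases
        case 1
        then show ?thesis using sub unfolding special_points_def by blast
      next
        case 2
        show ?thesis
        proof (cases "mc i = w")
          case True
          then have "mc i \<noteq> mark_comp C i" using True 2(2) uC w by metis
          then have "u = v" "z = x" using m[OF 2(1)] 2(2,3) by simp_all
          then show ?thesis using nimg(2) unfolding special_points_def by blast
        next
          case False
          then have "mc i = u" "mp i = z" using m[OF 2(1)] 2(2,3) by simp_all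
          then show ?thesis using 2(1) unfolding special_points_def by auto
        qed
      qed
    qed
    moreover have "finite (special_points ?C u)"
    proof -
      have "finite (edges ?C `` {u})" using D(5) by (intro finite_Image) simp
      moreover have "finite {mark_pt ?C i |i. i \<in> {1, 2, 3} \<and> mark_comp ?C i = u}"
        by (rule finite_subset[of _ "mark_pt ?C ` {1, 2, 3}"]) blast+
      ultimately show ?thesis unfolding special_points_def by blast
    qed
    ultimately show "card (special_points ?C u) \<ge> 3" using card_mono order_trans by blast
  qed
  ultimately show ?thesis unfolding stable_map_def by blast
qed

text \<open>The line is glued at the \<open>m\<close>-th marked point itself, and the mark moves to
  the point of the line with value \<open>V\<close>.\<close>

lemma extend_mark:
  assumes C: "stable_map k n d C" and m: "m \<in> {1, 2, 3}"
    and F: "morphism_of_degree k n 1 F" "F (cvec.span {hom_pt 1 0}) = V"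
      "F (cvec.span {hom_pt 0 1}) = mark_value C m" and ne: "V \<noteq> mark_value C m"
  obtains C' where "stable_map k n (Suc d) C'" "mark_value C' m = V"
    "\<And>i. i \<in> {1, 2, 3} \<Longrightarrow> i \<noteq> m \<Longrightarrow> mark_value C' i = mark_value C i"
proof -
  let ?p = "cvec.span {hom_pt 1 0}" and ?q = "cvec.span {hom_pt 0 1}"
  obtain w where w: "w \<notin> comps C"
    using stable_mapD(3)[OF C] ex_new_if_finite infinite_UNIV_nat by metis
  let ?v = "mark_comp C m" and ?x = "mark_pt C m"
  have marks: "mark_comp C i \<in> comps C" "mark_pt C i \<in> P1"
    "mark_pt C i \<notin> node C (mark_comp C i) ` (edges C `` {mark_comp C i})" if "i \<in> {1, 2, 3}" for i
    using stable_mapD(1)[OF C] that unfolding prestable_curve_def by blast+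
  have inj: "i = m" if "i \<in> {1, 2, 3}" "(mark_comp C i, mark_pt C i) = (?v, ?x)" for i
    using stable_mapD(1)[OF C] that m unfolding prestable_curve_def inj_on_def by blast
  have pq: "?p \<in> P1" "?q \<in> P1" "?p \<noteq> ?q"
    using span_hom_pt_eq[of 1 0 0 1] hom_pt_in_P1[of 1 0] hom_pt_in_P1[of 0 1] by auto
  let ?C = "attach C ?v ?x w F ?q ((mark_comp C)(m := w)) ((mark_pt C)(m := ?p))"
  have "stable_map k n (d + 1) ?C"
  proof (rule attach_stable[OF C marks(1)[OF m] w marks(2,3)[OF m] pq(2) F(1) _ pq(1)])
    show "F ?q = cmap C ?v ?x" using F(3) by (simp add: mark_value_def)
    show "F ?p \<noteq> F ?q" using F(2,3) ne by simp
    fix i :: nat assume i: "i \<in> {1, 2, 3}"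
    show "((mark_comp C)(m := w)) i = mark_comp C i \<and> ((mark_pt C)(m := ?p)) i = mark_pt C i \<and>
        (mark_comp C i, mark_pt C i) \<noteq> (?v, ?x) \<or>
      ((mark_comp C)(m := w)) i = w \<and> ((mark_pt C)(m := ?p)) i \<in> P1 \<and> ((mark_pt C)(m := ?p)) i \<noteq> ?q \<and>
        (mark_comp C i, mark_pt C i) = (?v, ?x)"
    proof (cases "i = m")
      case True
      then show ?thesis using pq(1,3) by simp
    next
      case False
      then have "(mark_comp C i, mark_pt C i) \<noteq> (?v, ?x)" using inj[OF i] by blast
      then show ?thesis using False by simp
    qed
  qed
  moreover have "mark_value ?C m = V" using F(2) by (simp add: mark_value_def)
  moreover have "mark_value ?C i = mark_value C i" if "i \<in> {1, 2, 3}" "i \<noteq> m" for i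
  proof -
    have "mark_comp C i \<noteq> w" using marks(1)[OF that(1)] w by metis
    then show ?thesis using that(2) by (simp add: mark_value_def)
  qed
  ultimately show thesis using that[of ?C] by simp
qed

section \<open>Raising the degree without changing the marked values\<close>

lemma dim_coord_space_ge: "n \<le> cvec.dim (coord_space {1..n})"
proof -
  let ?v = "\<lambda>i. unit_vec_at (Suc i)"
  have "lin_indep n ?v"
    unfolding lin_indep_def
  proof (intro allI impI)
    fix l i assume z: "\<forall>j. (\<Sum>i<n. l i * ?v i j) = 0" and i: "i < n"
    have "(\<Sum>r<n. l r * ?v r (Suc i)) = (\<Sum>r<n. if r = i then l r else 0)"
      by (intro sum.cong) (auto simp: unit_vec_at_def)
    then show "l i = 0" using z[rule_format, of "Suc i"] i by simp
  qed
  then have "cvec.dim (cvec.span (?v ` {..<n})) = n" by (rule lin_indep_dim)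
  moreover
  have "cvec.span (?v ` {..<n}) \<subseteq> coord_space {1..n}"
    by (intro cvec.span_minimal subspace_coord_space) (auto simp: unit_vec_at_def coord_space_def)
  then have "cvec.dim (cvec.span (?v ` {..<n})) \<le> cvec.dim (coord_space {1..n})"
    by (rule dim_mono_fin_gen[OF fin_gen_coord_space[OF finite_atLeastAtMost subset_refl]])
  ultimately show ?thesis by simp
qed

lemma Gr_dim_le: "V \<in> Gr k n \<Longrightarrow> k \<le> n"
proof -
  assume "V \<in> Gr k n"
  then have V: "V \<subseteq> coord_space {1..n}" "cvec.dim V = k" by (auto simp: Gr_def)
  have "cvec.dim V \<le> card (unit_vec_at ` {1..n})"
    using V(1) coord_space_span[of "{1..n}"] by (intro cvec.dim_le_card) auto
  also have "\<dots> \<le> n" using card_image_le[of "{1..n}" unit_vec_at] by simp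
  finally show "k \<le> n" using V(2) by simp
qed

text \<open>A hyperplane of \<open>U\<close>, which exists for \<open>0 < k\<close>, is joined with
  a vector outside \<open>U\<close>, which exists for \<open>k < n\<close>.\<close>

lemma Gr_neighbour:
  assumes "U \<in> Gr k n" "0 < k" "k < n"
  obtains U' where "U' \<in> Gr k n" "U' \<noteq> U" "k \<le> Suc (cvec.dim (U \<inter> U'))"
proof -
  note U = dim_GrD[OF assms(1)]
  have zero: "cvec.dim {0} \<le> k - 1" using cvec.dim_le_card[of "{0}" "{}"] by simp
  obtain A where A: "cvec.subspace A" "A \<subseteq> U" "cvec.dim A = k - 1"
    using subspace_between[OF U(4) cvec.subspace_single_0 U(1) _ zero] cvec.subspace_0[OF U(1)] U(3) by auto
  have "\<not> coord_space {1..n} \<subseteq> U"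
    using dim_mono_fin_gen[OF U(4), of "coord_space {1..n}"] dim_coord_space_ge[of n] U(3) assms(3) by auto
  then obtain b where b: "b \<in> coord_space {1..n}" "b \<notin> U" by blast
  let ?U = "cvec.span (insert b A)"
  have "cvec.dim ?U = k"
    using dim_span_insert_fin_gen[OF fin_gen_subset[OF U(4) A(2)] A(1), of b] A(2,3) b(2) assms(2) by auto
  moreover have "?U \<subseteq> coord_space {1..n}"
    using b(1) A(2) U(2) by (intro cvec.span_minimal) auto
  ultimately have G: "?U \<in> Gr k n" by (simp add: Gr_def)
  have sup: "insert b A \<subseteq> ?U" by (rule cvec.span_superset)
  then have "A \<subseteq> U \<inter> ?U" using A(2) by blast
  then have "k - 1 \<le> cvec.dim (U \<inter> ?U)"
    using dim_mono_fin_gen[OF fin_gen_subset[OF U(4)], of "U \<inter> ?U" A] A(3) by simp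
  moreover have "?U \<noteq> U" using sup b(2) by blast
  ultimately show thesis using that[OF G] assms(2) by simp
qed

text \<open>An unmarked line is glued at a point of \<open>P1\<close> that is not special, which
  exists because \<open>P1\<close> is infinite. The line joins two different planes, so its map is
  nonconstant and stability imposes nothing on its special points.\<close>

lemma add_tail:
  assumes C: "stable_map k n d C" and k: "0 < k" "k < n"
  obtains C' where "stable_map k n (Suc d) C'"
    "\<And>i. i \<in> {1, 2, 3} \<Longrightarrow> mark_value C' i = mark_value C i"
proof -
  let ?p = "cvec.span {hom_pt 1 0}" and ?q = "cvec.span {hom_pt 0 1}"
  obtain w where w: "w \<notin> comps C"
    using stable_mapD(3)[OF C] ex_new_if_finite infinite_UNIV_nat by metis
  let ?v = "mark_comp C 1"
  have marks: "mark_comp C i \<in> comps C" if "i \<in> {1, 2, 3}" for i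
    using stable_mapD(1)[OF C] that unfolding prestable_curve_def by blast
  then have v: "?v \<in> comps C" by simp
  have "\<not> P1 \<subseteq> special_points C ?v"
    using infinite_P1 finite_subset[OF _ finite_special_points[OF C]] by (rule contrapos_nn)
  then obtain x where x: "x \<in> P1" "x \<notin> special_points C ?v" by blast
  obtain e where "morphism_of_degree k n e (cmap C ?v)"
    using C v unfolding stable_map_def by blast
  then have G: "cmap C ?v x \<in> Gr k n" using x(1) by (rule morphism_in_Gr)
  obtain U where U: "U \<in> Gr k n" "U \<noteq> cmap C ?v x" "k \<le> Suc (cvec.dim (cmap C ?v x \<inter> U))"
    using Gr_neighbour[OF G k] by blast
  obtain F where F: "morphism_of_degree k n 1 F" "F ?p = U" "F ?q = cmap C ?v x"
    by (rule line_through[OF U(1) G U(2)]) (use U(3) in \<open>simp_all add: Int_commute\<close>)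
  have pq: "?p \<in> P1" "?q \<in> P1" using hom_pt_in_P1[of 1 0] hom_pt_in_P1[of 0 1] by auto
  let ?C = "attach C ?v x w F ?q (mark_comp C) (mark_pt C)"
  have "stable_map k n (d + 1) ?C"
  proof (rule attach_stable[OF C v w x(1) _ pq(2) F(1) F(3) pq(1)])
    show "x \<notin> node C ?v ` (edges C `` {?v})" using x(2) unfolding special_points_def by blast
    show "F ?p \<noteq> F ?q" using F(2,3) U(2) by simp
    fix i :: nat assume i: "i \<in> {1, 2, 3}"
    have "(mark_comp C i, mark_pt C i) \<noteq> (?v, x)"
      using i x(2) unfolding special_points_def by blast
    then show "mark_comp C i = mark_comp C i \<and> mark_pt C i = mark_pt C i \<and> (mark_comp C i, mark_pt C i) \<noteq> (?v, x) \<or>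
      mark_comp C i = w \<and> mark_pt C i \<in> P1 \<and> mark_pt C i \<noteq> ?q \<and> (mark_comp C i, mark_pt C i) = (?v, x)"
      by blast
  qed
  moreover have "mark_value ?C i = mark_value C i" if "i \<in> {1, 2, 3}" for i
  proof -
    have "mark_comp C i \<noteq> w" using marks[OF that] w by metis
    then show ?thesis by (simp add: mark_value_def)
  qed
  ultimately show thesis using that[of ?C] by simp
qed

text \<open>
  Induction on \<open>d\<close>. If two of the subspaces meet outside \<open>A\<close>, enlarge \<open>A\<close> by a common vector,
  shrink \<open>B\<close> to a hyperplane containing both, and move the third subspace along a line.
\<close>

lemma stable_map_through_three_points:
  assumes "cvec.subspace A" "cvec.dim A = k - d" "d \<le> k" "B \<in> Gr (k + d) n"
    "\<And>i. i \<in> {1, 2, 3} \<Longrightarrow> V i \<in> Gr k n \<and> A \<subseteq> V i \<and> V i \<subseteq> B"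
  shows "\<exists>C. stable_map k n d C \<and> (\<forall>i\<in>{1, 2, 3}. mark_value C i = V i)"
  using assms
proof (induction d arbitrary: A B V)
  \<comment> \<open>Proved for every \<open>d\<close> ahead of the induction, because the
    transversal situation also occurs in the induction step.\<close>
  have base: "\<exists>C. stable_map k n d C \<and> (\<forall>i\<in>{1, 2, 3}. mark_value C i = V i)"
    if "cvec.subspace A" "cvec.dim A = k - d" "d \<le> k" "B \<in> Gr (k + d) n"
      "\<And>i. i \<in> {1, 2, 3} \<Longrightarrow> V i \<in> Gr k n \<and> A \<subseteq> V i \<and> V i \<subseteq> B"
      "\<And>i j. i \<in> {1, 2, 3} \<Longrightarrow> j \<in> {1, 2, 3} \<Longrightarrow> i \<noteq> j \<Longrightarrow> V i \<inter> V j = A"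
    for d A B and V :: "nat \<Rightarrow> cvec set"
  proof -
    note hyps = that(1-4)
    have V: "V 1 \<in> Gr k n" "V 2 \<in> Gr k n" "V 3 \<in> Gr k n" "V 1 \<subseteq> B" "V 2 \<subseteq> B" "V 3 \<subseteq> B"
      using that(5)[of 1] that(5)[of 2] that(5)[of 3] by simp_all
    have I: "V 1 \<inter> V 2 = A" "V 1 \<inter> V 3 = A" "V 2 \<inter> V 3 = A"
      using that(6)[of 1 2] that(6)[of 1 3] that(6)[of 2 3] by simp_all
    obtain F where F: "morphism_of_degree k n d F" "F (cvec.span {hom_pt 1 0}) = V 1"
      "F (cvec.span {hom_pt 0 1}) = V 2" "F (cvec.span {hom_pt 1 1}) = V 3"
      by (rule transversal_curve_through[OF hyps V I]) blast
    have "\<forall>i\<in>{1, 2, 3}. mark_value (one_component_map F) i = V i"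
      using F(2-4) by (simp add: mark_value_def one_component_map_def)
    then show ?thesis using one_component_map_stable[OF F(1)] by blast
  qed
  {
    case 0
    \<comment> \<open>For \<open>d = 0\<close> the space \<open>A\<close> already has dimension
      \<open>k\<close>, so the three planes coincide with it.\<close>
    have "V i = A" if "i \<in> {1, 2, 3}" for i
      using 0(5)[OF that] 0(1,2) subspace_eq_fin_gen[of "V i" A] dim_GrD[of "V i" k n] by auto
    then show ?case by (intro base[OF 0]) auto
  next
    case (Suc d)
    show ?case
    proof (cases "\<forall>i\<in>{1, 2, 3}. \<forall>j\<in>{1, 2, 3}. i \<noteq> j \<longrightarrow> V i \<inter> V j = A")
      case True
      then show ?thesis by (intro base[OF Suc.prems]) blast+
    next
      case False
      note B = dim_GrD[OF Suc.prems(4)]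
      have V: "V i \<in> Gr k n" "A \<subseteq> V i" "V i \<subseteq> B" if "i \<in> {1, 2, 3}" for i
        using Suc.prems(5)[OF that] by blast+
      note VD = dim_GrD[OF V(1)]
      obtain i j where ij: "i \<in> {1, 2, 3}" "j \<in> {1, 2, 3}" "i \<noteq> j" "V i \<inter> V j \<noteq> A"
        using False by blast
      have "\<exists>m\<in>{1, 2, 3}. m \<noteq> i \<and> m \<noteq> j"
        unfolding bex_simps by presburger
      then obtain m where m: "m \<in> {1, 2, 3}" "m \<noteq> i" "m \<noteq> j" by blast
      obtain a where a: "a \<in> V i" "a \<in> V j" "a \<notin> A"
        using ij V(2)[OF ij(1)] V(2)[OF ij(2)] by blast
      let ?A = "cvec.span (insert a A)"
      have fA: "fin_gen A" using fin_gen_subset[OF VD(4)[OF ij(1)] V(2)[OF ij(1)]] .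
      have dA: "cvec.dim ?A = k - d"
        using dim_span_insert_fin_gen[OF fA Suc.prems(1) a(3)] Suc.prems(2,3) by simp
      have AI: "?A \<subseteq> V i \<inter> V j"
        using a V(2)[OF ij(1)] V(2)[OF ij(2)] VD(1)[OF ij(1)] VD(1)[OF ij(2)]
        by (intro cvec.span_minimal cvec.subspace_inter) auto
      \<comment> \<open>The enlarged \<open>A\<close> has dimension \<open>k - d\<close>, so the two
        planes span at most dimension \<open>k + d\<close> and fit into a hyperplane
        \<open>H\<close> of \<open>B\<close>.\<close>
      have "k - d \<le> cvec.dim (V i \<inter> V j)"
        using dim_mono_fin_gen[OF _ AI] fin_gen_subset[OF VD(4)[OF ij(1)], of "V i \<inter> V j"] dA by auto
      then have dS: "cvec.dim (cvec.span (V i \<union> V j)) \<le> k + d"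
        using dim_sums_Int_fin_gen[OF VD(4)[OF ij(1)] VD(4)[OF ij(2)] VD(1)[OF ij(1)] VD(1)[OF ij(2)]]
          VD(3)[OF ij(1)] VD(3)[OF ij(2)] by linarith
      obtain H where H: "cvec.subspace H" "cvec.span (V i \<union> V j) \<subseteq> H" "H \<subseteq> B" "cvec.dim H = k + d"
      proof (rule subspace_between[OF B(4) cvec.subspace_span B(1) _ dS])
        show "cvec.span (V i \<union> V j) \<subseteq> B"
          using V(3)[OF ij(1)] V(3)[OF ij(2)] by (intro cvec.span_minimal B(1)) auto
        show "k + d \<le> cvec.dim B" using B(3) by simp
      qed blast
      have fH: "fin_gen H" using fin_gen_subset[OF B(4) H(3)] .
      have HG: "H \<in> Gr (k + d) n" using H B(2) by (auto simp: Gr_def)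
      have VH: "V i \<subseteq> H" "V j \<subseteq> H" using H(2) cvec.span_superset[of "V i \<union> V j"] by blast+
      let ?U = "V m \<inter> H"
      have sU: "cvec.subspace ?U" using VD(1)[OF m(1)] H(1) by (rule cvec.subspace_inter)
      have fU: "fin_gen ?U" using fin_gen_subset[OF fH] by blast
      have "cvec.span (V m \<union> H) \<subseteq> B"
        using V(3)[OF m(1)] H(3) by (intro cvec.span_minimal B(1)) auto
      then have "cvec.dim (cvec.span (V m \<union> H)) \<le> k + Suc d"
        using dim_mono_fin_gen[OF B(4)] B(3) by metis
      then have dU: "k - 1 \<le> cvec.dim ?U"
        using dim_sums_Int_fin_gen[OF VD(4)[OF m(1)] fH VD(1)[OF m(1)] H(1)] VD(3)[OF m(1)] H(4) by linarith
      have AU: "A \<subseteq> ?U" using V(2)[OF m(1)] V(2)[OF ij(1)] VH(1) by blast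
      have dA1: "cvec.dim A \<le> k - 1" using Suc.prems(2) by simp
      \<comment> \<open>\<open>H\<close> cuts off at most one dimension of \<open>V m\<close>, so
        the cut has a subspace \<open>U0\<close> of dimension \<open>k - 1\<close> containing
        \<open>A\<close>. Together with \<open>a\<close> it spans at most dimension
        \<open>k\<close>; hence some \<open>k\<close>-plane \<open>W\<close> in \<open>H\<close>
        contains the enlarged \<open>A\<close> and meets \<open>V m\<close> in dimension at least
        \<open>k - 1\<close>.\<close>
      obtain U0 where U0: "cvec.subspace U0" "A \<subseteq> U0" "U0 \<subseteq> ?U" "cvec.dim U0 = k - 1"
        by (rule subspace_between[OF fU Suc.prems(1) sU AU dA1 dU]) blast
      have fU0: "fin_gen U0" using fin_gen_subset[OF fU U0(3)] .
      have dW: "cvec.dim (cvec.span (insert a U0)) \<le> k"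
      proof (cases "a \<in> U0")
        case True
        then have "cvec.span (insert a U0) = U0"
          using U0(1) by (simp add: insert_absorb cvec.span_eq_iff[THEN iffD2])
        then show ?thesis using U0(4) by simp
      next
        case False
        then show ?thesis
          using dim_span_insert_fin_gen[OF fU0 U0(1) False] U0(4) Suc.prems(3) by simp
      qed
      have sW: "cvec.span (insert a U0) \<subseteq> H"
        using a(1) VH(1) U0(3) by (intro cvec.span_minimal H(1)) auto
      have "k \<le> cvec.dim H" using H(4) by simp
      then obtain W where W: "cvec.subspace W" "cvec.span (insert a U0) \<subseteq> W" "W \<subseteq> H" "cvec.dim W = k"
        using subspace_between[OF fH cvec.subspace_span H(1) sW dW] by blast
      have WG: "W \<in> Gr k n" using W(1,3,4) H(3) B(2) by (auto simp: Gr_def)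
      have UW: "insert a U0 \<subseteq> W" using W(2) cvec.span_superset[of "insert a U0"] by blast
      have AW: "?A \<subseteq> W" using UW U0(2) by (intro cvec.span_minimal W(1)) auto
      define V' where "V' = V(m := W)"
      have "V' r \<in> Gr k n \<and> ?A \<subseteq> V' r \<and> V' r \<subseteq> H" if r: "r \<in> {1, 2, 3}" for r
      proof -
        have "r = m \<or> r = i \<or> r = j" using r ij(1-3) m unfolding insert_iff empty_iff by presburger
        then show ?thesis
          using AI AW W(3) WG V(1)[OF r] VH m by (auto simp: V'_def)
      qed
      then obtain C where C: "stable_map k n d C" "\<forall>r\<in>{1, 2, 3}. mark_value C r = V' r"
        using Suc.IH[of ?A H V'] dA HG Suc.prems(3) by auto
      show ?thesis
      proof (cases "W = V m")
        case True
        \<comment> \<open>With \<open>W = V m\<close> there is no line to attach, so a tail supplies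
          the missing degree. Its two inequalities come from \<open>Suc d \<le> k\<close> and
          \<open>k + Suc d \<le> n\<close>.\<close>
        have k: "0 < k" "k < n" using Gr_dim_le[OF Suc.prems(4)] Suc.prems(3) by simp_all
        obtain C' where C': "stable_map k n (Suc d) C'"
            "\<And>i. i \<in> {1, 2, 3} \<Longrightarrow> mark_value C' i = mark_value C i"
          by (rule add_tail[OF C(1) k]) blast
        moreover have "V' = V" using True by (simp add: V'_def)
        ultimately have "\<forall>i\<in>{1, 2, 3}. mark_value C' i = V i" using C(2) by simp
        then show ?thesis using C'(1) by blast
      next
        case False
        have "U0 \<subseteq> V m \<inter> W" using U0(3) UW by blast
        then have "k - 1 \<le> cvec.dim (V m \<inter> W)"
          using dim_mono_fin_gen[of "V m \<inter> W" U0] fin_gen_subset[OF VD(4)[OF m(1)], of "V m \<inter> W"] U0(4) by auto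
        then have "k \<le> Suc (cvec.dim (V m \<inter> W))" by simp
        then obtain F where F: "morphism_of_degree k n 1 F" "F (cvec.span {hom_pt 1 0}) = V m"
          "F (cvec.span {hom_pt 0 1}) = W"
          by (rule line_through[OF V(1)[OF m(1)] WG False[symmetric]]) blast+
        have W': "mark_value C m = W" using bspec[OF C(2) m(1)] by (simp add: V'_def)
        obtain C' where C': "stable_map k n (Suc d) C'" "mark_value C' m = V m"
            "\<And>i. i \<in> {1, 2, 3} \<Longrightarrow> i \<noteq> m \<Longrightarrow> mark_value C' i = mark_value C i"
          by (rule extend_mark[OF C(1) m(1) F(1,2)]) (use F(3) W' False in auto)
        have "mark_value C' r = V r" if "r \<in> {1, 2, 3}" for r
          using C'(2) C'(3)[OF that] bspec[OF C(2) that] by (cases "r = m") (simp_all add: V'_def)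
        then show ?thesis using C'(1) by blast
      qed
    qed
  }
qed

section \<open>Marked values of isomorphism classes\<close>

lemma isomorphic_maps_refl: "isomorphic_maps C C"
proof -
  have "P1_automorphism id"
    unfolding P1_automorphism_def by (intro exI[of _ id]) (auto simp: cvec.linear_id)
  then show ?thesis
    unfolding isomorphic_maps_def by (intro exI[of _ id] exI[of _ "\<lambda>_. id"]) auto
qed

lemma isomorphic_maps_mark_value:
  assumes "stable_map k n d C" "isomorphic_maps C C'" "i \<in> {1, 2, 3}"
  shows "mark_value C' i = mark_value C i"
proof -
  have "mark_comp C i \<in> comps C" "mark_pt C i \<in> P1"
    using stable_mapD(1)[OF assms(1)] assms(3) unfolding prestable_curve_def by blast+
  then show ?thesis
    using assms(2,3) unfolding isomorphic_maps_def mark_value_def by metis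
qed

text \<open>Isomorphisms preserve marked values and the class contains \<open>C\<close>, so the
  image under evaluation is a singleton and \<open>the_elem\<close> returns its element.\<close>

lemma ev_class:
  assumes "stable_map k n d C" "i \<in> {1, 2, 3}"
    "X = {(C, C'). stable_map k n d C \<and> stable_map k n d C' \<and> isomorphic_maps C C'} `` {C}"
  shows "ev i X = mark_value C i"
proof -
  have X: "X = {C'. stable_map k n d C' \<and> isomorphic_maps C C'}"
    using assms(1,3) by auto
  have "C \<in> X" using assms(1) isomorphic_maps_refl unfolding X by blast
  moreover have "mark_value C' i = mark_value C i" if "C' \<in> X" for C'
    using that isomorphic_maps_mark_value[OF assms(1) _ assms(2)] unfolding X by blast
  ultimately have "(\<lambda>C. mark_value C i) ` X = {mark_value C i}" by blast
  then show ?thesis unfolding ev_def mark_value_def by simp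
qed

lemma S_locus_iff:
  "V \<in> S_locus k n I J d \<longleftrightarrow> (\<exists>C. stable_map k n d C \<and> mark_value C 1 \<in> schubert k n J \<and>
     mark_value C 2 \<in> opp_schubert k n I \<and> mark_value C 3 = V)"
  (is "_ \<longleftrightarrow> ?R")
proof
  assume "V \<in> S_locus k n I J d"
  then obtain X where X: "X \<in> M03 k n d" "ev 1 X \<in> schubert k n J" "ev 2 X \<in> opp_schubert k n I" "V = ev 3 X"
    unfolding S_locus_def E_locus_def by blast
  obtain C where C: "stable_map k n d C"
    "X = {(C, C'). stable_map k n d C \<and> stable_map k n d C' \<and> isomorphic_maps C C'} `` {C}"
    using X(1) unfolding M03_def by (auto elim!: quotientE)
  show ?R
    using X(2-4) ev_class[OF C(1) _ C(2), of 1] ev_class[OF C(1) _ C(2), of 2] ev_class[OF C(1) _ C(2), of 3] C(1)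
    by auto
next
  assume ?R
  then obtain C where C: "stable_map k n d C" "mark_value C 1 \<in> schubert k n J"
    "mark_value C 2 \<in> opp_schubert k n I" "mark_value C 3 = V" by blast
  let ?r = "{(C, C'). stable_map k n d C \<and> stable_map k n d C' \<and> isomorphic_maps C C'}"
  let ?X = "?r `` {C}"
  have "?X \<in> M03 k n d" unfolding M03_def using C(1) by (intro quotientI) simp
  moreover have "ev i ?X = mark_value C i" if "i \<in> {1, 2, 3}" for i
    using ev_class[OF C(1) that refl] .
  ultimately show "V \<in> S_locus k n I J d"
    unfolding S_locus_def E_locus_def using C(2-4) by (intro image_eqI[of _ _ ?X]) auto
qed

section \<open>Bounds on the degree from validity\<close>

lemma ext_seq_bounds:
  assumes "A \<subseteq> {1..n}" "A \<noteq> {}"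
  shows "int n * ((r - 1) div int (card A)) < ext_seq n A r"
    "ext_seq n A r \<le> int n * ((r - 1) div int (card A)) + int n"
proof -
  have fin: "finite A" using assms(1) finite_subset by blast
  then have "card A > 0" using assms(2) by (simp add: card_gt_0_iff)
  then have "nat ((r - 1) mod int (card A)) < length (sorted_list_of_set A)"
    by (simp add: nat_less_iff)
  then have "sorted_list_of_set A ! nat ((r - 1) mod int (card A)) \<in> A"
    using fin nth_mem set_sorted_list_of_set by metis
  then show "int n * ((r - 1) div int (card A)) < ext_seq n A r"
    "ext_seq n A r \<le> int n * ((r - 1) div int (card A)) + int n"
    using assms(1) by (auto simp: ext_seq_def)
qed

text \<open>Only extreme elements are tested. For \<open>d > k\<close> the image of the first
  element of \<open>I\<close> is at most 0, against \<open>a \<le> f a\<close>. For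
  \<open>d > n - k\<close> the image of the last element of the complement of \<open>I\<close>,
  itself at most \<open>n\<close>, exceeds \<open>2 * n\<close>, against
  \<open>f a \<le> a + n\<close>.\<close>

lemma valid_triple_bounds:
  assumes "I \<in> ksubsets k n" "J \<in> ksubsets k n" "valid_triple k n I J d" "0 < k" "k < n"
  shows "d \<le> k" "k + d \<le> n"
proof -
  note I = ksubsets_simps[OF assms(1)] and J = ksubsets_simps[OF assms(2)]
  have ne: "I \<noteq> {}" "J \<noteq> {}" using I(2) J(2) assms(4) by auto
  have cc: "card ({1..n} - I) = n - k" "card ({1..n} - J) = n - k"
    using I J by (simp_all add: card_Diff_subset)
  have ne': "{1..n} - I \<noteq> {}" "{1..n} - J \<noteq> {}" using cc assms(5) by (metis card.empty zero_less_diff less_irrefl)+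
  obtain f where f: "\<And>r. f (ext_seq n I r) = ext_seq n J (r + int k - int d)"
    "\<And>r. f (ext_seq n ({1..n} - I) r) = ext_seq n ({1..n} - J) (r + int d)"
    "\<And>a. a \<le> f a" "\<And>a. f a \<le> a + int n"
    using assms(3) ne(1) ne'(1) unfolding valid_triple_def is_juggling_fun_def by blast
  show "d \<le> k"
  proof (rule ccontr)
    assume "\<not> d \<le> k"
    then have "(1 + int k - int d - 1) div int k < 0"
      using assms(4) by (intro div_neg_pos_less0) simp_all
    then have "(1 + int k - int d - 1) div int k \<le> -1" by linarith
    then have "int n * ((1 + int k - int d - 1) div int k) \<le> - int n"
      using mult_left_mono[of "(1 + int k - int d - 1) div int k" "-1" "int n"] by simp
    then have "ext_seq n J (1 + int k - int d) \<le> 0"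
      using ext_seq_bounds(2)[OF J(3) ne(2), of "1 + int k - int d"] J(2) by simp
    moreover have "0 < ext_seq n I 1"
      using ext_seq_bounds(1)[OF I(3) ne(1), of 1] by simp
    ultimately show False using f(1)[of 1] f(3)[of "ext_seq n I 1"] by simp
  qed
  show "k + d \<le> n"
  proof (rule ccontr)
    assume "\<not> k + d \<le> n"
    let ?r = "int (n - k)"
    have pos: "?r > 0" using assms(5) by simp
    have le: "2 * ?r \<le> ?r + int d - 1" using \<open>\<not> k + d \<le> n\<close> assms(5) by linarith
    have "2 * ?r div ?r = 2" using pos by (intro nonzero_mult_div_cancel_right) simp
    then have "2 \<le> (?r + int d - 1) div ?r"
      using zdiv_mono1[OF le pos] by (simp only:)
    then have "int n * 2 \<le> int n * ((?r + int d - 1) div ?r)" by (intro mult_left_mono) simp_all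
    then have "2 * int n < ext_seq n ({1..n} - J) (?r + int d)"
      using ext_seq_bounds(1)[of "{1..n} - J" n "?r + int d"] ne'(2) cc(2) by auto
    moreover have "ext_seq n ({1..n} - I) ?r \<le> int n"
      using ext_seq_bounds(2)[of "{1..n} - I" n ?r] ne'(1) cc(1) pos by (auto simp: div_pos_pos_trivial)
    ultimately show False using f(2)[of ?r] f(4)[of "ext_seq n ({1..n} - I) ?r"] by simp
  qed
qed

theorem proposition13p8:
  fixes k n d :: nat and I J :: "nat set"
  assumes "k \<le> n"
    and "I \<in> ksubsets k n" and "J \<in> ksubsets k n"
    and "valid_triple k n I J d"
  shows "q1 ` {T \<in> Fl3 k n d. q2 T \<in> Y_locus k n I J d} = S_locus k n I J d"
proof
  show "q1 ` {T \<in> Fl3 k n d. q2 T \<in> Y_locus k n I J d} \<subseteq> S_locus k n I J d"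
  proof
    fix V assume "V \<in> q1 ` {T \<in> Fl3 k n d. q2 T \<in> Y_locus k n I J d}"
    then obtain A B where "(A, V, B) \<in> Fl3 k n d" "(A, B) \<in> Y_locus k n I J d"
      by (auto simp: q1_def q2_def)
    \<comment> \<open>The two shadows supply planes in the two Schubert varieties between the same
      \<open>A\<close> and \<open>B\<close>; with \<open>V\<close> they are the prescribed marked
      values.\<close>
    then obtain V1 V2 where T: "(A, V, B) \<in> Fl3 k n d" "(A, V1, B) \<in> Fl3 k n d" "(A, V2, B) \<in> Fl3 k n d"
      and X: "V1 \<in> schubert k n J" "V2 \<in> opp_schubert k n I"
      by (auto simp: Y_locus_def flag_shadow_def q1_def q2_def)
    define W where "W = (\<lambda>i::nat. if i = 1 then V1 else if i = 2 then V2 else V)"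
    have "\<exists>C. stable_map k n d C \<and> (\<forall>i\<in>{1, 2, 3}. mark_value C i = W i)"
    proof (rule stable_map_through_three_points)
      show "cvec.subspace A" "cvec.dim A = k - d" "d \<le> k" "B \<in> Gr (k + d) n"
        using T(1) by (auto simp: Fl3_def Gr_def)
      show "W i \<in> Gr k n \<and> A \<subseteq> W i \<and> W i \<subseteq> B" for i
        using T by (auto simp: Fl3_def W_def)
    qed
    then show "V \<in> S_locus k n I J d"
      using X unfolding S_locus_iff by (auto simp: W_def)
  qed
  show "S_locus k n I J d \<subseteq> q1 ` {T \<in> Fl3 k n d. q2 T \<in> Y_locus k n I J d}"
  proof
    fix V assume "V \<in> S_locus k n I J d"
    then obtain C where C: "stable_map k n d C" "mark_value C 1 \<in> schubert k n J"
      "mark_value C 2 \<in> opp_schubert k n I" "mark_value C 3 = V"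
      unfolding S_locus_iff by blast
    have d: "d \<le> k" "k + d \<le> n"
    proof -
      have "d = 0" if "k = 0 \<or> k = n" using stable_map_to_point_degree_0[OF C(1) that] .
      then show "d \<le> k" "k + d \<le> n"
        using valid_triple_bounds[OF assms(2-4)] assms(1) by (cases "k = 0 \<or> k = n"; auto)+
    qed
    obtain A0 B0 where AB0: "cvec.subspace A0" "A0 \<subseteq> coord_space {1..n}" "k \<le> cvec.dim A0 + d"
      "cvec.subspace B0" "B0 \<subseteq> coord_space {1..n}" "cvec.dim B0 \<le> k + d"
      "\<And>v L. v \<in> comps C \<Longrightarrow> L \<in> P1 \<Longrightarrow> A0 \<subseteq> cmap C v L \<and> cmap C v L \<subseteq> B0"
      by (rule kernel_span_stable_map[OF C(1)]) blast
    note fg = fin_gen_coord_space[of "{1..n}", OF finite_atLeastAtMost]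
    have zero: "cvec.dim {0} \<le> k - d" using cvec.dim_le_card[of "{0}" "{}"] by simp
    obtain A where A: "cvec.subspace A" "A \<subseteq> A0" "cvec.dim A = k - d"
    proof (rule subspace_between[OF fg[OF AB0(2)] cvec.subspace_single_0 AB0(1) _ zero])
      show "{0} \<subseteq> A0" using cvec.subspace_0[OF AB0(1)] by simp
      show "k - d \<le> cvec.dim A0" using AB0(3) by simp
    qed blast
    obtain B where B: "cvec.subspace B" "B0 \<subseteq> B" "B \<subseteq> coord_space {1..n}" "cvec.dim B = k + d"
    proof (rule subspace_between[OF fg[OF subset_refl] AB0(4) subspace_coord_space AB0(5,6)])
      show "k + d \<le> cvec.dim (coord_space {1..n})" using dim_coord_space_ge[of n] d(2) by simp
    qed blast
    have flag: "(A, mark_value C i, B) \<in> Fl3 k n d" if "i \<in> {1, 2, 3}" for i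
    proof -
      have mark: "mark_comp C i \<in> comps C" "mark_pt C i \<in> P1"
        using stable_mapD(1)[OF C(1)] that unfolding prestable_curve_def by blast+
      obtain e where "morphism_of_degree k n e (cmap C (mark_comp C i))"
        using C(1) mark(1) unfolding stable_map_def by blast
      then have "mark_value C i \<in> Gr k n"
        unfolding mark_value_def using mark(2) by (rule morphism_in_Gr)
      moreover have "A \<subseteq> mark_value C i" "mark_value C i \<subseteq> B"
        using AB0(7)[OF mark] A(2) B(2) unfolding mark_value_def by blast+
      moreover have "A \<in> Gr (k - d) n" "B \<in> Gr (k + d) n"
        using A B AB0(2) by (auto simp: Gr_def)
      ultimately show ?thesis using d(1) by (simp add: Fl3_def)
    qed
    have "(A, B) \<in> flag_shadow k n d (schubert k n J)"
      unfolding flag_shadow_def using flag[of 1] C(2)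
      by (intro image_eqI[of _ _ "(A, mark_value C 1, B)"]) (simp_all add: q1_def q2_def)
    moreover have "(A, B) \<in> flag_shadow k n d (opp_schubert k n I)"
      unfolding flag_shadow_def using flag[of 2] C(3)
      by (intro image_eqI[of _ _ "(A, mark_value C 2, B)"]) (simp_all add: q1_def q2_def)
    ultimately show "V \<in> q1 ` {T \<in> Fl3 k n d. q2 T \<in> Y_locus k n I J d}"
      using flag[of 3] C(4)
      by (intro image_eqI[of _ _ "(A, V, B)"]) (simp_all add: q1_def q2_def Y_locus_def)
  qed
qed

end
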